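(* Let $m$ be a fixed positive integer, let $S$ be a non-empty subset of $(\mathbb{Z}/m\mathbb{Z})^{\times}$, and let $A=\{a+mn : a\in S,\ n=0,1,2,\dots\}$, where each $a\in S$ is represented by an integer in $[1,m]$ (so $A$ is the set of positive integers whose residue modulo $m$ lies in $S$). Write the characteristic function of $S$ as $1_S(x)=\sum_{\chi}c_\chi\chi(x)$, the sum over all Dirichlet characters $\chi$ of $(\mathbb{Z}/m\mathbb{Z})^{\times}$, with $c_\chi=\frac{1}{\varphi(m)}\sum_{a\in S}\overline{\chi}(a)$. Let $f$ be a random completely multiplicative function. Then: (i) unless $c_\chi\ge 0$ for every real character $\chi$ and $c_\chi=0$ for every complex (non-real) character $\chi$, there exist $\delta>0$ and $x_0$ such that for all $x\ge x_0$, \[ \mathbb{P}\left(\sum_{n\in A\cap[1,x)}\frac{f(n)}{n}<0\right)>\delta ; \] (ii) if $c_\chi\ge 0$ for every real character $\chi$ and $c_\chi=0$ for every complex character $\chi$, then there is a positive constant $C$ such that \[ \mathbb{P}\left(\sum_{n\in A\cap[1,x)}\frac{f(n)}{n}<0\right)=O\left(\exp\left(-\exp\left(\frac{\ln x}{C\ln_{2}x}\right)\right)\right). \]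
   Context: A random completely multiplicative function $f$ is defined by choosing $f(p)\in\{1,-1\}$ independently for each prime $p$ with $\mathbb{P}(f(p)=1)=\mathbb{P}(f(p)=-1)=1/2$, and extending completely multiplicatively to all positive integers ($f(1)=1$). $\ln_2 x=\ln\ln x$. A character is real if it takes only real values, complex otherwise. $\varphi$ is Euler's totient function. *)

theory Defs
  imports "HOL-Probability.Probability" "HOL-Number_Theory.Number_Theory"
begin

text \<open>Dirichlet characters modulo \<open>m\<close>, i.e. the characters of the unit group of the integers
  modulo \<open>m\<close> in their usual form as \<open>m\<close>-periodic functions vanishing exactly off the units.\<close>

definition dirichlet_character :: "nat \<Rightarrow> (nat \<Rightarrow> complex) \<Rightarrow> bool" where
  "dirichlet_character m \<psi> \<longleftrightarrow>
     \<psi> 1 = 1 \<and>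
     (\<forall>a b. \<psi> (a * b) = \<psi> a * \<psi> b) \<and>
     (\<forall>a. \<psi> (a + m) = \<psi> a) \<and>
     (\<forall>a. \<psi> a = 0 \<longleftrightarrow> \<not> coprime a m)"

definition real_character :: "(nat \<Rightarrow> complex) \<Rightarrow> bool" where
  "real_character \<psi> \<longleftrightarrow> (\<forall>a. \<psi> a \<in> \<real>)"

text \<open>A set of residue classes is given by its representatives in \<open>{1..m}\<close>; this is the
  coefficient of \<open>\<psi>\<close> in the expansion of the indicator of \<open>S\<close> in characters modulo \<open>m\<close>.\<close>

definition char_coeff :: "nat \<Rightarrow> nat set \<Rightarrow> (nat \<Rightarrow> complex) \<Rightarrow> complex" where
  "char_coeff m S \<psi> = (\<Sum>a\<in>S. cnj (\<psi> a)) / of_nat (totient m)"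

definition residue_class_set :: "nat \<Rightarrow> nat set \<Rightarrow> nat set" where
  "residue_class_set m S = {a + m * n | a n. a \<in> S}"

text \<open>The value \<open>f 0\<close> is irrelevant and left unconstrained.\<close>

locale random_completely_multiplicative = prob_space M
  for M :: "'w measure" +
  fixes f :: "nat \<Rightarrow> 'w \<Rightarrow> real"
  assumes indep_primes: "indep_vars (\<lambda>_. borel) f {p. prime p}"
    and prime_values: "\<And>p \<omega>. prime p \<Longrightarrow> \<omega> \<in> space M \<Longrightarrow> f p \<omega> \<in> {1, -1}"
    and prob_plus: "\<And>p. prime p \<Longrightarrow> prob {\<omega> \<in> space M. f p \<omega> = 1} = 1 / 2"
    and prob_minus: "\<And>p. prime p \<Longrightarrow> prob {\<omega> \<in> space M. f p \<omega> = -1} = 1 / 2"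
    and f_one: "\<And>\<omega>. \<omega> \<in> space M \<Longrightarrow> f 1 \<omega> = 1"
    and f_mult: "\<And>a b \<omega>. a > 0 \<Longrightarrow> b > 0 \<Longrightarrow> \<omega> \<in> space M \<Longrightarrow>
                   f (a * b) \<omega> = f a \<omega> * f b \<omega>"

definition prob_negative :: "'w measure \<Rightarrow> (nat \<Rightarrow> 'w \<Rightarrow> real) \<Rightarrow> nat set \<Rightarrow> real \<Rightarrow> real" where
  "prob_negative M f A x =
     measure M {\<omega> \<in> space M. (\<Sum>n | n \<in> A \<and> 1 \<le> n \<and> real n < x. f n \<omega> / real n) < 0}"

end

theory Submission
  imports Defs "HOL-Computational_Algebra.Squarefree" "HOL-Real_Asymp.Real_Asymp"
begin

text \<open>
  Up to a positive factor \<open>1\<^sub>S = \<Sum> c\<^sub>\<psi> \<psi>\<close>, so the sum \<open>T\<close> of \<open>f(n)/n\<close> behaves like \<open>\<Sum> c\<^sub>\<psi> E\<^sub>\<psi>\<close>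
  with \<open>E\<^sub>\<psi> = \<Prod> (1 - \<psi>(p) f(p)/p)^(-1)\<close>.

  (i) Test \<open>T\<close> against the bounded weight \<open>R = \<Prod> (1 + t(p) f(p)) \<ge> 0\<close>, the product over a finite set \<open>F\<close>
  of primes with \<open>\<bar>t(p)\<bar> \<le> 1\<close>. Since \<open>E f(n)\<close> is the indicator of squares, \<open>E[T R]\<close> tends, up to a
  positive factor, to \<open>\<Sum> c\<^sub>\<psi> L(2, \<psi>\<^sup>2) \<Prod> (1 + t(p) \<psi>(p)/p)\<close>. By Dirichlet's theorem \<open>F\<close> and \<open>t\<close> can be
  chosen to make the last product close to \<open>exp (\<Sum> v(a) \<psi>(a))\<close> for any real function \<open>v\<close> on the residue
  classes; with \<open>v\<close> the real part of a complex multiple of an offending character, only the terms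
  of that character and its conjugate change, and they can be made dominant and negative. As \<open>E[T\<^sup>2]\<close> is bounded, \<open>T\<close> is negative with
  probability bounded below.

  (ii) Let \<open>y = exp (ln x / (50 ln ln x))\<close>. The \<open>y\<close>-smooth part of \<open>T\<close> is, up to a Rankin tail, a
  nonnegative combination of positive Euler products and so at least a negative power of \<open>ln x\<close>,
  whatever the signs. Ordering the remaining \<open>n\<close> by their largest prime factor \<open>p > y\<close> gives a
  martingale with increments of size \<open>O(ln x / p)\<close>, plus a negligible part where \<open>p\<^sup>2\<close> divides \<open>n\<close>; its
  exponential moments give the bound.
\<close>

section \<open>Characters modulo m\<close>

text \<open>In (i) no sign is conditioned on: \<open>R\<close> is fixed before x grows, so one bound
  \<open>2 ^ card F\<close> for \<open>R\<close> and one bound 8 for the second moment serve all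
  large x. The primes of \<open>F\<close> must be large, for only then is 1 + t \<psi>(p)/p close to
  its exponential. Large primes in a given class with reciprocal sum near a given value are what
  Dirichlet's theorem, hence L(1, \<psi>) \<noteq> 0, is for. The factor L(2, \<psi>^2) may rotate a
  complex coefficient; being non-zero, it is absorbed by the multiplier exp, which can be any
  non-zero complex number. In (ii) the smooth part is at least a constant times (1 + ln y)^(-3), up
  to a Rankin tail (1 + ln y)^36 exp (- ln x / ln y). With ln y = ln x / (50 ln ln x) that tail is
  of order at most (ln x)^(-14), negligible since 50 > 36 + 3. The rough part fluctuates on the
  scale ln x / sqrt y. The exponential parameter sqrt y therefore gives a probability of about exp
  (- sqrt y / (ln x)^3), where sqrt y = exp (ln x / (100 ln ln x)); passing from 100 to C = 400
  absorbs all powers of ln x.\<close>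

lemma periodic_cong:
  fixes g :: "nat \<Rightarrow> 'a"
  assumes "\<And>a. g (a + m) = g a" "[a = b] (mod m)"
  shows "g a = g b"
proof -
  have *: "g (r + k * m) = g r" for r k
    by (induction k) (simp_all add: assms(1) add.assoc[symmetric] add.commute[of m])
  have "g a = g (a mod m)" for a
    using *[of "a mod m" "a div m"] by (simp add: add.commute)
  then show ?thesis
    using assms(2) by (metis cong_def)
qed

text \<open>As a polynomial in \<omega> the sum has degree below n and non-zero constant
  coefficient, so it cannot vanish at all n roots of unity.\<close>

lemma exists_root_of_unity_component:
  fixes c :: "nat \<Rightarrow> complex"
  assumes n: "n > 0" and c0: "c 0 \<noteq> 0"
  shows "\<exists>\<omega>. \<omega> ^ n = 1 \<and> (\<Sum>k<n. \<omega> ^ k * c k) \<noteq> 0"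
proof (rule ccontr)
  assume "\<not> ?thesis"
  then have z: "(\<Sum>k<n. \<omega> ^ k * c k) = 0" if "\<omega> ^ n = 1" for \<omega>
    using that by blast
  define p where "p = (\<Sum>k<n. Polynomial.monom (c k) k)"
  have "poly p \<omega> = 0" if "\<omega> ^ n = 1" for \<omega>
    using z[OF that] unfolding p_def poly_sum Polynomial.poly_monom by (simp add: mult.commute)
  then have sub: "{\<omega>. \<omega> ^ n = 1} \<subseteq> {\<omega>. poly p \<omega> = 0}"
    by blast
  have coeff0: "poly.coeff p 0 = c 0"
  proof -
    have "poly.coeff p 0 = (\<Sum>k<n. if k = 0 then c k else 0)"
      unfolding p_def by (simp add: coeff_sum)
    then show ?thesis using n by simp
  qed
  then have p0: "p \<noteq> 0"
    using c0 by auto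
  have "degree p < n"
    unfolding p_def
    by (rule le_less_trans[OF degree_sum_le[of _ _ "n - 1"]])
       (use n in \<open>auto intro: order_trans[OF Polynomial.degree_monom_le]\<close>)
  moreover have "card {\<omega>::complex. \<omega> ^ n = 1} \<le> card {\<omega>. poly p \<omega> = 0}"
    by (rule card_mono[OF poly_roots_finite[OF p0] sub])
  moreover have "card {\<omega>::complex. \<omega> ^ n = 1} = n"
    using n by (rule card_roots_unity_eq)
  ultimately show False
    using card_poly_roots_bound[OF p0] by simp
qed

text \<open>Complex functions on the unit group, in the same encoding as
  \<open>dirichlet_character\<close>; translation by a unit g is x -> g * x.\<close>

definition unit_function :: "nat \<Rightarrow> (nat \<Rightarrow> complex) \<Rightarrow> bool" where
  "unit_function m \<phi> \<longleftrightarrow> (\<forall>x. \<phi> (x + m) = \<phi> x) \<and> (\<forall>x. \<not> coprime x m \<longrightarrow> \<phi> x = 0)"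

lemma unit_function_translates:
  assumes "unit_function m \<phi>"
  shows "unit_function m (\<lambda>x. \<Sum>k<n. \<omega> ^ k * \<phi> (g ^ k * x))"
  unfolding unit_function_def
proof (intro conjI allI impI)
  fix x
  have "[g ^ k * (x + m) = g ^ k * x] (mod m)" for k
    by (simp add: cong_def distrib_left)
  then have "\<phi> (g ^ k * (x + m)) = \<phi> (g ^ k * x)" for k
    using periodic_cong[of \<phi> m] assms unfolding unit_function_def by simp
  then show "(\<Sum>k<n. \<omega> ^ k * \<phi> (g ^ k * (x + m))) = (\<Sum>k<n. \<omega> ^ k * \<phi> (g ^ k * x))"
    by simp
next
  fix x assume "\<not> coprime x m"
  then have "\<not> coprime (g ^ k * x) m" for k
    by simp
  then have "\<phi> (g ^ k * x) = 0" for k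
    using assms unfolding unit_function_def by blast
  then show "(\<Sum>k<n. \<omega> ^ k * \<phi> (g ^ k * x)) = 0"
    by simp
qed

text \<open>Each translation has finite order, so a nonzero function has a nonzero component that is an
  eigenvector of it; taking components preserves all eigenvector properties already achieved.\<close>

lemma translation_eigencomponent:
  fixes \<phi> :: "nat \<Rightarrow> complex"
  assumes \<phi>: "unit_function m \<phi>" "\<phi> x0 \<noteq> 0" and g: "coprime g m" and m: "m > 0"
  shows "\<exists>\<omega>. \<omega> ^ totient m = 1 \<and> (\<Sum>k<totient m. \<omega> ^ k * \<phi> (g ^ k * x0)) \<noteq> 0 \<and>
          (\<forall>x. (\<Sum>k<totient m. \<omega> ^ k * \<phi> (g ^ k * (g * x))) = 
               inverse \<omega> * (\<Sum>k<totient m. \<omega> ^ k * \<phi> (g ^ k * x)))"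
proof -
  let ?n = "totient m"
  have n: "?n > 0" using m by simp
  obtain \<omega> where \<omega>: "\<omega> ^ ?n = 1" "(\<Sum>k<?n. \<omega> ^ k * \<phi> (g ^ k * x0)) \<noteq> 0"
    using exists_root_of_unity_component[OF n, of "\<lambda>k. \<phi> (g ^ k * x0)"] \<phi>(2) by auto
  have w0: "\<omega> \<noteq> 0"
    using \<omega>(1) n by (metis power_0_left zero_neq_one neq0_conv)
  have "(\<Sum>k<?n. \<omega> ^ k * \<phi> (g ^ k * (g * x))) = inverse \<omega> * (\<Sum>k<?n. \<omega> ^ k * \<phi> (g ^ k * x))" for x
  proof -
    define F where "F k = \<omega> ^ k * \<phi> (g ^ k * x)" for k
    have "[g ^ ?n = 1] (mod m)"
      by (rule euler_theorem[OF g])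
    then have "[g ^ ?n * x = 1 * x] (mod m)"
      by (rule cong_scalar_right)
    then have "\<phi> (g ^ ?n * x) = \<phi> x"
      using periodic_cong[of \<phi> m] \<phi>(1) unfolding unit_function_def by simp
    \<comment> \<open>This makes the index shift below a cyclic permutation of the summands.\<close>
    then have Fn: "F ?n = F 0"
      using \<omega>(1) by (simp add: F_def)
    have "\<omega> * (\<Sum>k<?n. \<omega> ^ k * \<phi> (g ^ k * (g * x))) = (\<Sum>k<?n. F (Suc k))"
      by (simp add: F_def sum_distrib_left mult_ac)
    also have "\<dots> = (\<Sum>k<?n. F k)"
      using sum.lessThan_Suc_shift[of F "?n"] sum.lessThan_Suc[of F "?n"] Fn by simp
    finally show ?thesis
      using w0 by (simp add: F_def field_simps)
  qed
  then show ?thesis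
    using \<omega> by blast
qed

text \<open>Translations commute, so averaging over the powers of a new g keeps the old eigenvalues.
  The prescribed eigenvalue \<zeta> at \<open>a\<close> is carried along because it will certify
  that the resulting character differs from 1 at \<open>a\<close>.\<close>

lemma common_eigenvector:
  fixes \<phi> :: "nat \<Rightarrow> complex"
  assumes m: "m > 0" and B: "finite B" "\<forall>g\<in>B. coprime g m"
    and \<phi>: "unit_function m \<phi>" "\<exists>x. \<phi> x \<noteq> 0" "\<forall>x. \<phi> (a * x) = \<zeta> * \<phi> x"
  shows "\<exists>\<phi>'. unit_function m \<phi>' \<and> (\<exists>x. \<phi>' x \<noteq> 0) \<and> (\<forall>x. \<phi>' (a * x) = \<zeta> * \<phi>' x) \<and>
           (\<forall>g\<in>B. \<exists>l. \<forall>x. \<phi>' (g * x) = l * \<phi>' x)"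
  using B
proof (induction rule: finite_induct)
  case empty
  then show ?case using \<phi> by blast
next
  case (insert g B)
  then obtain \<psi> where \<psi>: "unit_function m \<psi>" "\<exists>x. \<psi> x \<noteq> 0" "\<forall>x. \<psi> (a * x) = \<zeta> * \<psi> x"
    "\<forall>g\<in>B. \<exists>l. \<forall>x. \<psi> (g * x) = l * \<psi> x"
    by auto
  have g: "coprime g m" using insert.prems by simp
  obtain x0 where x0: "\<psi> x0 \<noteq> 0" using \<psi>(2) by blast
  obtain \<omega> where \<omega>: "(\<Sum>k<totient m. \<omega> ^ k * \<psi> (g ^ k * x0)) \<noteq> 0"
    "\<forall>x. (\<Sum>k<totient m. \<omega> ^ k * \<psi> (g ^ k * (g * x))) = 
               inverse \<omega> * (\<Sum>k<totient m. \<omega> ^ k * \<psi> (g ^ k * x))"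
    using translation_eigencomponent[OF \<psi>(1) x0 g m] by blast
  define \<theta> where "\<theta> x = (\<Sum>k<totient m. \<omega> ^ k * \<psi> (g ^ k * x))" for x
  have eig: "\<theta> (h * x) = l * \<theta> x" if "\<forall>x. \<psi> (h * x) = l * \<psi> x" for h l x
  proof -
    have "\<psi> (g ^ k * (h * x)) = l * \<psi> (g ^ k * x)" for k
      using that[rule_format, of "g ^ k * x"] by (simp add: mult_ac)
    then show ?thesis
      by (simp add: \<theta>_def sum_distrib_left mult_ac)
  qed
  have "unit_function m \<theta>"
    unfolding \<theta>_def[abs_def] by (rule unit_function_translates[OF \<psi>(1)])
  moreover have "\<theta> x0 \<noteq> 0"
    using \<omega>(1) by (simp add: \<theta>_def)
  moreover have "\<theta> (g * x) = inverse \<omega> * \<theta> x" for x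
    using \<omega>(2) by (simp add: \<theta>_def)
  ultimately show ?case
  proof (intro exI[of _ \<theta>] conjI ballI)
    fix h assume "h \<in> insert g B"
    then show "\<exists>l. \<forall>x. \<theta> (h * x) = l * \<theta> x"
      using eig \<psi>(4) \<open>\<And>x. \<theta> (g * x) = inverse \<omega> * \<theta> x\<close> by blast
  qed (use eig \<psi>(3) in blast)+
qed

lemma dirichlet_character_cong:
  assumes "dirichlet_character m \<psi>" "[a = b] (mod m)"
  shows "\<psi> a = \<psi> b"
  using periodic_cong[of \<psi> m a b] assms unfolding dirichlet_character_def by blast

lemma dirichlet_character_one: "dirichlet_character m \<psi> \<Longrightarrow> \<psi> (Suc 0) = 1"
  unfolding dirichlet_character_def by simp

lemma dirichlet_character_mult: "dirichlet_character m \<psi> \<Longrightarrow> \<psi> (a * b) = \<psi> a * \<psi> b"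
  unfolding dirichlet_character_def by blast

lemma dirichlet_character_power: "dirichlet_character m \<psi> \<Longrightarrow> \<psi> (a ^ k) = \<psi> a ^ k"
  by (induction k) (simp_all add: dirichlet_character_one dirichlet_character_mult)

lemma dirichlet_character_eq_0_iff: "dirichlet_character m \<psi> \<Longrightarrow> \<psi> a = 0 \<longleftrightarrow> \<not> coprime a m"
  unfolding dirichlet_character_def by blast

lemma dirichlet_character_power_totient:
  assumes "dirichlet_character m \<psi>" "coprime a m"
  shows "\<psi> a ^ totient m = 1"
proof -
  have "\<psi> (a ^ totient m) = \<psi> 1"
    by (rule dirichlet_character_cong[OF assms(1)]) (rule euler_theorem[OF assms(2)])
  then show ?thesis
    using dirichlet_character_one[OF assms(1)] dirichlet_character_power[OF assms(1)] by simp
qed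

lemma dirichlet_character_norm:
  assumes "m > 0" "dirichlet_character m \<psi>"
  shows "norm (\<psi> a) = (if coprime a m then 1 else 0)"
proof (cases "coprime a m")
  case True
  have "norm (\<psi> a) ^ totient m = 1"
    using dirichlet_character_power_totient[OF assms(2) True] by (metis norm_one norm_power)
  then have "norm (\<psi> a) = 1"
    using power_eq_1_iff[of "norm (\<psi> a)" "totient m"] assms(1)
    by (metis norm_ge_zero power_eq_imp_eq_base power_one totient_gt_0_iff zero_le_one)
  then show ?thesis using True by simp
next
  case False
  then show ?thesis using assms(2) by (simp add: dirichlet_character_eq_0_iff)
qed

lemma dirichlet_character_norm_le_1:
  assumes "m > 0" "dirichlet_character m \<psi>"
  shows "norm (\<psi> a) \<le> 1"
  using dirichlet_character_norm[OF assms] by simp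

lemma dirichlet_character_mult_cnj:
  assumes "m > 0" "dirichlet_character m \<psi>"
  shows "\<psi> a * cnj (\<psi> a) = (if coprime a m then 1 else 0)"
  using dirichlet_character_norm[OF assms, of a] complex_norm_square[of "\<psi> a"] by auto

text \<open>The starting function is the indicator of 1 minus that of the inverse of a. Its sum over
  the powers of a telescopes to zero, so the component found at 1 must belong to some \<omega>
  \<noteq> 1. A common eigenvector of all translations with this eigenvalue at a then yields the
  character.\<close>

lemma exists_separating_character:
  assumes m: "m > 0" and a: "coprime a m" "\<not> [a = 1] (mod m)"
  shows "\<exists>\<psi>. dirichlet_character m \<psi> \<and> \<psi> a \<noteq> 1"
proof -
  define \<delta> :: "nat \<Rightarrow> complex" where "\<delta> x = of_bool ([x = 1] (mod m))" for x
  define \<phi> where "\<phi> x = \<delta> x - \<delta> (a * x)" for x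
  have \<delta>per: "\<delta> x = \<delta> y" if "[x = y] (mod m)" for x y
    using that unfolding \<delta>_def by (auto simp: cong_def)
  have un: "unit_function m \<phi>"
    unfolding unit_function_def
  proof (intro conjI allI impI)
    fix x
    have "[x + m = x] (mod m)" "[a * (x + m) = a * x] (mod m)"
      by (simp_all add: cong_def distrib_left)
    then show "\<phi> (x + m) = \<phi> x"
      unfolding \<phi>_def by (simp add: \<delta>per[of "x + m" x] \<delta>per[of "a * (x + m)" "a * x"])
  next
    fix x assume x: "\<not> coprime x m"
    have "\<delta> y = 0" if "\<not> coprime y m" for y
    proof -
      have "\<not> [y = 1] (mod m)"
        using that by (metis cong_imp_coprime cong_sym coprime_1_left)
      then show ?thesis by (simp add: \<delta>_def)
    qed
    then show "\<phi> x = 0"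
      using x unfolding \<phi>_def by (simp add: x)
  qed
  have "\<phi> 1 \<noteq> 0"
    using a(2) by (simp add: \<phi>_def \<delta>_def)
  then obtain \<omega> where \<omega>: "\<omega> ^ totient m = 1" "(\<Sum>k<totient m. \<omega> ^ k * \<phi> (a ^ k * 1)) \<noteq> 0"
      "\<forall>x. (\<Sum>k<totient m. \<omega> ^ k * \<phi> (a ^ k * (a * x))) = 
               inverse \<omega> * (\<Sum>k<totient m. \<omega> ^ k * \<phi> (a ^ k * x))"
    using translation_eigencomponent[OF un _ a(1) m] by blast
  define \<theta> where "\<theta> x = (\<Sum>k<totient m. \<omega> ^ k * \<phi> (a ^ k * x))" for x
  have "\<omega> \<noteq> 1"
  proof
    assume "\<omega> = 1"
    have "(\<Sum>k<totient m. \<phi> (a ^ k * 1)) = \<delta> 1 - \<delta> (a ^ totient m)"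
      unfolding \<phi>_def using sum_lessThan_telescope'[of "\<lambda>k. \<delta> (a ^ k)" "totient m"] by simp
    also have "\<dots> = 0"
      using \<delta>per[OF euler_theorem[OF a(1)]] by simp
    finally show False
      using \<omega>(2) \<open>\<omega> = 1\<close> by simp
  qed
  have un\<theta>: "unit_function m \<theta>"
    unfolding \<theta>_def[abs_def] by (rule unit_function_translates[OF un])
  have "\<exists>x. \<theta> x \<noteq> 0" "\<forall>x. \<theta> (a * x) = inverse \<omega> * \<theta> x"
    using \<omega>(2,3) unfolding \<theta>_def by blast+
  then have "\<exists>\<phi>'. unit_function m \<phi>' \<and> (\<exists>x. \<phi>' x \<noteq> 0) \<and>
      (\<forall>x. \<phi>' (a * x) = inverse \<omega> * \<phi>' x) \<and>
      (\<forall>g\<in>{g\<in>{..<m}. coprime g m}. \<exists>l. \<forall>x. \<phi>' (g * x) = l * \<phi>' x)"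
    by (intro common_eigenvector[OF m _ _ un\<theta>]) auto
  then obtain \<phi>' where \<phi>': "unit_function m \<phi>'" "\<exists>x. \<phi>' x \<noteq> 0" "\<forall>x. \<phi>' (a * x) = inverse \<omega> * \<phi>' x"
    "\<forall>g\<in>{g\<in>{..<m}. coprime g m}. \<exists>l. \<forall>x. \<phi>' (g * x) = l * \<phi>' x"
    by blast
  have cong': "\<phi>' x = \<phi>' y" if "[x = y] (mod m)" for x y
    using periodic_cong[of \<phi>' m] \<phi>'(1) that unfolding unit_function_def by blast
  have van: "\<phi>' x = 0" if "\<not> coprime x m" for x
    using \<phi>'(1) that unfolding unit_function_def by blast
  obtain x0 where x0: "\<phi>' x0 \<noteq> 0" using \<phi>'(2) by blast
  have ev: "\<exists>l. \<forall>x. \<phi>' (g * x) = l * \<phi>' x" for g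
  proof (cases "coprime g m")
    case True
    then have "g mod m \<in> {g\<in>{..<m}. coprime g m}"
      using m by simp
    then obtain l where l: "\<forall>x. \<phi>' ((g mod m) * x) = l * \<phi>' x"
      using \<phi>'(4) by blast
    have "\<phi>' (g * x) = \<phi>' ((g mod m) * x)" for x
      by (rule cong') (simp add: cong_def mod_mult_left_eq)
    then show ?thesis using l by auto
  next
    case False
    then have "\<phi>' (g * x) = 0" for x
      by (intro van) simp
    then show ?thesis by (intro exI[of _ 0]) simp
  qed
  \<comment> \<open>The eigenvalue of translation by g. Eigenvalues of a common eigenvector
    multiply, and a non-unit g sends it to zero.\<close>
  define \<kappa> where "\<kappa> g = \<phi>' (g * x0) / \<phi>' x0" for g
  have ch: "\<phi>' (g * x) = \<kappa> g * \<phi>' x" for g x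
  proof -
    obtain l where l: "\<forall>x. \<phi>' (g * x) = l * \<phi>' x" using ev by blast
    then have "\<kappa> g = l" using x0 by (simp add: \<kappa>_def)
    then show ?thesis using l by simp
  qed
  have ch1: "\<kappa> 1 = 1" using x0 by (simp add: \<kappa>_def)
  have chm: "\<kappa> (g * h) = \<kappa> g * \<kappa> h" for g h
  proof -
    have "\<kappa> (g * h) * \<phi>' x0 = \<phi>' (g * (h * x0))"
      using ch[of "g * h" x0] by (simp add: mult_ac)
    also have "\<dots> = \<kappa> g * \<kappa> h * \<phi>' x0" by (simp add: ch)
    finally show ?thesis using x0 by simp
  qed
  have chper: "\<kappa> g = \<kappa> h" if "[g = h] (mod m)" for g h
    unfolding \<kappa>_def using cong'[OF cong_scalar_right[OF that]] by metis
  have ch0: "\<kappa> g = 0 \<longleftrightarrow> \<not> coprime g m" for g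
  proof
    assume "\<kappa> g = 0"
    show "\<not> coprime g m"
    proof
      assume g: "coprime g m"
      have "\<kappa> (g ^ totient m) = 1"
        using chper[OF euler_theorem[OF g]] ch1 by simp
      moreover have "totient m = Suc (totient m - 1)" using m by simp
      ultimately have "\<kappa> (g * g ^ (totient m - 1)) = 1" by (metis power_Suc)
      then show False using \<open>\<kappa> g = 0\<close> by (simp add: chm)
    qed
  next
    assume "\<not> coprime g m"
    then have "\<phi>' (g * x0) = 0" by (intro van) simp
    then show "\<kappa> g = 0" by (simp add: \<kappa>_def)
  qed
  have "dirichlet_character m \<kappa>"
    unfolding dirichlet_character_def
  proof (intro conjI allI)
    show "\<kappa> (g + m) = \<kappa> g" for g
      by (rule chper) (simp add: cong_def)
  qed (rule ch1 chm ch0)+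
  moreover have "\<kappa> a = inverse \<omega>"
    using \<phi>'(3) x0 by (simp add: \<kappa>_def)
  ultimately show ?thesis
    using \<open>\<omega> \<noteq> 1\<close> by (metis inverse_1 inverse_inverse_eq)
qed

section \<open>Orthogonality of the characters modulo m\<close>

abbreviation characters :: "nat \<Rightarrow> (nat \<Rightarrow> complex) set" where
  "characters m \<equiv> {\<psi>. dirichlet_character m \<psi>}"

lemma finite_characters:
  assumes m: "m > 0"
  shows "finite (characters m)"
proof -
  define V where "V = insert 0 {z::complex. z ^ totient m = 1}"
  have "finite {z::complex. z ^ totient m = 1}"
    using card_roots_unity_eq[of "totient m"] m card_ge_0_finite by fastforce
  then have "finite (PiE {..<m} (\<lambda>_. V))"
    by (intro finite_PiE) (auto simp: V_def)
  moreover have "(\<lambda>\<psi>. restrict \<psi> {..<m}) ` characters m \<subseteq> PiE {..<m} (\<lambda>_. V)"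
    unfolding V_def
    by (intro image_subsetI restrict_PiE[THEN iffD2] Pi_I)
       (auto simp: dirichlet_character_eq_0_iff intro: dirichlet_character_power_totient)
  moreover have "inj_on (\<lambda>\<psi>. restrict \<psi> {..<m}) (characters m)"
  proof (rule inj_onI, rule ext)
    fix \<psi> \<psi>' x
    assume *: "\<psi> \<in> characters m" "\<psi>' \<in> characters m" "restrict \<psi> {..<m} = restrict \<psi>' {..<m}"
    have "\<psi> x = \<psi> (x mod m)" "\<psi>' x = \<psi>' (x mod m)"
      using * by (auto intro!: dirichlet_character_cong simp: cong_def)
    moreover have "\<psi> (x mod m) = \<psi>' (x mod m)"
      using fun_cong[OF *(3), of "x mod m"] m by simp
    ultimately show "\<psi> x = \<psi>' x" by simp
  qed
  ultimately show ?thesis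
    by (meson finite_imageD finite_subset)
qed

definition principal_character :: "nat \<Rightarrow> nat \<Rightarrow> complex" where
  "principal_character m a = of_bool (coprime a m)"

lemma dirichlet_character_principal: "dirichlet_character m (principal_character m)"
proof -
  have "coprime (a + m) m \<longleftrightarrow> coprime a m" for a
    by (metis coprime_iff_gcd_eq_1 gcd_add1)
  then show ?thesis
    unfolding dirichlet_character_def principal_character_def by simp
qed

lemma dirichlet_character_times:
  assumes "dirichlet_character m \<psi>" "dirichlet_character m \<psi>'"
  shows "dirichlet_character m (\<lambda>a. \<psi> a * \<psi>' a)"
  using assms unfolding dirichlet_character_def by (auto simp: mult_ac)

lemma dirichlet_character_cnj:
  assumes "dirichlet_character m \<psi>"
  shows "dirichlet_character m (\<lambda>a. cnj (\<psi> a))"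
  using assms unfolding dirichlet_character_def by auto

lemma card_characters_pos: "m > 0 \<Longrightarrow> card (characters m) > 0"
  using dirichlet_character_principal finite_characters by (auto simp: card_gt_0_iff)

text \<open>Multiplication by a character \<kappa> with \<kappa>(a) \<noteq> 1 permutes the
  characters and multiplies the sum by \<kappa>(a). The number of characters is left as
  \<open>card (characters m)\<close>.\<close>

lemma sum_characters:
  assumes m: "m > 0" and a: "coprime a m"
  shows "(\<Sum>\<psi>\<in>characters m. \<psi> a) = (if [a = 1] (mod m) then of_nat (card (characters m)) else 0)"
proof (cases "[a = 1] (mod m)")
  case True
  then have "\<psi> a = 1" if "\<psi> \<in> characters m" for \<psi>
    using that dirichlet_character_cong[of m \<psi> a 1] dirichlet_character_one[of m \<psi>] by auto
  then have "(\<Sum>\<psi>\<in>characters m. \<psi> a) = (\<Sum>\<psi>\<in>characters m. 1)"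
    by (intro sum.cong) auto
  then show ?thesis using True by simp
next
  case False
  obtain \<kappa> where \<kappa>: "dirichlet_character m \<kappa>" "\<kappa> a \<noteq> 1"
    using exists_separating_character[OF m a False] by blast
  have unit: "cnj (\<kappa> x) * (\<kappa> x * \<psi> x) = \<psi> x" "\<kappa> x * (cnj (\<kappa> x) * \<psi> x) = \<psi> x"
    if "\<psi> \<in> characters m" for \<psi> x
    using dirichlet_character_mult_cnj[OF m \<kappa>(1), of x] dirichlet_character_eq_0_iff[of m \<psi> x] that
    by (cases "coprime x m"; simp add: mult.assoc[symmetric] mult.commute)+
  have "(\<Sum>\<psi>\<in>characters m. \<psi> a) = (\<Sum>\<psi>\<in>characters m. \<kappa> a * \<psi> a)"
    by (rule sum.reindex_bij_witness[of _ "\<lambda>\<psi> x. \<kappa> x * \<psi> x" "\<lambda>\<psi> x. cnj (\<kappa> x) * \<psi> x"])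
       (use unit in \<open>auto intro!: dirichlet_character_times dirichlet_character_cnj \<kappa>\<close>)
  then have "(1 - \<kappa> a) * (\<Sum>\<psi>\<in>characters m. \<psi> a) = 0"
    by (simp add: sum_distrib_left[symmetric] left_diff_distrib)
  then show ?thesis using \<kappa>(2) False by simp
qed

lemma sum_characters_cnj:
  assumes m: "m > 0" and a: "coprime a m"
  shows "(\<Sum>\<psi>\<in>characters m. cnj (\<psi> a) * \<psi> b) =
    (if [a = b] (mod m) then of_nat (card (characters m)) else 0)"
proof (cases "coprime b m")
  case True
  obtain a' where a': "[a * a' = 1] (mod m)"
    using cong_solve_coprime_nat[OF a] by auto
  have cop: "coprime a' m"
    using a' by (metis cong_imp_coprime cong_sym coprime_1_left coprime_mult_left_iff)
  have "cnj (\<psi> a) * \<psi> b = \<psi> (a' * b)" if "\<psi> \<in> characters m" for \<psi>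
  proof -
    have "\<psi> a * \<psi> a' = 1"
      using that a' dirichlet_character_cong[of m \<psi> "a * a'" 1] dirichlet_character_one[of m \<psi>]
        dirichlet_character_mult[of m \<psi>] by auto
    moreover have "\<psi> a * cnj (\<psi> a) = 1"
      using that a dirichlet_character_mult_cnj[OF m] by auto
    ultimately have "cnj (\<psi> a) = \<psi> a'"
      by (metis mult.assoc mult.commute mult.right_neutral)
    then show ?thesis using that by (simp add: dirichlet_character_mult)
  qed
  then have "(\<Sum>\<psi>\<in>characters m. cnj (\<psi> a) * \<psi> b) = (\<Sum>\<psi>\<in>characters m. \<psi> (a' * b))"
    by simp
  also have "\<dots> = (if [a' * b = 1] (mod m) then of_nat (card (characters m)) else 0)"
    using cop True by (intro sum_characters[OF m]) simp
  also have "[a' * b = 1] (mod m) \<longleftrightarrow> [a = b] (mod m)"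
  proof
    assume "[a' * b = 1] (mod m)"
    then have "[a * (a' * b) = a * 1] (mod m)" by (rule cong_scalar_left)
    moreover have "[(a * a') * b = 1 * b] (mod m)" using a' by (rule cong_scalar_right)
    ultimately show "[a = b] (mod m)"
      by (metis cong_sym cong_trans mult.assoc mult.right_neutral mult_1)
  next
    assume "[a = b] (mod m)"
    then have "[a' * a = a' * b] (mod m)" by (rule cong_scalar_left)
    then show "[a' * b = 1] (mod m)"
      using a' by (metis cong_sym cong_trans mult.commute)
  qed
  finally show ?thesis .
next
  case False
  then have "\<not> [a = b] (mod m)"
    using a by (metis cong_imp_coprime)
  moreover have "(\<Sum>\<psi>\<in>characters m. cnj (\<psi> a) * \<psi> b) = 0"
    using False by (intro sum.neutral) (simp add: dirichlet_character_eq_0_iff)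
  ultimately show ?thesis by simp
qed

text \<open>Multiplication by some g with \<psi>(g) \<noteq> 1 permutes the residues and multiplies
  the sum by \<psi>(g).\<close>

lemma sum_character_totatives:
  assumes m: "m > 0" and \<psi>: "dirichlet_character m \<psi>" "\<psi> \<noteq> principal_character m"
  shows "(\<Sum>a\<in>{..<m}. \<psi> a) = 0"
proof -
  obtain g where g: "\<psi> g \<noteq> principal_character m g" using \<psi>(2) by blast
  have cg: "coprime g m"
    using g dirichlet_character_eq_0_iff[OF \<psi>(1), of g] unfolding principal_character_def
    by (cases "coprime g m") auto
  then have g1: "\<psi> g \<noteq> 1" using g by (simp add: principal_character_def)
  obtain h where h: "[g * h = 1] (mod m)"
    using cong_solve_coprime_nat[OF cg] by auto
  have red: "\<psi> (x mod m) = \<psi> x" for x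
    by (rule dirichlet_character_cong[OF \<psi>(1)]) (simp add: cong_def)
  have inv: "(h * ((g * x) mod m)) mod m = x" "(g * ((h * x) mod m)) mod m = x" if "x < m" for x
  proof -
    have "[g * h * x = 1 * x] (mod m)" using h by (rule cong_scalar_right)
    then have *: "(g * h * x) mod m = x" using that by (simp add: cong_def)
    then show "(h * ((g * x) mod m)) mod m = x" "(g * ((h * x) mod m)) mod m = x"
      by (simp_all add: mod_mult_right_eq mult_ac)
  qed
  have "(\<Sum>a<m. \<psi> a) = (\<Sum>a<m. \<psi> ((g * a) mod m))"
    by (rule sum.reindex_bij_witness[of _ "\<lambda>a. (g * a) mod m" "\<lambda>a. (h * a) mod m"])
       (use inv m in auto)
  also have "\<dots> = \<psi> g * (\<Sum>a<m. \<psi> a)"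
    by (simp add: red dirichlet_character_mult[OF \<psi>(1)] sum_distrib_left)
  finally have "(1 - \<psi> g) * (\<Sum>a<m. \<psi> a) = 0"
    by (simp add: algebra_simps)
  then show ?thesis using g1 by simp
qed

section \<open>Euler products and character sums\<close>

lemma has_sum_times:
  fixes f :: "'i \<Rightarrow> 'a :: {real_normed_field, banach}" and g :: "'j \<Rightarrow> 'a"
  assumes f: "(\<lambda>x. norm (f x)) summable_on A" "(f has_sum a) A"
    and g: "(\<lambda>y. norm (g y)) summable_on B" "(g has_sum b) B"
  shows "(\<lambda>(x, y). norm (f x * g y)) summable_on A \<times> B"
    and "((\<lambda>(x, y). f x * g y) has_sum a * b) (A \<times> B)"
proof -
  have "(\<lambda>(x, y). norm (f x) * norm (g y)) summable_on A \<times> B"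
  proof (rule summable_on_SigmaI)
    show "((\<lambda>y. case (x, y) of (x, y) \<Rightarrow> norm (f x) * norm (g y)) has_sum
            norm (f x) * (\<Sum>\<^sub>\<infinity>y\<in>B. norm (g y))) B" for x
      using has_sum_cmult_right[OF has_sum_infsum[OF g(1)], of "norm (f x)"] by simp
    show "(\<lambda>x. norm (f x) * (\<Sum>\<^sub>\<infinity>y\<in>B. norm (g y))) summable_on A"
      using f(1) by (rule summable_on_cmult_left)
  qed auto
  then show abs: "(\<lambda>(x, y). norm (f x * g y)) summable_on A \<times> B"
    by (simp add: norm_mult)
  show "((\<lambda>(x, y). f x * g y) has_sum a * b) (A \<times> B)"
  proof (rule has_sum_SigmaI)
    show "((\<lambda>y. case (x, y) of (x, y) \<Rightarrow> f x * g y) has_sum f x * b) B" for x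
      using has_sum_cmult_right[OF g(2), of "f x"] by simp
    show "((\<lambda>x. f x * b) has_sum a * b) A"
      using has_sum_cmult_left[OF f(2), of b] by simp
    show "(\<lambda>(x, y). f x * g y) summable_on A \<times> B"
      by (rule Infinite_Sum.abs_summable_summable) (use abs in \<open>simp add: case_prod_unfold\<close>)
  qed
qed

definition smooth :: "nat set \<Rightarrow> nat set" where
  "smooth P = {n. n > 0 \<and> prime_factors n \<subseteq> P}"

text \<open>Unique factorization in the form that makes one more prime multiply the sum over
  \<open>smooth P\<close> by a geometric series; the multiplicity of p recovers the
  exponent.\<close>

lemma smooth_insert:
  assumes p: "prime p" "p \<notin> P" and P: "\<And>q. q \<in> P \<Longrightarrow> prime q"
  shows "smooth (insert p P) = (\<lambda>(k, n). p ^ k * n) ` (UNIV \<times> smooth P)"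
    and "inj_on (\<lambda>(k, n). p ^ k * n) (UNIV \<times> smooth P)"
proof -
  have ndvd: "\<not> p dvd n" if "n \<in> smooth P" for n
    using that p by (auto simp: smooth_def in_prime_factors_iff)
  show "smooth (insert p P) = (\<lambda>(k, n). p ^ k * n) ` (UNIV \<times> smooth P)"
  proof (intro equalityI subsetI)
    fix n assume n: "n \<in> smooth (insert p P)"
    then have n0: "n \<noteq> 0" by (simp add: smooth_def)
    obtain y where y: "n = p ^ multiplicity p n * y" "\<not> p dvd y"
      using multiplicity_decompose'[of n p] n0 p(1) by (metis not_prime_unit)
    have y0: "y \<noteq> 0" using y(1) n0 by (metis mult_0_right)
    have "prime_factors y \<subseteq> prime_factors n"
      by (rule dvd_prime_factors[OF n0]) (use y(1) in \<open>metis dvd_triv_right\<close>)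
    moreover have "p \<notin> prime_factors y"
      using y(2) by (auto simp: in_prime_factors_iff)
    ultimately have "y \<in> smooth P"
      using n y0 by (auto simp: smooth_def)
    then show "n \<in> (\<lambda>(k, n). p ^ k * n) ` (UNIV \<times> smooth P)"
      using y(1) by (intro image_eqI[of _ _ "(multiplicity p n, y)"]) auto
  next
    fix n assume "n \<in> (\<lambda>(k, n). p ^ k * n) ` (UNIV \<times> smooth P)"
    then obtain k y where ky: "n = p ^ k * y" "y \<in> smooth P" by auto
    have "p ^ k \<noteq> 0" "y \<noteq> 0" using p(1) ky(2) by (auto simp: smooth_def)
    moreover have "prime_factors (p ^ k) \<subseteq> {p}"
      using p(1) prime_dvd_power primes_dvd_imp_eq by (auto simp: in_prime_factors_iff) blast
    ultimately show "n \<in> smooth (insert p P)"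
      using ky by (auto simp: smooth_def prime_factors_product)
  qed
  show "inj_on (\<lambda>(k, n). p ^ k * n) (UNIV \<times> smooth P)"
  proof (rule inj_onI, clarify)
    fix k n k' n' assume *: "n \<in> smooth P" "n' \<in> smooth P" "p ^ k * n = p ^ k' * n'"
    have m: "multiplicity p (p ^ j * i) = j" if "i \<in> smooth P" for i j
    proof -
      have "i \<noteq> 0" using that by (simp add: smooth_def)
      then have "multiplicity p (p ^ j * i) = multiplicity p (p ^ j) + multiplicity p i"
        using p(1) by (intro prime_elem_multiplicity_mult_distrib) auto
      moreover have "multiplicity p i = 0" using ndvd[OF that] by (rule not_dvd_imp_multiplicity_0)
      ultimately show ?thesis using p(1) by simp
    qed
    have "k = k'" using m *(1,2,3) by metis
    then show "k = k' \<and> n = n'" using * p(1) by simp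
  qed
qed

lemma power_of_completely_multiplicative:
  fixes g :: "nat \<Rightarrow> 'a :: monoid_mult"
  assumes "g 1 = 1" "\<And>a b. a > 0 \<Longrightarrow> b > 0 \<Longrightarrow> g (a * b) = g a * g b" "p > 0"
  shows "g (p ^ k) = g p ^ k"
  using assms by (induction k) auto

text \<open>Absolute convergence comes from finitely many geometric series alone. The identity
  therefore covers \<psi>(n) f(n)/n, which is not absolutely summable over all n.\<close>

theorem euler_product_finite:
  fixes g :: "nat \<Rightarrow> 'a :: {real_normed_field, banach}"
  assumes g: "g 1 = 1" "\<And>a b. a > 0 \<Longrightarrow> b > 0 \<Longrightarrow> g (a * b) = g a * g b"
    and P: "finite P" "\<And>p. p \<in> P \<Longrightarrow> prime p" "\<And>p. p \<in> P \<Longrightarrow> norm (g p) < 1"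
  shows "(\<lambda>n. norm (g n)) summable_on smooth P" "(g has_sum (\<Prod>p\<in>P. 1 / (1 - g p))) (smooth P)"
proof -
  have "(\<lambda>n. norm (g n)) summable_on smooth P \<and> (g has_sum (\<Prod>p\<in>P. 1 / (1 - g p))) (smooth P)"
    using P
  proof (induction P rule: finite_induct)
    case empty
    have "smooth {} = {1}"
      by (auto simp: smooth_def prime_factorization_empty_iff)
    then show ?case using g(1) by (auto simp: has_sum_finite_iff)
  next
    case (insert p P)
    have IH: "(\<lambda>n. norm (g n)) summable_on smooth P" "(g has_sum (\<Prod>p\<in>P. 1 / (1 - g p))) (smooth P)"
      using insert by auto
    have p: "prime p" "p > 0" using insert.prems(1)[of p] by (auto simp: prime_gt_0_nat)
    have np: "norm (g p) < 1" using insert.prems(2) by simp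
    have "summable (\<lambda>k. norm (g p ^ k))"
      using np by (simp add: norm_power summable_geometric)
    then have geo: "(\<lambda>k. norm (g p ^ k)) summable_on UNIV"
      "((\<lambda>k. g p ^ k) has_sum 1 / (1 - g p)) UNIV"
      using norm_summable_imp_has_sum[OF _ geometric_sums[OF np]]
        norm_summable_imp_summable_on[of "\<lambda>k. norm (g p ^ k)"] by auto
    note si = smooth_insert[OF p(1) insert.hyps(2), OF insert.prems(1)]
    have gm: "g (case z of (k, n) \<Rightarrow> p ^ k * n) = (case z of (k, n) \<Rightarrow> g p ^ k * g n)"
      if "z \<in> UNIV \<times> smooth P" for z
      using that p g(2) power_of_completely_multiplicative[OF g p(2)]
      by (auto simp: smooth_def split: prod.splits)
    have inj: "inj_on (\<lambda>(k, n). p ^ k * n) (UNIV \<times> smooth P)"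
      by (rule si(2)) auto
    have eq: "(\<lambda>(k, n). norm (g p ^ k * g n)) summable_on UNIV \<times> smooth P
       \<longleftrightarrow> (\<lambda>n. norm (g n)) summable_on (\<lambda>(k, n). p ^ k * n) ` (UNIV \<times> smooth P)"
      unfolding summable_on_reindex[OF inj] o_def
      by (intro summable_on_cong) (auto simp: gm split: prod.splits)
    have eq2: "((\<lambda>(k, n). g p ^ k * g n) has_sum S) (UNIV \<times> smooth P)
       \<longleftrightarrow> (g has_sum S) ((\<lambda>(k, n). p ^ k * n) ` (UNIV \<times> smooth P))" for S
      unfolding has_sum_reindex[OF inj] o_def
      by (intro has_sum_cong) (simp add: gm)
    have img: "smooth (insert p P) = (\<lambda>(k, n). p ^ k * n) ` (UNIV \<times> smooth P)"
      by (rule si(1)) auto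
    show ?case
      using has_sum_times[OF geo IH] eq eq2 insert.hyps unfolding img by simp
  qed
  then show "(\<lambda>n. norm (g n)) summable_on smooth P" "(g has_sum (\<Prod>p\<in>P. 1 / (1 - g p))) (smooth P)" by auto
qed

section \<open>Bounds for zeta near 1 by telescoping\<close>

lemma powr_telescope_bounds:
  fixes e :: real and n :: nat
  assumes e: "e > 0" and n: "n > 0"
  shows "e * real (Suc n) powr (- 1 - e) \<le> real n powr - e - real (Suc n) powr - e"
    and "real n powr - e - real (Suc n) powr - e \<le> e * real n powr (- 1 - e)"
proof -
  have "\<exists>z. real n < z \<and> z < real (Suc n) \<and>
      real (Suc n) powr - e - real n powr - e = (real (Suc n) - real n) * (- e * z powr (- e - 1))"
    using n by (intro MVT2) (auto intro!: derivative_eq_intros)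
  then obtain z where z0: "real n < z" "z < real (Suc n)"
    "real (Suc n) powr - e - real n powr - e = (real (Suc n) - real n) * (- e * z powr (- e - 1))"
    by blast
  have "- e - 1 = - 1 - e" by simp
  with z0(3) have z: "real n < z" "z < real (Suc n)"
    "real n powr - e - real (Suc n) powr - e = e * z powr (- 1 - e)"
    using z0 by simp_all
  have "real (Suc n) powr (- 1 - e) \<le> z powr (- 1 - e)" "z powr (- 1 - e) \<le> real n powr (- 1 - e)"
    using z n e by (auto intro!: powr_mono2')
  then show "e * real (Suc n) powr (- 1 - e) \<le> real n powr - e - real (Suc n) powr - e"
    "real n powr - e - real (Suc n) powr - e \<le> e * real n powr (- 1 - e)"
    unfolding z(3) using e by simp_all
qed

text \<open>The term n = 0 contributes nothing, because \<open>0 powr x = 0\<close>.\<close>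

abbreviation zeta :: "real \<Rightarrow> real" where
  "zeta s \<equiv> (\<Sum>n. real n powr - s)"

lemma summable_zeta: "s > 1 \<Longrightarrow> summable (\<lambda>n. real n powr - s)"
  by (simp add: summable_real_powr_iff)

lemma zeta_bounds:
  assumes s: "s > (1::real)"
  shows "1 / (s - 1) \<le> zeta s" "zeta s \<le> 1 + 1 / (s - 1)"
proof -
  define e where "e = s - 1"
  have e: "e > 0" "- s = - 1 - e" using s by (auto simp: e_def)
  have lim: "(\<lambda>N. real (Suc N) powr - e) \<longlonglongrightarrow> 0"
    using e(1) by real_asymp
  have tele: "(\<Sum>n<N. real (Suc n) powr - e - real (Suc (Suc n)) powr - e) = 1 - real (Suc N) powr - e" for N
    using sum_lessThan_telescope'[of "\<lambda>n. real (Suc n) powr - e" N] by simp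
  have sumS: "summable (\<lambda>n. real (Suc n) powr - s)"
    using summable_zeta[OF s] by (subst summable_Suc_iff)
  have shift: "zeta s = (\<Sum>n. real (Suc n) powr - s)"
    using suminf_split_head[OF summable_zeta[OF s]] by simp
  have shift2: "zeta s = 1 + (\<Sum>n. real (Suc (Suc n)) powr - s)"
    unfolding shift using suminf_split_head[OF sumS] by simp
  have sums: "(\<lambda>n. real (Suc n) powr - e - real (Suc (Suc n)) powr - e) sums (1 - 0)"
    unfolding sums_def tele by (intro tendsto_intros lim)
  have "1 / e = (\<Sum>n. (real (Suc n) powr - e - real (Suc (Suc n)) powr - e) / e)"
    using sums_unique[OF sums_divide[OF sums, of e]] by simp
  also have "\<dots> \<le> zeta s" unfolding shift
    using powr_telescope_bounds(2)[OF e(1) zero_less_Suc] e(1) unfolding e(2)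
    by (intro suminf_le sumS[unfolded e(2)] sums_summable[OF sums_divide[OF sums]])
       (simp add: divide_le_eq mult.commute del: of_nat_Suc)
  finally show "1 / (s - 1) \<le> zeta s" by (simp add: e_def)
  have "(\<Sum>n. real (Suc (Suc n)) powr - s) \<le> (\<Sum>n. (real (Suc n) powr - e - real (Suc (Suc n)) powr - e) / e)"
    using powr_telescope_bounds(1)[OF e(1) zero_less_Suc] e(1) sumS unfolding e(2)
    by (intro suminf_le sums_summable[OF sums_divide[OF sums]])
       (simp_all del: of_nat_Suc add: le_divide_eq mult.commute summable_Suc_iff[of "\<lambda>n. real (Suc n) powr _"])
  also have "\<dots> = 1 / e"
    using sums_unique[OF sums_divide[OF sums, of e]] by simp
  finally show "zeta s \<le> 1 + 1 / (s - 1)" unfolding shift2 by (simp add: e_def)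
qed

text \<open>Full periods cancel, so fewer than m terms of norm at most 1 survive.\<close>

lemma norm_sum_character_le:
  assumes m: "m > 0" and \<psi>: "dirichlet_character m \<psi>" "\<psi> \<noteq> principal_character m"
  shows "norm (\<Sum>n<N. \<psi> n) \<le> real m"
proof -
  have per: "(\<Sum>n<q * m + r. \<psi> n) = (\<Sum>n<r. \<psi> n)" for q r
  proof (induction q)
    case (Suc q)
    have add: "(\<Sum>n<m + k. \<psi> n) = (\<Sum>n<m. \<psi> n) + (\<Sum>n<k. \<psi> (n + m))" for k
      by (induction k) (simp_all add: add.commute)
    have "(\<Sum>n<Suc q * m + r. \<psi> n) = (\<Sum>n<m + (q * m + r). \<psi> n)" by (simp add: add.assoc)
    also have "\<dots> = (\<Sum>n<m. \<psi> n) + (\<Sum>n<q * m + r. \<psi> (n + m))"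
      by (rule add)
    also have "\<dots> = (\<Sum>n<q * m + r. \<psi> n)"
      using sum_character_totatives[OF assms] \<psi>(1) by (simp add: dirichlet_character_def)
    finally show ?case using Suc by simp
  qed simp
  have "norm (\<Sum>n<N. \<psi> n) = norm (\<Sum>n<N mod m. \<psi> n)"
    using per[of "N div m" "N mod m"] by simp
  also have "\<dots> \<le> real (card {..<N mod m}) * 1"
    by (rule sum_norm_bound) (rule dirichlet_character_norm_le_1[OF m \<psi>(1)])
  also have "\<dots> \<le> real m" using m by (simp add: less_imp_le)
  finally show ?thesis .
qed

section \<open>Character sums with weights of bounded variation\<close>

lemma summation_by_parts:
  fixes c b :: "nat \<Rightarrow> 'a :: comm_ring_1"
  assumes "M \<le> N"
  shows "(\<Sum>n\<in>{M..<N}. c n * b n) = (\<Sum>n<N. c n) * b N - (\<Sum>n<M. c n) * b M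
           + (\<Sum>n\<in>{M..<N}. (\<Sum>k<Suc n. c k) * (b n - b (Suc n)))"
  using assms by (induction N rule: dec_induct) (simp_all add: algebra_simps)

lemma norm_character_sum_le:
  fixes b :: "nat \<Rightarrow> real"
  assumes m: "m > 0" and \<psi>: "dirichlet_character m \<psi>" "\<psi> \<noteq> principal_character m" and "M \<le> N"
  shows "norm (\<Sum>n\<in>{M..<N}. \<psi> n * of_real (b n)) \<le>
           real m * (\<bar>b N\<bar> + \<bar>b M\<bar> + (\<Sum>n\<in>{M..<N}. \<bar>b n - b (Suc n)\<bar>))"
proof -
  note le = norm_sum_character_le[OF m \<psi>]
  have tri: "norm (x - y + z) \<le> norm x + norm y + norm z" for x y z :: complex
    by (metis add_right_mono norm_triangle_ineq norm_triangle_ineq4 order_trans)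
  have "norm (\<Sum>n\<in>{M..<N}. \<psi> n * of_real (b n)) \<le>
     norm ((\<Sum>n<N. \<psi> n) * of_real (b N)) + norm ((\<Sum>n<M. \<psi> n) * of_real (b M)) +
     norm (\<Sum>n\<in>{M..<N}. (\<Sum>k<Suc n. \<psi> k) * of_real (b n - b (Suc n)))"
    unfolding summation_by_parts[OF \<open>M \<le> N\<close>, of \<psi> "\<lambda>n. of_real (b n)"] of_real_diff
    by (rule tri)
  also have "\<dots> \<le> real m * \<bar>b N\<bar> + real m * \<bar>b M\<bar> + (\<Sum>n\<in>{M..<N}. real m * \<bar>b n - b (Suc n)\<bar>)"
    using le by (intro add_mono sum_norm_le) 
      (auto simp: norm_mult simp del: sum.lessThan_Suc of_real_diff intro!: mult_right_mono)
  finally show ?thesis by (simp add: sum_distrib_left distrib_left)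
qed

lemma norm_character_sum_antimono_le:
  fixes b :: "nat \<Rightarrow> real"
  assumes m: "m > 0" and \<psi>: "dirichlet_character m \<psi>" "\<psi> \<noteq> principal_character m" and "M \<le> N"
    and b: "\<And>n. n \<ge> M \<Longrightarrow> b (Suc n) \<le> b n" "\<And>n. n \<ge> M \<Longrightarrow> 0 \<le> b n"
  shows "norm (\<Sum>n\<in>{M..<N}. \<psi> n * of_real (b n)) \<le> 2 * real m * b M"
proof -
  have "(\<Sum>n\<in>{M..<N}. \<bar>b n - b (Suc n)\<bar>) = (\<Sum>n\<in>{M..<N}. b n - b (Suc n))"
    using b(1) by (intro sum.cong) auto
  also have "\<dots> = b M - b N"
    using \<open>M \<le> N\<close> by (induction N rule: dec_induct) auto
  finally have "\<bar>b N\<bar> + \<bar>b M\<bar> + (\<Sum>n\<in>{M..<N}. \<bar>b n - b (Suc n)\<bar>) = 2 * b M"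
    using b(2)[of N] b(2)[of M] \<open>M \<le> N\<close> by simp
  then show ?thesis
    using norm_character_sum_le[OF m \<psi> \<open>M \<le> N\<close>, of b] by (simp add: mult_ac)
qed

text \<open>Majorant on the interval from n to n + 1 of (1 + ln x) / x^2, which dominates the
  derivatives of all weights used below: the numerator is taken at the right end, the denominator at
  the left.\<close>

definition log_weight :: "nat \<Rightarrow> real" where
  "log_weight n = (1 + ln (real n + 1)) / real n ^ 2"

lemma log_weight_nonneg: "log_weight n \<ge> 0"
  by (simp add: log_weight_def)

lemma summable_log_weight: "summable log_weight"
proof (rule summable_comparison_test_bigo)
  show "summable (\<lambda>n. norm (real n powr (- 3 / 2)))"
    by (simp add: summable_real_powr_iff)
  show "log_weight \<in> O(\<lambda>n. real n powr (- 3 / 2))"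
    unfolding log_weight_def by real_asymp
qed

lemma bounded_variation_of_deriv:
  fixes g g' :: "real \<Rightarrow> real"
  assumes g: "\<And>x. x \<ge> 1 \<Longrightarrow> (g has_real_derivative g' x) (at x)"
    and g': "\<And>x. x \<ge> 1 \<Longrightarrow> \<bar>g' x\<bar> \<le> K * ((1 + ln x) / x ^ 2)" and K: "K \<ge> 0" and n: "n \<ge> 1"
  shows "\<bar>g (real n) - g (real (Suc n))\<bar> \<le> K * log_weight n"
proof -
  have "\<exists>z. real n < z \<and> z < real (Suc n) \<and>
      g (real (Suc n)) - g (real n) = (real (Suc n) - real n) * g' z"
    using n by (intro MVT2 g) auto
  then obtain z where z: "real n < z" "z < real n + 1" "g (real (Suc n)) - g (real n) = g' z"
    by auto
  have n1: "real n \<ge> 1" using n by simp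
  have "\<bar>g' z\<bar> \<le> K * ((1 + ln z) / z ^ 2)"
    using g'[of z] z n1 by simp
  also have "(1 + ln z) / z ^ 2 \<le> (1 + ln (real n + 1)) / real n ^ 2"
    using z n1 by (intro frac_le add_mono power_mono) auto
  finally show ?thesis
    using K z(3) by (simp add: log_weight_def mult_left_mono abs_minus_commute)
qed

lemma norm_character_sum_bounded_variation:
  fixes b :: "nat \<Rightarrow> real"
  assumes m: "m > 0" and \<psi>: "dirichlet_character m \<psi>" "\<psi> \<noteq> principal_character m"
    and b: "b 1 = 0" "\<And>n. n \<ge> 1 \<Longrightarrow> \<bar>b n - b (Suc n)\<bar> \<le> K * log_weight n" and K: "K \<ge> 0"
  shows "norm (\<Sum>n\<in>{1..<N}. \<psi> n * of_real (b n)) \<le> 2 * real m * K * suminf log_weight"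
proof (cases "N \<ge> 1")
  case True
  have le: "(\<Sum>n\<in>{1..<N}. \<bar>b n - b (Suc n)\<bar>) \<le> K * suminf log_weight"
  proof -
    have "(\<Sum>n\<in>{1..<N}. \<bar>b n - b (Suc n)\<bar>) \<le> (\<Sum>n\<in>{1..<N}. K * log_weight n)"
      by (rule sum_mono) (use b(2) in auto)
    also have "\<dots> = K * (\<Sum>n\<in>{1..<N}. log_weight n)" by (simp add: sum_distrib_left)
    also have "\<dots> \<le> K * suminf log_weight"
      using K by (intro mult_left_mono sum_le_suminf summable_log_weight) (auto simp: log_weight_nonneg)
    finally show ?thesis .
  qed
  have "b 1 - b N = (\<Sum>n\<in>{1..<N}. b n - b (Suc n))"
    using True by (induction N rule: dec_induct) auto
  then have "\<bar>b N\<bar> = \<bar>\<Sum>n\<in>{1..<N}. b n - b (Suc n)\<bar>"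
    using b(1) by (metis abs_minus_cancel diff_0)
  then have "\<bar>b N\<bar> \<le> (\<Sum>n\<in>{1..<N}. \<bar>b n - b (Suc n)\<bar>)"
    by (metis sum_abs)
  then have "\<bar>b N\<bar> + \<bar>b 1\<bar> + (\<Sum>n\<in>{1..<N}. \<bar>b n - b (Suc n)\<bar>) \<le> 2 * (K * suminf log_weight)"
    using le b(1) by simp
  then have "real m * (\<bar>b N\<bar> + \<bar>b 1\<bar> + (\<Sum>n\<in>{1..<N}. \<bar>b n - b (Suc n)\<bar>)) \<le>
     real m * (2 * (K * suminf log_weight))"
    by (intro mult_left_mono) auto
  then show ?thesis
    using norm_character_sum_le[OF m \<psi> True, of b] by (simp add: mult_ac)
next
  case False
  then show ?thesis
    using K by (simp add: suminf_nonneg summable_log_weight log_weight_nonneg)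
qed

text \<open>An ordered sum, since for s = 1 the convergence is only conditional. Again
  \<open>0 powr x = 0\<close> removes the term n = 0.\<close>

definition L_series :: "(nat \<Rightarrow> complex) \<Rightarrow> real \<Rightarrow> complex" where
  "L_series \<psi> s = (\<Sum>n. \<psi> n * of_real (real n powr - s))"

lemma powr_antimono_nat: "s \<ge> 0 \<Longrightarrow> n \<ge> 1 \<Longrightarrow> real (Suc n) powr - s \<le> real n powr - s"
  by (intro powr_mono2') auto

lemma L_series_sums:
  assumes m: "m > 0" and \<psi>: "dirichlet_character m \<psi>" "\<psi> \<noteq> principal_character m"
    and s: "s \<ge> 1"
  shows "(\<lambda>n. \<psi> n * of_real (real n powr - s)) sums L_series \<psi> s"
  unfolding L_series_def
proof (intro summable_sums summable_Cauchy[THEN iffD2] allI impI)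
  fix e :: real assume e: "e > 0"
  have "(\<lambda>n. 2 * real m * real n powr - s) \<longlonglongrightarrow> 0"
    using s by real_asymp
  then obtain N where N: "\<And>n. n \<ge> N \<Longrightarrow> norm (2 * real m * real n powr - s) < e"
    using e by (auto simp: LIMSEQ_iff)
  show "\<exists>N. \<forall>k\<ge>N. \<forall>n. norm (\<Sum>n = k..<n. \<psi> n * of_real (real n powr - s)) < e"
  proof (intro exI allI impI)
    fix k n assume k: "k \<ge> max N 1"
    show "norm (\<Sum>n = k..<n. \<psi> n * of_real (real n powr - s)) < e"
    proof (cases "k \<le> n")
      case True
      have "norm (\<Sum>n = k..<n. \<psi> n * of_real (real n powr - s)) \<le> 2 * real m * real k powr - s"
        using k s by (intro norm_character_sum_antimono_le[OF m \<psi> True] powr_antimono_nat) auto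
      then show ?thesis using N[of k] k by simp
    qed (use e in auto)
  qed
qed

lemma partial_sums_from_1:
  fixes f :: "nat \<Rightarrow> 'a :: real_normed_vector"
  assumes "f sums S" "f 0 = 0"
  shows "(\<lambda>N. \<Sum>n\<in>{1..<N}. f n) \<longlonglongrightarrow> S"
proof -
  have "(\<Sum>n<N. f n) = (\<Sum>n\<in>{1..<N}. f n)" for N
    using assms(2) by (intro sum.mono_neutral_right) (auto simp: not_le)
  then show ?thesis using assms(1) by (simp add: sums_def)
qed

lemma norm_L_series_le:
  assumes m: "m > 0" and \<psi>: "dirichlet_character m \<psi>" "\<psi> \<noteq> principal_character m"
    and s: "s \<ge> 1"
  shows "norm (L_series \<psi> s) \<le> 2 * real m"
proof (rule Lim_norm_ubound[OF _ partial_sums_from_1[OF L_series_sums[OF assms]]])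
  show "\<forall>\<^sub>F N in sequentially. norm (\<Sum>n = 1..<N. \<psi> n * of_real (real n powr - s)) \<le> 2 * real m"
    using eventually_ge_at_top[of 1]
  proof eventually_elim
    case (elim N)
    have "norm (\<Sum>n = 1..<N. \<psi> n * of_real (real n powr - s)) \<le> 2 * real m * real 1 powr - s"
      using s by (intro norm_character_sum_antimono_le[OF m \<psi> elim] powr_antimono_nat) auto
    then show ?case by simp
  qed
qed auto

text \<open>The weight x^(-s) - x^(-1) vanishes at x = 1 and has total variation O(s - 1). A zero at
  1 would thus force L(s) = O(s - 1); a non-zero value at 1 keeps L(s) away from zero
  nearby.\<close>

lemma L_series_lipschitz_at_1:
  assumes m: "m > 0" and \<psi>: "dirichlet_character m \<psi>" "\<psi> \<noteq> principal_character m"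
    and s: "s \<ge> 1"
  shows "norm (L_series \<psi> s - L_series \<psi> 1) \<le> 2 * real m * suminf log_weight * (s - 1)"
proof -
  define e where "e = s - 1"
  have e: "e \<ge> 0" "- s = - 1 - e" using s by (auto simp: e_def)
  define g where "g x = x powr - s - x powr - 1" for x :: real
  define g' where "g' x = - s * x powr (- s - 1) + x powr (- 2)" for x :: real
  have "(g has_real_derivative g' x) (at x)" if "x \<ge> 1" for x
    unfolding g_def g'_def using that
    by (intro DERIV_cong[OF DERIV_diff[OF has_real_derivative_powr has_real_derivative_powr]]) auto
  moreover have "\<bar>g' x\<bar> \<le> e * ((1 + ln x) / x ^ 2)" if x: "x \<ge> 1" for x
  proof -
    have "- s - 1 = - e + (- 2)"
      by (simp add: e_def)
    then have "x powr (- s - 1) = x powr - e * x powr (- 2)"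
      by (simp only: powr_add)
    then have "x powr (- s - 1) = x powr - e / x ^ 2"
      using x by (simp add: powr_minus_divide)
    moreover have "x powr (- 2) = 1 / x ^ 2"
      using x by (simp add: powr_minus_divide)
    ultimately have g'_eq: "g' x = ((1 - x powr - e) - e * x powr - e) / x ^ 2"
      unfolding g'_def by (simp add: e_def diff_divide_distrib algebra_simps)
    moreover have "x powr - e \<le> 1"
      using powr_mono[of "-e" 0 x] e x by simp
    moreover have "1 - x powr - e \<le> e * ln x"
      using exp_ge_add_one_self[of "- e * ln x"] x by (simp add: powr_def)
    moreover have "0 \<le> e * ln x" "0 \<le> e * x powr - e" "e * x powr - e \<le> e"
      using e(1) x \<open>x powr - e \<le> 1\<close> by (auto intro: mult_left_le)
    ultimately have "\<bar>(1 - x powr - e) - e * x powr - e\<bar> \<le> e * ln x + e"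
      by linarith
    then have "\<bar>g' x\<bar> \<le> (e * ln x + e) / x ^ 2"
      unfolding g'_eq abs_divide by (intro frac_le) (use x in auto)
    then show ?thesis by (simp add: field_simps)
  qed
  ultimately have bv: "\<bar>g (real n) - g (real (Suc n))\<bar> \<le> e * log_weight n" if "n \<ge> 1" for n
    using that e(1) by (intro bounded_variation_of_deriv[of g g']) auto
  have "(\<lambda>n. \<psi> n * of_real (real n powr - s) - \<psi> n * of_real (real n powr - 1)) sums
      (L_series \<psi> s - L_series \<psi> 1)"
    by (intro sums_diff L_series_sums[OF m \<psi>] s) simp
  from partial_sums_from_1[OF this]
  have lim: "(\<lambda>N. \<Sum>n\<in>{1..<N}. \<psi> n * of_real (g (real n))) \<longlonglongrightarrow> L_series \<psi> s - L_series \<psi> 1"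
    by (simp add: g_def right_diff_distrib)
  have "norm (\<Sum>n\<in>{1..<N}. \<psi> n * of_real (g (real n))) \<le> 2 * real m * e * suminf log_weight" for N
    by (rule norm_character_sum_bounded_variation[OF m \<psi>]) (use bv e in \<open>auto simp: g_def\<close>)
  then show ?thesis
    by (intro Lim_norm_ubound[OF _ lim]) (auto simp: e_def mult_ac)
qed

text \<open>These are the partial sums of -L'(s), and their bound is uniform for s between 1 and
  2.\<close>

lemma norm_log_character_sum_le:
  assumes m: "m > 0" and \<psi>: "dirichlet_character m \<psi>" "\<psi> \<noteq> principal_character m"
    and s: "s \<ge> 1" "s \<le> 2"
  shows "norm (\<Sum>n\<in>{1..<N}. \<psi> n * of_real (ln (real n) * real n powr - s))
     \<le> 2 * real m * 2 * suminf log_weight"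
proof (rule norm_character_sum_bounded_variation[OF m \<psi>])
  define g where "g x = ln x * x powr - s" for x :: real
  define g' where "g' x = (1 - s * ln x) * x powr (- s - 1)" for x :: real
  have "(g has_real_derivative g' x) (at x)" if "x \<ge> 1" for x
    unfolding g_def g'_def using that
    by (auto intro!: derivative_eq_intros simp: field_simps powr_diff)
  moreover have "\<bar>g' x\<bar> \<le> 2 * ((1 + ln x) / x ^ 2)" if x: "x \<ge> 1" for x
  proof -
    have "x powr (- s - 1) \<le> x powr (- 2)"
      using x s by (intro powr_mono) auto
    then have p: "x powr (- s - 1) \<le> 1 / x ^ 2"
      using x by (simp add: powr_minus_divide)
    have "0 \<le> s * ln x" "s * ln x \<le> 2 * ln x" using s x by (auto intro!: mult_right_mono)
    then have "\<bar>1 - s * ln x\<bar> \<le> 2 * (1 + ln x)"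
      using x by (simp add: abs_le_iff) 
    then have "\<bar>g' x\<bar> \<le> 2 * (1 + ln x) * (1 / x ^ 2)"
      unfolding g'_def abs_mult using p x by (intro mult_mono) auto
    then show ?thesis by simp
  qed
  ultimately have bv: "\<bar>g (real n) - g (real (Suc n))\<bar> \<le> 2 * log_weight n" if "n \<ge> 1" for n
    using that by (intro bounded_variation_of_deriv[of g g']) auto
  then show "\<bar>ln (real n) * real n powr - s - ln (real (Suc n)) * real (Suc n) powr - s\<bar> \<le> 2 * log_weight n"
    if "n \<ge> 1" for n
    using that by (simp add: g_def)
qed auto

section \<open>Non-vanishing of L(1)\<close>

text \<open>Every non-zero n < N has all its prime factors below N, so the product and the full
  series differ at most by the tail from N of the absolute series; n = 0 is covered by
  \<open>g 0 = 0\<close>.\<close>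

lemma partial_euler_products_tendsto:
  fixes g :: "nat \<Rightarrow> 'a :: {real_normed_field, banach}"
  assumes g: "g 1 = 1" "\<And>a b. a > 0 \<Longrightarrow> b > 0 \<Longrightarrow> g (a * b) = g a * g b" "g 0 = 0"
    and sum: "summable (\<lambda>n. norm (g n))" and lt1: "\<And>p. prime p \<Longrightarrow> norm (g p) < 1"
  shows "(\<lambda>N. \<Prod>p | prime p \<and> p < N. 1 / (1 - g p)) \<longlonglongrightarrow> (\<Sum>n. g n)"
proof -
  have sumg: "summable g" using sum by (rule summable_norm_cancel)
  have gs: "(g has_sum suminf g) UNIV"
    by (rule norm_summable_imp_has_sum[OF sum summable_sums[OF sumg]])
  have ns: "((\<lambda>n. norm (g n)) has_sum (\<Sum>n. norm (g n))) UNIV"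
    by (rule norm_summable_imp_has_sum) (use sum in \<open>auto intro: summable_sums\<close>)
  define P where "P N = {p. prime p \<and> p < N}" for N :: nat
  define T where "T N = smooth (P N)" for N
  have bound: "norm ((\<Prod>p\<in>P N. 1 / (1 - g p)) - suminf g) \<le> suminf (\<lambda>n. norm (g n)) - (\<Sum>n<N. norm (g n))" for N
  proof -
    have e: "(g has_sum (\<Prod>p\<in>P N. 1 / (1 - g p))) (T N)"
      unfolding T_def by (rule euler_product_finite[OF g(1,2)]) (use lt1 in \<open>auto simp: P_def\<close>)
    have d: "(g has_sum (suminf g - (\<Prod>p\<in>P N. 1 / (1 - g p)))) (- T N)"
      using has_sum_Diff[OF gs e] by (simp add: Compl_eq_Diff_UNIV)
    have sub: "n \<in> T N \<or> n = 0" if "n < N" for n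
    proof -
      have "prime p \<and> p < N" if "p \<in> prime_factors n" "n \<noteq> 0" for p
        using that \<open>n < N\<close> by (auto simp: in_prime_factors_iff dest: dvd_imp_le)
      then show ?thesis by (auto simp: T_def smooth_def P_def)
    qed
    have h: "((\<lambda>n. norm (g n)) has_sum ((\<Sum>n. norm (g n)) - (\<Sum>n<N. norm (g n)))) (- {..<N})"
      using has_sum_Diff[OF ns, of "{..<N}"] by (simp add: Compl_eq_Diff_UNIV has_sum_finite)
    have "(\<lambda>n. norm (g n)) summable_on - T N"
      by (rule summable_on_subset_banach[OF has_sum_imp_summable[OF ns]]) auto
    then have "norm (suminf g - (\<Prod>p\<in>P N. 1 / (1 - g p))) \<le> infsum (\<lambda>n. norm (g n)) (- T N)"
      by (intro norm_has_sum_bound[OF has_sum_infsum d])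
    also have "\<dots> \<le> (\<Sum>n. norm (g n)) - (\<Sum>n<N. norm (g n))"
      unfolding infsumI[OF h, symmetric]
    proof (rule infsum_mono_neutral)
      show "(\<lambda>n. norm (g n)) summable_on - T N" "(\<lambda>n. norm (g n)) summable_on - {..<N}"
        by (auto intro: summable_on_subset_banach[OF has_sum_imp_summable[OF ns]])
      show "norm (g n) \<le> 0" if "n \<in> - T N - - {..<N}" for n
        using that sub[of n] g(3) by auto
    qed auto
    finally show ?thesis by (simp add: norm_minus_commute)
  qed
  have "(\<lambda>N. suminf (\<lambda>n. norm (g n)) - (\<Sum>n<N. norm (g n))) \<longlonglongrightarrow> suminf (\<lambda>n. norm (g n)) - suminf (\<lambda>n. norm (g n))"
    by (rule tendsto_diff[OF tendsto_const summable_LIMSEQ[OF sum]])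
  then have "(\<lambda>N. suminf (\<lambda>n. norm (g n)) - (\<Sum>n<N. norm (g n))) \<longlonglongrightarrow> 0"
    by simp
  then have "(\<lambda>N. (\<Prod>p\<in>P N. 1 / (1 - g p)) - suminf g) \<longlonglongrightarrow> 0"
    by (rule Lim_null_comparison[rotated]) (rule always_eventually[OF allI[OF bound]])
  then show ?thesis
    by (simp add: LIM_zero_iff P_def)
qed

lemma prime_powr_less_1: "prime p \<Longrightarrow> s > 0 \<Longrightarrow> real p powr - s < 1"
  using prime_gt_1_nat[of p] by (simp add: powr_minus_divide ge_one_powr_ge_zero divide_less_eq gr_one_powr)

lemma character_euler_product:
  assumes m: "m > 0" and \<psi>: "dirichlet_character m \<psi>" and s: "s > 1"
  shows "(\<lambda>N. \<Prod>p | prime p \<and> p < N. 1 / (1 - \<psi> p * of_real (real p powr - s))) \<longlonglongrightarrow> L_series \<psi> s"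
    and "summable (\<lambda>n. norm (\<psi> n * of_real (real n powr - s)))"
proof -
  have le: "norm (\<psi> n * of_real (real n powr - s)) \<le> real n powr - s" for n
    using dirichlet_character_norm_le_1[OF m \<psi>, of n] by (simp add: norm_mult mult_left_le_one_le)
  show sum: "summable (\<lambda>n. norm (\<psi> n * of_real (real n powr - s)))"
    by (rule summable_comparison_test'[OF summable_zeta[OF s]]) (use le in auto)
  show "(\<lambda>N. \<Prod>p | prime p \<and> p < N. 1 / (1 - \<psi> p * of_real (real p powr - s))) \<longlonglongrightarrow> L_series \<psi> s"
    unfolding L_series_def
  proof (rule partial_euler_products_tendsto[OF _ _ _ sum])
    show "norm (\<psi> p * of_real (real p powr - s)) < 1" if "prime p" for p
      using le[of p] prime_powr_less_1[OF that, of s] s by linarith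
  qed (use \<psi> in \<open>auto simp: dirichlet_character_one dirichlet_character_mult powr_mult\<close>)
qed

lemma norm_L_series_le_zeta:
  assumes m: "m > 0" and \<psi>: "dirichlet_character m \<psi>" and s: "s > 1"
  shows "norm (L_series \<psi> s) \<le> zeta s"
proof -
  have "norm (L_series \<psi> s) \<le> (\<Sum>n. norm (\<psi> n * of_real (real n powr - s)))"
    unfolding L_series_def by (rule summable_norm[OF character_euler_product(2)[OF assms]])
  also have "\<dots> \<le> zeta s"
    using dirichlet_character_norm_le_1[OF m \<psi>]
    by (intro suminf_le character_euler_product(2)[OF assms] summable_zeta[OF s])
       (simp add: norm_mult mult_left_le_one_le)
  finally show ?thesis .
qed

section \<open>Complex characters: the inequality 3 + 4 cos + cos 2\<close>

lemma ln_norm_sums: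
  assumes w: "norm (w::complex) < 1"
  shows "(\<lambda>k. Re (w ^ k) / real k) sums (- ln (norm (1 - w)))"
proof -
  have "(\<lambda>k. - ((- (- w)) ^ k) / of_nat k) sums ln (1 + - w)"
    by (rule Ln_series') (use w in simp)
  then have "(\<lambda>k. Re (- (- (w ^ k) / of_nat k))) sums Re (- ln (1 - w))"
    by (intro sums_Re sums_minus) simp
  moreover have "1 - w \<noteq> 0" using w by auto
  ultimately show ?thesis by simp
qed

text \<open>Term by term in the logarithmic series, with c = Re (z^k): 3 + 4 c + (2 c^2 - 1) = 2 (1
  + c)^2 \<ge> 0.\<close>

lemma three_four_one:
  assumes z: "norm (z::complex) = 1" and t: "0 \<le> t" "t < 1"
  shows "norm (1 - of_real t :: complex) ^ 3 * norm (1 - z * of_real t) ^ 4 * norm (1 - z ^ 2 * of_real t) \<le> 1"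
proof -
  have norms: "norm (of_real t :: complex) < 1" "norm (z * of_real t) < 1" "norm (z ^ 2 * of_real t) < 1"
    using z t by (simp_all add: norm_mult norm_power)
  then have nz: "1 - of_real t \<noteq> (0::complex)" "1 - z * of_real t \<noteq> 0" "1 - z ^ 2 * of_real t \<noteq> 0"
    by auto
  note S = ln_norm_sums[OF norms(1)] ln_norm_sums[OF norms(2)] ln_norm_sums[OF norms(3)]
  have sums: "(\<lambda>k. 3 * (Re (of_real t ^ k) / real k) + 4 * (Re ((z * of_real t) ^ k) / real k) + Re ((z ^ 2 * of_real t) ^ k) / real k)
     sums (3 * - ln (norm (1 - of_real t :: complex)) + 4 * - ln (norm (1 - z * of_real t)) + - ln (norm (1 - z ^ 2 * of_real t)))"
    by (intro sums_add sums_mult S)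
  have nonneg: "0 \<le> 3 * (Re (of_real t ^ k) / real k) + 4 * (Re ((z * of_real t) ^ k) / real k) + Re ((z ^ 2 * of_real t) ^ k) / real k" for k
  proof -
    define c where "c = Re (z ^ k)"
    have "norm (z ^ k) = 1" using z by (simp add: norm_power)
    then have "Im (z ^ k) ^ 2 = 1 - c ^ 2"
      using cmod_power2[of "z ^ k"] by (simp add: c_def)
    then have "Re ((z ^ 2) ^ k) = 2 * c ^ 2 - 1"
      by (simp add: power_mult[symmetric] mult.commute[of 2] c_def) (simp add: power_mult power2_eq_square)
    then have "Re ((z * of_real t) ^ k) = c * t ^ k" "Re ((z ^ 2 * of_real t) ^ k) = (2 * c ^ 2 - 1) * t ^ k"
      "Re (of_real t ^ k) = t ^ k"
      by (simp_all add: power_mult_distrib c_def flip: of_real_power)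
    then have "3 * (Re (of_real t ^ k) / real k) + 4 * (Re ((z * of_real t) ^ k) / real k) + Re ((z ^ 2 * of_real t) ^ k) / real k
      = 2 * (1 + c) ^ 2 * t ^ k / real k"
      by (simp only: times_divide_eq_right add_divide_distrib[symmetric])
         (simp add: algebra_simps power2_eq_square)
    then show ?thesis using t by simp
  qed
  have "0 \<le> 3 * - ln (norm (1 - of_real t :: complex)) + 4 * - ln (norm (1 - z * of_real t)) + - ln (norm (1 - z ^ 2 * of_real t))"
    by (rule sums_le[OF nonneg sums_zero sums])
  also have "\<dots> = - ln (norm (1 - of_real t :: complex) ^ 3 * norm (1 - z * of_real t) ^ 4 * norm (1 - z ^ 2 * of_real t))"
    using nz by (simp add: ln_mult ln_realpow)
  finally show ?thesis
    using nz by (simp add: ln_le_zero_iff)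
qed

lemma L_series_three_four_one:
  assumes m: "m > 0" and \<psi>: "dirichlet_character m \<psi>" and s: "s > 1"
  shows "1 \<le> norm (L_series (principal_character m) s) ^ 3 * norm (L_series \<psi> s) ^ 4 *
              norm (L_series (\<lambda>n. \<psi> n * \<psi> n) s)"
proof (rule LIMSEQ_le_const)
  define E where "E \<chi>' N = (\<Prod>p | prime p \<and> p < N. 1 / (1 - \<chi>' p * complex_of_real (real p powr - s)))"
    for \<chi>' :: "nat \<Rightarrow> complex" and N :: nat
  show "(\<lambda>N. norm (E (principal_character m) N) ^ 3 * norm (E \<psi> N) ^ 4 * norm (E (\<lambda>n. \<psi> n * \<psi> n) N))
     \<longlonglongrightarrow> norm (L_series (principal_character m) s) ^ 3 * norm (L_series \<psi> s) ^ 4 *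
              norm (L_series (\<lambda>n. \<psi> n * \<psi> n) s)"
    unfolding E_def
    by (intro tendsto_intros character_euler_product[OF m _ s] dirichlet_character_principal
        dirichlet_character_times \<psi>)
  have "1 \<le> norm (E (principal_character m) N) ^ 3 * norm (E \<psi> N) ^ 4 * norm (E (\<lambda>n. \<psi> n * \<psi> n) N)" for N
    unfolding E_def prod_norm[symmetric] prod_power_distrib prod.distrib[symmetric]
  proof (rule prod_ge_1)
    fix p assume "p \<in> {p. prime p \<and> p < N}"
    then have p: "prime p" by simp
    define t where "t = real p powr - s"
    have t: "0 \<le> t" "t < 1" using prime_powr_less_1[OF p] s by (auto simp: t_def)
    show "1 \<le> norm (1 / (1 - principal_character m p * complex_of_real (real p powr - s))) ^ 3 *
       norm (1 / (1 - \<psi> p * complex_of_real (real p powr - s))) ^ 4 *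
       norm (1 / (1 - \<psi> p * \<psi> p * complex_of_real (real p powr - s)))"
    proof (cases "coprime p m")
      case True
      then have z: "norm (\<psi> p) = 1" using dirichlet_character_norm[OF m \<psi>] by simp
      then have "norm (\<psi> p * of_real t) < 1" "norm (\<psi> p ^ 2 * of_real t) < 1" "norm (of_real t :: complex) < 1"
        using t by (simp_all add: norm_mult norm_power)
      then have nz: "1 - of_real t \<noteq> (0::complex)" "1 - \<psi> p * of_real t \<noteq> 0" "1 - \<psi> p ^ 2 * of_real t \<noteq> 0"
        by auto
      have "1 \<le> 1 / (norm (1 - of_real t :: complex) ^ 3 * norm (1 - \<psi> p * of_real t) ^ 4 * norm (1 - \<psi> p ^ 2 * of_real t))"
        using three_four_one[OF z t] nz by (subst le_divide_eq) auto
      then show ?thesis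
        using True unfolding t_def[symmetric]
        by (simp add: principal_character_def norm_divide power_divide power2_eq_square)
    next
      case False
      then have "\<psi> p = 0" using dirichlet_character_eq_0_iff[OF \<psi>] by blast
      then show ?thesis using False by (simp add: principal_character_def)
    qed
  qed
  then show "\<exists>N. \<forall>n\<ge>N. 1 \<le> norm (E (principal_character m) n) ^ 3 * norm (E \<psi> n) ^ 4 * norm (E (\<lambda>n. \<psi> n * \<psi> n) n)"
    by blast
qed

text \<open>A character whose square is principal takes only the values 0, 1 and -1. Hence here
  \<psi>^2 is not principal and L(s, \<psi>^2) stays bounded; a zero of L(s, \<psi>) at 1
  contributes e^4 against the e^(-3) of the principal character, and the product falls below
  1.\<close>

lemma L_series_1_nonzero_complex:
  assumes m: "m > 0" and \<psi>: "dirichlet_character m \<psi>" "\<not> real_character \<psi>"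
  shows "L_series \<psi> 1 \<noteq> 0"
proof
  assume zero: "L_series \<psi> 1 = 0"
  have "principal_character m a \<in> \<real>" for a
    by (cases "coprime a m") (simp_all add: principal_character_def)
  then have np: "\<psi> \<noteq> principal_character m"
    using \<psi>(2) unfolding real_character_def by metis
  have np2: "(\<lambda>n. \<psi> n * \<psi> n) \<noteq> principal_character m"
  proof
    assume eq: "(\<lambda>n. \<psi> n * \<psi> n) = principal_character m"
    have "\<psi> a \<in> \<real>" for a
    proof -
      have "\<psi> a * \<psi> a = 0 \<or> \<psi> a * \<psi> a = 1"
        using fun_cong[OF eq, of a] by (auto simp: principal_character_def)
      then have "\<psi> a \<in> {0, 1, - 1}" using square_eq_1_iff by auto
      then show ?thesis by auto
    qed
    then show False using \<psi>(2) by (simp add: real_character_def)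
  qed
  define C where "C = 2 * real m * suminf log_weight"
  have le: "1 \<le> (1 + 1 / e) ^ 3 * (C * e) ^ 4 * (2 * real m)" if e: "e > 0" for e
  proof -
    have "1 \<le> norm (L_series (principal_character m) (1 + e)) ^ 3 * norm (L_series \<psi> (1 + e)) ^ 4 *
              norm (L_series (\<lambda>n. \<psi> n * \<psi> n) (1 + e))"
      by (rule L_series_three_four_one[OF m \<psi>(1)]) (use e in simp)
    also have "\<dots> \<le> (1 + 1 / e) ^ 3 * (C * e) ^ 4 * (2 * real m)"
    proof (intro mult_mono power_mono)
      show "norm (L_series (principal_character m) (1 + e)) \<le> 1 + 1 / e"
        using norm_L_series_le_zeta[OF m dirichlet_character_principal, of "1 + e"] zeta_bounds(2)[of "1 + e"] e by simp
      show "norm (L_series \<psi> (1 + e)) \<le> C * e"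
        using L_series_lipschitz_at_1[OF m \<psi>(1) np, of "1 + e"] e zero by (simp add: C_def)
      show "norm (L_series (\<lambda>n. \<psi> n * \<psi> n) (1 + e)) \<le> 2 * real m"
        by (rule norm_L_series_le[OF m dirichlet_character_times[OF \<psi>(1) \<psi>(1)] np2]) (use e in simp)
    qed (use e in auto)
    finally show ?thesis .
  qed
  have "((\<lambda>e. (1 + 1 / e) ^ 3 * (C * e) ^ 4 * (2 * real m)) \<longlongrightarrow> 0) (at_right 0)"
  proof -
    have lim: "((\<lambda>e. (e + 1) ^ 3 * C ^ 4 * e * (2 * real m)) \<longlongrightarrow> (0 + 1) ^ 3 * C ^ 4 * 0 * (2 * real m)) (at_right 0)"
      by (intro tendsto_intros)
    have "eventually (\<lambda>e. (1 + 1 / e) ^ 3 * (C * e) ^ 4 * (2 * real m) = (e + 1) ^ 3 * C ^ 4 * e * (2 * real m)) (at_right 0)"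
      using eventually_at_right_less[of 0]
    proof eventually_elim
      case (elim e)
      have "(1 + 1 / e) ^ 3 = (e + 1) ^ 3 / e ^ 3" using elim by (simp add: power_divide[symmetric] add_divide_distrib)
      moreover have "(C * e) ^ 4 = C ^ 4 * e * e ^ 3" by (simp add: power_mult_distrib power_numeral_reduce)
      ultimately show ?case using elim by simp
    qed
    from tendsto_cong[OF this] lim show ?thesis by simp
  qed
  then have "1 \<le> (0::real)"
    by (rule tendsto_lowerbound) (use le in \<open>auto intro!: eventually_at_right_less[of 0, THEN eventually_mono]\<close>)
  then show False by simp
qed

section \<open>Real characters: divisor sums and Lambert series\<close>

lemma has_sum_divisor_sums:
  fixes F :: "nat \<times> nat \<Rightarrow> 'a :: {t3_space, topological_comm_monoid_add}"
  assumes "(F has_sum S) ({0<..} \<times> {0<..})"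
  shows "((\<lambda>k. \<Sum>d | d dvd k. F (d, k div d)) has_sum S) {0<..}"
proof -
  have "((\<lambda>(k, d). F (d, k div d)) has_sum S) (SIGMA k:{0<..}. {d. d dvd k})"
    using assms
    by (rule has_sum_reindex_bij_witness
          [where j = "\<lambda>(d, j). (d * j, d)" and i = "\<lambda>(k, d). (d, k div d)", THEN iffD1, rotated -1])
       (auto elim!: dvdE)
  then show ?thesis
    by (rule has_sum_SigmaD) (auto intro!: has_sum_finite)
qed

lemma divisors_prime_power_mult:
  fixes p y :: nat
  assumes p: "prime p" and y: "\<not> p dvd y"
  shows "{d. d dvd p ^ e * y} = (\<lambda>(i, d). p ^ i * d) ` ({..e} \<times> {d. d dvd y})"
    and "inj_on (\<lambda>(i, d). p ^ i * d) ({..e} \<times> {d. d dvd y})"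
proof -
  show "{d. d dvd p ^ e * y} = (\<lambda>(i, d). p ^ i * d) ` ({..e} \<times> {d. d dvd y})"
  proof (intro equalityI subsetI)
    fix d assume "d \<in> {d. d dvd p ^ e * y}"
    then obtain a b where ab: "d = a * b" "a dvd p ^ e" "b dvd y"
      using division_decomp[of d "p ^ e" y] by auto
    then obtain i where "i \<le> e" "a = p ^ i"
      using p divides_primepow_nat by blast
    then show "d \<in> (\<lambda>(i, d). p ^ i * d) ` ({..e} \<times> {d. d dvd y})"
      using ab by force
  qed (auto intro!: mult_dvd_mono le_imp_power_dvd)
  show "inj_on (\<lambda>(i, d). p ^ i * d) ({..e} \<times> {d. d dvd y})"
  proof (rule inj_onI, clarify)
    fix i d i' d' assume *: "d dvd y" "d' dvd y" "p ^ i * d = p ^ i' * d'"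
    have m: "multiplicity p (p ^ j * c) = j" if "c dvd y" for c j
    proof -
      have nd: "\<not> p dvd c" using that y dvd_trans by blast
      then have "c \<noteq> 0" by (metis dvd_0_right)
      then have "multiplicity p (p ^ j * c) = multiplicity p (p ^ j) + multiplicity p c"
        using p by (intro prime_elem_multiplicity_mult_distrib) auto
      then show ?thesis using p not_dvd_imp_multiplicity_0[OF nd] by simp
    qed
    have "i = i'" using m *(1,2,3) by metis
    then show "i = i' \<and> d = d'" using * p by simp
  qed
qed

text \<open>The hypothesis on the multiplicities says that \<open>k\<close> is a square.\<close>

lemma sum_divisors_real_character:
  fixes c :: "nat \<Rightarrow> real"
  assumes c: "c 1 = 1" "\<And>a b. c (a * b) = c a * c b" "\<And>a. c a \<in> {-1, 0, 1}"
    and k: "k > 0"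
  shows "0 \<le> (\<Sum>d | d dvd k. c d)"
    "(\<And>p. prime p \<Longrightarrow> even (multiplicity p k)) \<Longrightarrow> 1 \<le> (\<Sum>d | d dvd k. c d)"
proof -
  have "0 \<le> (\<Sum>d | d dvd k. c d) \<and> ((\<forall>p. prime p \<longrightarrow> even (multiplicity p k)) \<longrightarrow> 1 \<le> (\<Sum>d | d dvd k. c d))"
    using k
  proof (induction k rule: less_induct)
    case (less k)
    show ?case
    proof (cases "k = 1")
      case True
      then show ?thesis using c(1) by simp
    next
      case False
      then obtain p where p: "prime p" "p dvd k" using prime_factor_nat by blast
      define e where "e = multiplicity p k"
      obtain y where y: "k = p ^ e * y" "\<not> p dvd y"
        unfolding e_def using multiplicity_decompose'[of k p] less.prems p(1)
        by (metis not_prime_unit not_gr0)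
      have e: "e > 0" unfolding e_def using p less.prems
        by (metis multiplicity_gt_zero_iff neq0_conv not_prime_unit)
      have y0: "y > 0" using y(1) less.prems by (metis mult_0_right neq0_conv)
      have "1 < p ^ e" by (rule one_less_power[OF prime_gt_1_nat[OF p(1)] e])
      then have "y < k" using y(1) y0 by simp
      note IH = less.IH[OF this y0]
      have cpow: "c (p ^ i) = c p ^ i" for i by (induction i) (use c in auto)
      have split: "(\<Sum>d | d dvd k. c d) = (\<Sum>i\<le>e. c p ^ i) * (\<Sum>d | d dvd y. c d)"
        unfolding y(1) divisors_prime_power_mult(1)[OF p(1) y(2)]
          sum.reindex[OF divisors_prime_power_mult(2)[OF p(1) y(2)]]
        by (simp add: sum_product sum.cartesian_product case_prod_unfold c(2) cpow)
      \<comment> \<open>For c(p) = -1 the sum alternates between 1 and 0, which is why even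
        exponents matter.\<close>
      have geo: "0 \<le> (\<Sum>i\<le>n. c p ^ i) \<and> (even n \<longrightarrow> 1 \<le> (\<Sum>i\<le>n. c p ^ i))" for n
      proof -
        have "c p = -1 \<or> c p = 0 \<or> c p = 1" using c(3)[of p] by auto
        moreover have "(\<Sum>i\<le>n. (- 1) ^ i) = (if even n then 1 else (0::real))" by (induction n) auto
        moreover have "(\<Sum>i\<le>n. 0 ^ i) = (1::real)" by (induction n) auto
        ultimately show ?thesis by auto
      qed
      have "\<forall>q. prime q \<longrightarrow> even (multiplicity q y)" if "\<forall>q. prime q \<longrightarrow> even (multiplicity q k)"
      proof (intro allI impI)
        fix q :: nat assume q: "prime q"
        show "even (multiplicity q y)"
        proof (cases "q = p")
          case True
          then show ?thesis using not_dvd_imp_multiplicity_0[OF y(2)] by simp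
        next
          case False
          have "multiplicity q k = multiplicity q (p ^ e) + multiplicity q y"
            unfolding y(1) using q p(1) y0 by (intro prime_elem_multiplicity_mult_distrib) auto
          also have "multiplicity q (p ^ e) = 0"
            using q p(1) False by (simp add: prime_multiplicity_other multiplicity_distinct_prime_power)
          finally have "multiplicity q k = multiplicity q y" by simp
          then show ?thesis using that q by metis
        qed
      qed
      moreover have "even e" if "\<forall>q. prime q \<longrightarrow> even (multiplicity q k)"
        using that p(1) by (simp add: e_def)
      ultimately show ?thesis
        unfolding split using IH geo[of e] mult_mono[of 1 "\<Sum>i\<le>e. c p ^ i" 1 "\<Sum>d | d dvd y. c d"]
        by auto
    qed
  qed
  then show "0 \<le> (\<Sum>d | d dvd k. c d)"
    "(\<And>p. prime p \<Longrightarrow> even (multiplicity p k)) \<Longrightarrow> 1 \<le> (\<Sum>d | d dvd k. c d)" by auto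
qed

text \<open>If \<Sum> \<psi>(n)/n = 0, subtracting the Lambert series from 1/(1 - x) times this zero
  series leaves \<Sum> \<psi>(n) \<open>lambert_coeff x n\<close>. These coefficients decrease to 0,
  so Abel summation bounds the sum uniformly in x.\<close>

definition lambert_coeff :: "real \<Rightarrow> nat \<Rightarrow> real" where
  "lambert_coeff x n = 1 / (real n * (1 - x)) - x ^ n / (1 - x ^ n)"

text \<open>Each x^i is paired with x^(n-1-i), and AM-GM is applied to the pair.\<close>

lemma geometric_sum_ge:
  fixes x :: real
  assumes x: "0 < x" "x < 1"
  shows "real n * x powr ((real n - 1) / 2) \<le> (\<Sum>i<n. x ^ i)"
proof -
  have "2 * (\<Sum>i<n. x ^ i) = (\<Sum>i<n. x ^ i) + (\<Sum>i<n. x ^ (n - Suc i))"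
    by (subst sum.nat_diff_reindex) simp
  also have "\<dots> = (\<Sum>i<n. x ^ i + x ^ (n - Suc i))" by (simp add: sum.distrib)
  also have "\<dots> \<ge> (\<Sum>i<n. 2 * x powr ((real n - 1) / 2))"
  proof (rule sum_mono)
    fix i assume "i \<in> {..<n}"
    then have i: "i < n" by simp
    have "2 * x powr ((real n - 1) / 2) = 2 * (x powr (real i / 2) * x powr (real (n - Suc i) / 2))"
      using i by (simp add: powr_add[symmetric] of_nat_diff add_divide_distrib[symmetric])
    also have "\<dots> \<le> (x powr (real i / 2)) ^ 2 + (x powr (real (n - Suc i) / 2)) ^ 2"
      using sum_squares_bound[of "x powr (real i / 2)" "x powr (real (n - Suc i) / 2)"] by (simp add: mult.assoc)
    also have "\<dots> = x ^ i + x ^ (n - Suc i)"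
      using x by (simp add: powr_power powr_realpow)
    finally show "2 * x powr ((real n - 1) / 2) \<le> x ^ i + x ^ (n - Suc i)" .
  qed
  finally show ?thesis by simp
qed

text \<open>Write A(n) = 1 + ... + x^(n-1), so 1 - x^n = (1 - x) A(n) and A(n+1) - x A(n) = 1. After
  cancelling 1/(1 - x) the claim is n (n+1) x^n \<le> A(n) A(n+1), which follows from the AM-GM
  bound for both factors.\<close>

lemma lambert_coeff_antimono:
  assumes x: "0 < x" "x < 1" and n: "n \<ge> 1"
  shows "lambert_coeff x (Suc n) \<le> lambert_coeff x n"
proof -
  define A where "A k = (\<Sum>i<k. x ^ i)" for k :: nat
  have Apos: "A k > 0" if "k > 0" for k
    unfolding A_def using that x by (intro sum_pos) auto
  have A: "1 - x ^ k = (1 - x) * A k" for k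
    unfolding A_def using sum_gp_strict[of x k] x by (simp add: field_simps)
  have "x powr (real n) \<le> x powr ((real n - 1) / 2) * x powr ((real (Suc n) - 1) / 2)"
    unfolding powr_add[symmetric] using x by (intro powr_mono') (auto simp: field_simps)
  then have "real n * real (Suc n) * x ^ n \<le> (real n * x powr ((real n - 1) / 2)) * (real (Suc n) * x powr ((real (Suc n) - 1) / 2))"
    using x by (simp add: powr_realpow mult_left_mono mult.assoc mult.left_commute del: of_nat_Suc)
  also have "\<dots> \<le> A n * A (Suc n)"
    unfolding A_def using geometric_sum_ge[OF x] x
    by (intro mult_mono) (auto intro!: sum_nonneg simp del: of_nat_Suc sum.lessThan_Suc)
  finally have *: "x ^ n / (A n * A (Suc n)) \<le> 1 / (real n * real (Suc n))"
    using n Apos[of n] Apos[of "Suc n"] by (simp add: field_simps del: of_nat_Suc)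
  have "x ^ n / A n - x ^ Suc n / A (Suc n) = x ^ n * (A (Suc n) - x * A n) / (A n * A (Suc n))"
    using n Apos[of n] Apos[of "Suc n"] by (simp add: field_simps)
  also have "A (Suc n) - x * A n = 1"
    unfolding A_def sum.lessThan_Suc_shift by (simp add: sum_distrib_left)
  finally have "x ^ n / A n - x ^ Suc n / A (Suc n) \<le> 1 / real n - 1 / real (Suc n)"
    using * n by (simp add: field_simps)
  then have "(x ^ n / A n - x ^ Suc n / A (Suc n)) / (1 - x) \<le> (1 / real n - 1 / real (Suc n)) / (1 - x)"
    using x by (intro divide_right_mono) auto
  then show ?thesis
    unfolding lambert_coeff_def A
    by (simp add: diff_divide_distrib mult.commute del: of_nat_Suc power_Suc)
qed

lemma lambert_coeff_tendsto_0:
  assumes x: "0 < x" "x < 1"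
  shows "lambert_coeff x \<longlonglongrightarrow> 0"
proof -
  have p: "(\<lambda>n. x ^ n) \<longlonglongrightarrow> 0" using x by (intro LIMSEQ_realpow_zero) auto
  have "(\<lambda>n. 1 / (1 - x) * (1 / real n) - x ^ n / (1 - x ^ n)) \<longlonglongrightarrow> 1 / (1 - x) * 0 - 0 / (1 - 0)"
    using lim_1_over_n by (intro tendsto_intros p) auto
  then show ?thesis by (simp add: lambert_coeff_def[abs_def] mult.commute)
qed

lemma lambert_coeff_nonneg:
  assumes x: "0 < x" "x < 1" and n: "n \<ge> 1"
  shows "0 \<le> lambert_coeff x n"
proof (rule LIMSEQ_le_const2[OF lambert_coeff_tendsto_0[OF x]])
  have "lambert_coeff x k \<le> lambert_coeff x n" if "k \<ge> n" for k
    using that by (induction k rule: dec_induct) (use n in \<open>auto intro: order_trans[OF lambert_coeff_antimono[OF x]]\<close>)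
  then show "\<exists>N. \<forall>k\<ge>N. lambert_coeff x k \<le> lambert_coeff x n" by blast
qed

text \<open>Monsky's argument: if \<open>L(1) = 0\<close>, the Lambert series \<open>\<Sum> \<psi>(n) x^n/(1-x^n)\<close> stays bounded
  as \<open>x\<close> tends to \<open>1\<close>, although its power series coefficients are at least \<open>1\<close> at the squares.\<close>

lemma L_series_1_nonzero_real:
  assumes m: "m > 0" and \<psi>: "dirichlet_character m \<psi>" "\<psi> \<noteq> principal_character m"
    and real: "real_character \<psi>"
  shows "L_series \<psi> 1 \<noteq> 0"
proof
  assume zero: "L_series \<psi> 1 = 0"
  define c where "c n = Re (\<psi> n)" for n
  have \<psi>c: "\<psi> n = of_real (c n)" for n
    using real by (simp add: real_character_def c_def)
  have c: "c 1 = 1" "c (a * b) = c a * c b" "c a \<in> {-1, 0, 1}" for a b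
  proof -
    show "c 1 = 1" using dirichlet_character_one[OF \<psi>(1)] by (simp add: c_def)
    have "of_real (c (a * b)) = (of_real (c a * c b) :: complex)"
      using dirichlet_character_mult[OF \<psi>(1), of a b] by (simp add: \<psi>c)
    then show "c (a * b) = c a * c b" by (simp only: of_real_eq_iff)
    have "\<bar>c a\<bar> = 0 \<or> \<bar>c a\<bar> = 1"
      using dirichlet_character_norm[OF m \<psi>(1), of a] by (auto simp: \<psi>c split: if_splits)
    then show "c a \<in> {-1, 0, 1}" by auto
  qed
  \<comment> \<open>The choice makes x^(J^2) = 1/2, so each of the J squares up to J^2 contributes
    at least 1/2. The total J/2 exceeds the bound 2 m that Abel summation gives.\<close>
  define J where "J = 4 * m + 1"
  define x where "x = (1 / 2 :: real) powr (1 / real (J ^ 2))"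
  have J: "J > 0" by (simp add: J_def)
  have xJ: "x ^ (J ^ 2) = 1 / 2"
    unfolding x_def using J by (subst powr_realpow[symmetric]) (auto simp: powr_powr)
  have x: "0 < x" "x < 1"
  proof -
    show "0 < x" by (simp add: x_def)
    show "x < 1"
    proof (rule ccontr)
      assume "\<not> x < 1"
      then have "1 \<le> x ^ (J ^ 2)" by (intro one_le_power) simp
      then show False using xJ by simp
    qed
  qed
  have np: "norm x < 1" "x \<noteq> 0" using x by auto
  define G where "G = (\<lambda>(d, j). c d * x ^ (d * j))"
  have Gabs: "(\<lambda>z. norm (G z)) summable_on ({0<..} \<times> {0<..})"
  proof (rule summable_on_comparison_test)
    have "summable (\<lambda>d. norm (x ^ d))"
      using x by (simp add: summable_geometric)
    then have "(\<lambda>d. norm (x ^ d)) summable_on UNIV"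
      by (intro norm_summable_imp_summable_on) simp
    then have 1: "(\<lambda>d. norm (x ^ d)) summable_on {0<..}" by (rule summable_on_subset_banach) auto
    have "summable (\<lambda>j. norm (x ^ (j - 1)))"
      using \<open>summable (\<lambda>d. norm (x ^ d))\<close> by (subst summable_Suc_iff[symmetric]) simp
    then have "(\<lambda>j. norm (x ^ (j - 1))) summable_on UNIV"
      by (intro norm_summable_imp_summable_on) simp
    then have 2: "(\<lambda>j. norm (x ^ (j - 1))) summable_on {0<..}" by (rule summable_on_subset_banach) auto
    show "(\<lambda>(d, j). norm (x ^ d * x ^ (j - 1))) summable_on ({0<..} \<times> {0<..})"
      by (rule has_sum_times(1)[OF 1 has_sum_infsum[OF Infinite_Sum.abs_summable_summable[OF 1]]
            2 has_sum_infsum[OF Infinite_Sum.abs_summable_summable[OF 2]]])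
    fix z :: "nat \<times> nat" assume z: "z \<in> {0<..} \<times> {0<..}"
    obtain d j where dj: "z = (d, j)" "d > 0" "j > 0" using z by auto
    obtain d' j' where "d = Suc d'" "j = Suc j'" using dj by (metis gr0_conv_Suc)
    \<comment> \<open>This dominates the double series by a product of two geometric series.\<close>
    then have "d + (j - 1) \<le> d * j" by simp
    then have "x ^ (d * j) \<le> x ^ (d + (j - 1))" using x by (intro power_decreasing) auto
    moreover have "\<bar>c d\<bar> \<le> 1" using c(3)[of d] by auto
    ultimately have "\<bar>c d\<bar> * x ^ (d * j) \<le> 1 * x ^ (d + (j - 1))"
      using x by (intro mult_mono) auto
    then show "norm (G z) \<le> (case z of (d, j) \<Rightarrow> norm (x ^ d * x ^ (j - 1)))"
      using x by (simp add: G_def dj abs_mult power_add)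
  qed auto
  then have "G summable_on ({0<..} \<times> {0<..})"
    by (rule Infinite_Sum.abs_summable_summable)
  then obtain S where S: "(G has_sum S) ({0<..} \<times> {0<..})"
    by (auto simp: summable_on_def)
  have inner: "((\<lambda>j. G (d, j)) has_sum c d * (x ^ d / (1 - x ^ d))) {0<..}" if "d > 0" for d
  proof -
    have "norm (x ^ d) < 1" using x that by (simp add: power_less_one_iff)
    from has_sum_cmult_right[OF has_sum_geometric_from_1[OF this], of "c d"]
    have "((\<lambda>j. c d * (x ^ d) ^ j) has_sum c d * (x ^ d / (1 - x ^ d))) {1..}" by simp
    moreover have "{1..} = {0::nat<..}" by auto
    ultimately show ?thesis by (simp add: G_def power_mult)
  qed
  have "((\<lambda>d. c d * (x ^ d / (1 - x ^ d))) has_sum S) {0<..}"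
    by (rule has_sum_SigmaD[OF S]) (use inner in auto)
  then have "((\<lambda>d. c d * (x ^ d / (1 - x ^ d))) has_sum S) UNIV"
    by (rule has_sum_cong_neutral[THEN iffD1, rotated -1]) auto
  then have lam: "(\<lambda>d. c d * (x ^ d / (1 - x ^ d))) sums S" by (rule has_sum_imp_sums)
  have "((\<lambda>k. \<Sum>d | d dvd k. G (d, k div d)) has_sum S) {0<..}"
    by (rule has_sum_divisor_sums[OF S])
  then have rs: "((\<lambda>k. (\<Sum>d | d dvd k. c d) * x ^ k) has_sum S) {0<..}"
    by (rule has_sum_cong[THEN iffD1, rotated]) (auto simp: G_def sum_distrib_right intro!: sum.cong)
  have "real J / 2 = (\<Sum>j\<in>{1..J}. x ^ (J ^ 2))" by (simp add: xJ)
  also have "\<dots> \<le> (\<Sum>j\<in>{1..J}. (\<Sum>d | d dvd j ^ 2. c d) * x ^ (j ^ 2))"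
  proof (rule sum_mono)
    fix j assume j: "j \<in> {1..J}"
    have "1 \<le> (\<Sum>d | d dvd j ^ 2. c d)"
      using j by (intro sum_divisors_real_character(2)[OF c]) (auto simp: prime_elem_multiplicity_power_distrib)
    moreover have "x ^ (J ^ 2) \<le> x ^ (j ^ 2)" using j x by (intro power_decreasing power_mono) auto
    ultimately have "1 * x ^ (J ^ 2) \<le> (\<Sum>d | d dvd j ^ 2. c d) * x ^ (j ^ 2)"
      using x by (intro mult_mono) auto
    then show "x ^ (J ^ 2) \<le> (\<Sum>d | d dvd j ^ 2. c d) * x ^ (j ^ 2)" by simp
  qed
  also have "\<dots> = (\<Sum>k\<in>(\<lambda>j. j ^ 2) ` {1..J}. (\<Sum>d | d dvd k. c d) * x ^ k)"
    by (subst sum.reindex) (auto simp: inj_on_def)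
  also have "\<dots> \<le> S"
    by (rule finite_sum_le_has_sum[OF rs])
       (use x in \<open>auto intro!: mult_nonneg_nonneg sum_divisors_real_character(1)[OF c]\<close>)
  finally have Sge: "real J / 2 \<le> S" .
  have L1: "(\<lambda>n. \<psi> n * of_real (real n powr - 1)) sums 0"
    using L_series_sums[OF m \<psi>, of 1] zero by simp
  have "(\<lambda>n. Re (\<psi> n * of_real (real n powr - 1))) sums Re 0"
    by (intro sums_Re L1)
  then have "(\<lambda>n. c n * real n powr - 1) sums 0" by (simp add: \<psi>c)
  then have "(\<lambda>n. c n * real n powr - 1 / (1 - x)) sums (0 / (1 - x))" by (rule sums_divide)
  moreover have "c n * lambert_coeff x n = c n * real n powr - 1 / (1 - x) - c n * (x ^ n / (1 - x ^ n))" for n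
    by (simp add: lambert_coeff_def powr_minus_divide right_diff_distrib)
  ultimately have "(\<lambda>n. c n * lambert_coeff x n) sums (- S)"
    using sums_diff[OF _ lam] by fastforce
  then have "(\<lambda>n. \<psi> n * of_real (lambert_coeff x n)) sums of_real (- S)"
    by (subst (asm) sums_of_real_iff[symmetric, where 'a = complex]) (simp add: \<psi>c)
  from partial_sums_from_1[OF this]
  have lim: "(\<lambda>N. \<Sum>n\<in>{1..<N}. \<psi> n * of_real (lambert_coeff x n)) \<longlonglongrightarrow> of_real (- S)"
    by (simp add: lambert_coeff_def)
  have "norm (of_real (- S) :: complex) \<le> 2 * real m"
  proof (rule Lim_norm_ubound[OF _ lim])
    show "\<forall>\<^sub>F N in sequentially. norm (\<Sum>n = 1..<N. \<psi> n * of_real (lambert_coeff x n)) \<le> 2 * real m"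
      using eventually_ge_at_top[of 1]
    proof eventually_elim
      case (elim N)
      have "norm (\<Sum>n = 1..<N. \<psi> n * of_real (lambert_coeff x n)) \<le> 2 * real m * lambert_coeff x 1"
        by (intro norm_character_sum_antimono_le[OF m \<psi> elim] lambert_coeff_antimono lambert_coeff_nonneg x)
      also have "lambert_coeff x 1 = 1" using x by (simp add: lambert_coeff_def field_simps)
      finally show ?case by simp
    qed
  qed auto
  then have "S \<le> 2 * real m" by simp
  then show False using Sge by (simp add: J_def)
qed

lemma L_series_1_nonzero:
  assumes m: "m > 0" and \<psi>: "dirichlet_character m \<psi>" "\<psi> \<noteq> principal_character m"
  shows "L_series \<psi> 1 \<noteq> 0"
  using L_series_1_nonzero_real[OF assms] L_series_1_nonzero_complex[OF m \<psi>(1)] by blast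

section \<open>Dirichlet's theorem\<close>

lemma has_sum_finite_sum:
  fixes f :: "'i \<Rightarrow> 'j \<Rightarrow> 'a :: topological_comm_monoid_add"
  assumes "finite I" "\<And>i. i \<in> I \<Longrightarrow> (f i has_sum s i) A"
  shows "((\<lambda>x. \<Sum>i\<in>I. f i x) has_sum (\<Sum>i\<in>I. s i)) A"
  using assms by (induction I rule: finite_induct) (auto intro!: has_sum_add)

lemma has_sum_greaterThan_0:
  fixes f :: "nat \<Rightarrow> 'a :: banach"
  assumes "summable (\<lambda>n. norm (f n))" "f 0 = 0"
  shows "(f has_sum suminf f) {0<..}"
proof -
  have "(f has_sum suminf f) UNIV"
    using assms(1) by (intro norm_summable_imp_has_sum summable_sums summable_norm_cancel[OF assms(1)])
  then show ?thesis
    by (rule has_sum_cong_neutral[THEN iffD1, rotated -1]) (use assms(2) in \<open>auto intro: gr0I\<close>)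
qed

section \<open>Logarithmic derivatives of the L-series near 1\<close>

lemma mangoldt_le_ln: "n > 0 \<Longrightarrow> mangoldt n \<le> ln (real n)"
proof -
  assume n: "n > 0"
  have "(mangoldt n :: real) \<le> (\<Sum>d | d dvd n. mangoldt d)"
    using n by (intro member_le_sum) (auto simp: mangoldt_nonneg)
  then show ?thesis using mangoldt_sum[where 'a = real] n by simp
qed

lemma summable_ln_powr: "s > 1 \<Longrightarrow> summable (\<lambda>n. ln (real n) * real n powr - s)"
proof (rule summable_comparison_test_bigo)
  assume s: "s > 1"
  show "summable (\<lambda>n. norm (real n powr (- (s + 1) / 2)))"
    using s by (simp add: summable_real_powr_iff)
  define d where "d = (s - 1) / 2"
  have d: "d > 0" "- (s + 1) / 2 = d - s" using s by (auto simp: d_def field_simps)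
  have "eventually (\<lambda>n. norm (ln (real n) * real n powr - s) \<le> (1 / d) * norm (real n powr (- (s + 1) / 2))) at_top"
    using eventually_ge_at_top[of 1]
  proof eventually_elim
    case (elim n)
    have "ln (real n) * real n powr - s \<le> real n powr d / d * real n powr - s"
      using elim d by (intro mult_right_mono ln_powr_bound) auto
    also have "\<dots> = (1 / d) * real n powr (d - s)"
      by (simp add: powr_add[symmetric])
    finally show ?case using elim d(1) unfolding d(2) by (simp add: abs_mult)
  qed
  then show "(\<lambda>n. ln (real n) * real n powr - s) \<in> O(\<lambda>n. real n powr (- (s + 1) / 2))"
    by (rule bigoI)
qed

text \<open>The series of -L'/L.\<close>

definition mangoldt_series :: "(nat \<Rightarrow> complex) \<Rightarrow> real \<Rightarrow> complex" where
  "mangoldt_series \<psi> s = (\<Sum>n. \<psi> n * mangoldt n * of_real (real n powr - s))"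

text \<open>The series of -L'; working with it directly avoids differentiating L.\<close>

definition log_series :: "(nat \<Rightarrow> complex) \<Rightarrow> real \<Rightarrow> complex" where
  "log_series \<psi> s = (\<Sum>n. \<psi> n * of_real (ln (real n) * real n powr - s))"

lemma summable_log_series:
  assumes m: "m > 0" and \<psi>: "dirichlet_character m \<psi>" and s: "s > 1"
  shows "summable (\<lambda>n. norm (\<psi> n * of_real (ln (real n) * real n powr - s)))"
proof (rule summable_comparison_test'[OF summable_ln_powr[OF s]])
  fix n :: nat assume "n \<ge> 1"
  then show "norm (norm (\<psi> n * of_real (ln (real n) * real n powr - s))) \<le> ln (real n) * real n powr - s"
    using dirichlet_character_norm_le_1[OF m \<psi>, of n] by (simp add: norm_mult abs_mult mult_left_le_one_le)
qed

lemma summable_mangoldt_series: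
  assumes m: "m > 0" and \<psi>: "dirichlet_character m \<psi>" and s: "s > 1"
  shows "summable (\<lambda>n. norm (\<psi> n * mangoldt n * of_real (real n powr - s)))"
proof (rule summable_comparison_test'[OF summable_ln_powr[OF s]])
  fix n :: nat assume n: "n \<ge> 1"
  have "norm (\<psi> n) * mangoldt n * real n powr - s \<le> 1 * ln (real n) * real n powr - s"
    using n dirichlet_character_norm_le_1[OF m \<psi>, of n] mangoldt_le_ln[of n] mangoldt_nonneg[of n]
    by (intro mult_mono) auto
  then show "norm (norm (\<psi> n * mangoldt n * of_real (real n powr - s))) \<le> ln (real n) * real n powr - s"
    by (simp add: norm_mult abs_mult mangoldt_nonneg)
qed

text \<open>The Dirichlet convolution of the von Mangoldt function with 1 is the logarithm, and
  complete multiplicativity of \<psi>(n) n^(-s) lets this factor pass through the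
  convolution.\<close>

lemma mangoldt_series_times_L_series:
  assumes m: "m > 0" and \<psi>: "dirichlet_character m \<psi>" and s: "s > 1"
  shows "mangoldt_series \<psi> s * L_series \<psi> s = log_series \<psi> s"
proof -
  define V where "V n = \<psi> n * mangoldt n * of_real (real n powr - s)" for n
  define L where "L n = \<psi> n * of_real (real n powr - s)" for n
  have V: "(V has_sum mangoldt_series \<psi> s) {0<..}"
    unfolding V_def mangoldt_series_def
    by (rule has_sum_greaterThan_0[OF summable_mangoldt_series[OF assms]]) simp
  have L: "(L has_sum L_series \<psi> s) {0<..}"
    unfolding L_def L_series_def
    by (rule has_sum_greaterThan_0[OF character_euler_product(2)[OF assms]]) simp
  have Va: "(\<lambda>n. norm (V n)) summable_on {0<..}"
    unfolding V_def
    by (rule has_sum_imp_summable[OF has_sum_greaterThan_0]) (use summable_mangoldt_series[OF assms] in auto)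
  have La: "(\<lambda>n. norm (L n)) summable_on {0<..}"
    unfolding L_def
    by (rule has_sum_imp_summable[OF has_sum_greaterThan_0]) (use character_euler_product(2)[OF assms] in auto)
  have "((\<lambda>k. \<Sum>d | d dvd k. (\<lambda>(x, y). V x * L y) (d, k div d)) has_sum (mangoldt_series \<psi> s * L_series \<psi> s)) {0<..}"
    by (rule has_sum_divisor_sums[OF has_sum_times(2)[OF Va V La L]])
  moreover have "(\<Sum>d | d dvd k. (\<lambda>(x, y). V x * L y) (d, k div d)) = \<psi> k * of_real (ln (real k) * real k powr - s)"
    if k: "k \<in> {0<..}" for k
  proof -
    have "(\<Sum>d | d dvd k. (\<lambda>(x, y). V x * L y) (d, k div d)) =
        (\<Sum>d | d dvd k. \<psi> k * of_real (real k powr - s) * mangoldt d)"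
    proof (rule sum.cong[OF refl])
      fix d assume "d \<in> {d. d dvd k}"
      then obtain j where j: "k = d * j" by (auto elim: dvdE)
      then have "d > 0" "k div d = j" using k by auto
      then show "(\<lambda>(x, y). V x * L y) (d, k div d) = \<psi> k * of_real (real k powr - s) * mangoldt d"
        by (simp add: V_def L_def j dirichlet_character_mult[OF \<psi>] powr_mult)
    qed
    also have "\<dots> = \<psi> k * of_real (real k powr - s) * of_real (ln (real k))"
      using mangoldt_sum[of k, where 'a = complex] k by (simp add: sum_distrib_left[symmetric])
    finally show ?thesis by simp
  qed
  ultimately have "((\<lambda>k. \<psi> k * of_real (ln (real k) * real k powr - s)) has_sum (mangoldt_series \<psi> s * L_series \<psi> s)) {0<..}"
    by (rule has_sum_cong[THEN iffD1, rotated])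
  moreover have "((\<lambda>k. \<psi> k * of_real (ln (real k) * real k powr - s)) has_sum log_series \<psi> s) {0<..}"
    unfolding log_series_def by (rule has_sum_greaterThan_0[OF summable_log_series[OF assms]]) simp
  ultimately show ?thesis by (rule has_sum_unique)
qed

text \<open>Near 1 the numerator -L' is bounded, while L is kept away from zero by L(1) \<noteq> 0
  and the Lipschitz bound.\<close>

lemma mangoldt_series_bounded:
  assumes m: "m > 0" and \<psi>: "dirichlet_character m \<psi>" "\<psi> \<noteq> principal_character m"
  shows "\<exists>K. eventually (\<lambda>e. norm (mangoldt_series \<psi> (1 + e)) \<le> K) (at_right 0)"
proof -
  define l where "l = norm (L_series \<psi> 1)"
  have l: "l > 0" using L_series_1_nonzero[OF assms] by (simp add: l_def)
  define K where "K = 2 * real m * 2 * suminf log_weight"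
  have D: "norm (log_series \<psi> (1 + e)) \<le> K" if e: "0 < e" "e \<le> 1" for e
  proof -
    have "(\<lambda>n. \<psi> n * of_real (ln (real n) * real n powr - (1 + e))) sums log_series \<psi> (1 + e)"
      unfolding log_series_def
      by (intro summable_sums summable_norm_cancel[OF summable_log_series[OF m \<psi>(1)]]) (use e in simp)
    from partial_sums_from_1[OF this] show ?thesis
      by (rule Lim_norm_ubound[rotated])
         (use norm_log_character_sum_le[OF m \<psi>, of "1 + e"] e in \<open>auto simp: K_def\<close>)
  qed
  define C where "C = 2 * real m * suminf log_weight"
  have "((\<lambda>e. l - C * e) \<longlongrightarrow> l - C * 0) (at_right 0)" by (intro tendsto_intros)
  then have "eventually (\<lambda>e. l - C * e > l / 2) (at_right 0)"
    using l by (intro order_tendstoD) auto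
  moreover have "eventually (\<lambda>e::real. e \<le> 1) (at_right 0)"
    using eventually_at_right_real[of 0 1] by (auto elim: eventually_mono)
  ultimately have "eventually (\<lambda>e. norm (mangoldt_series \<psi> (1 + e)) \<le> 2 * K / l) (at_right 0)"
    using eventually_at_right_less[of 0]
  proof eventually_elim
    case (elim e)
    have "l - norm (L_series \<psi> (1 + e)) \<le> norm (L_series \<psi> (1 + e) - L_series \<psi> 1)"
      unfolding l_def by (metis norm_minus_commute norm_triangle_ineq2)
    also have "\<dots> \<le> C * e"
      using L_series_lipschitz_at_1[OF m \<psi>, of "1 + e"] elim by (simp add: C_def)
    finally have L: "norm (L_series \<psi> (1 + e)) > l / 2" using elim by simp
    have "norm (mangoldt_series \<psi> (1 + e)) * (l / 2) \<le> norm (mangoldt_series \<psi> (1 + e)) * norm (L_series \<psi> (1 + e))"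
      using L by (intro mult_left_mono) auto
    also have "\<dots> \<le> K"
      using mangoldt_series_times_L_series[OF m \<psi>(1), of "1 + e"] D[of e] elim by (simp add: norm_mult[symmetric])
    finally show ?case using l by (simp add: field_simps)
  qed
  then show ?thesis by blast
qed

text \<open>A difference quotient replaces the derivative: 1 - n^(-e) \<le> e ln n bounds each term
  below by that of (zeta(1+e) - zeta(1+2e)) / e. The zeta bounds then give (1/(2e) - 1)/e, which is
  at least 1/(4 e^2) for e \<le> 1/4.\<close>

lemma log_zeta_lower:
  assumes e: "0 < e" "e \<le> 1 / 4"
  shows "1 / (4 * e ^ 2) \<le> (\<Sum>n. ln (real n) * real n powr - (1 + e))"
proof -
  have le: "(real n powr - (1 + e) - real n powr - (1 + 2 * e)) / e \<le> ln (real n) * real n powr - (1 + e)" for n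
  proof (cases "n > 0")
    case True
    have "- (1 + 2 * e) = - (1 + e) + - e" by simp
    then have "real n powr - (1 + 2 * e) = real n powr - (1 + e) * real n powr - e"
      by (simp only: powr_add)
    moreover have "1 - real n powr - e \<le> e * ln (real n)"
      using exp_ge_add_one_self[of "- e * ln (real n)"] True by (simp add: powr_def)
    ultimately have "real n powr - (1 + e) - real n powr - (1 + 2 * e) \<le> real n powr - (1 + e) * (e * ln (real n))"
      using mult_left_mono[of "1 - real n powr - e" "e * ln (real n)" "real n powr - (1 + e)"]
      by (simp add: right_diff_distrib)
    then show ?thesis using e by (simp add: divide_le_eq mult_ac)
  qed simp
  have s: "summable (\<lambda>n. real n powr - (1 + e))" "summable (\<lambda>n. real n powr - (1 + 2 * e))"
    using e by (auto intro!: summable_zeta simp del: minus_add_distrib)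
  have "1 / (4 * e ^ 2) \<le> (1 / e - (1 + 1 / (2 * e))) / e"
  proof -
    have "4 * e * e \<le> 1 * e" using e by (intro mult_right_mono) auto
    then show ?thesis using e by (simp add: field_simps power2_eq_square)
  qed
  also have "\<dots> \<le> (zeta (1 + e) - zeta (1 + 2 * e)) / e"
    using zeta_bounds(1)[of "1 + e"] zeta_bounds(2)[of "1 + 2 * e"] e by (intro divide_right_mono diff_mono) auto
  also have "\<dots> = (\<Sum>n. (real n powr - (1 + e) - real n powr - (1 + 2 * e)) / e)"
    using suminf_divide[OF summable_diff[OF s], of e] suminf_diff[OF s] by simp
  also have "\<dots> \<le> (\<Sum>n. ln (real n) * real n powr - (1 + e))"
    using le e by (intro suminf_le summable_divide summable_diff s summable_ln_powr) auto
  finally show ?thesis .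
qed

text \<open>Only the terms n = k m + 1, which are coprime to m, are kept. Since k m + 1 \<le> k (m +
  1), each costs at most a factor (m + 1)^2 against the k-th term of the logarithmic zeta
  series.\<close>

lemma log_series_principal_lower:
  assumes m: "m > 0" and e: "0 < e" "e \<le> 1 / 4"
  shows "1 / (4 * e ^ 2 * (real m + 1) ^ 2) \<le> norm (log_series (principal_character m) (1 + e))"
proof -
  define a where "a n = of_bool (coprime n m) * (ln (real n) * real n powr - (1 + e))" for n
  define b where "b n = ln (real n) * real n powr - (1 + e)" for n
  have a0: "a n \<ge> 0" for n by (cases "n = 0") (auto simp: a_def)
  have suma: "summable a"
    by (rule summable_comparison_test'[OF summable_ln_powr[of "1 + e"], where N = 1])
       (use e in \<open>auto simp: a_def abs_mult\<close>)
  have sumb: "summable b" unfolding b_def using e by (intro summable_ln_powr) auto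
  have log: "log_series (principal_character m) (1 + e) = of_real (suminf a)"
  proof -
    have "principal_character m n * of_real (ln (real n) * real n powr - (1 + e)) = of_real (a n)" for n
      by (cases "coprime n m") (simp_all add: a_def principal_character_def)
    then show ?thesis
      unfolding log_series_def suminf_of_real[OF suma] by simp
  qed
  have bound: "b k / (real m + 1) ^ 2 \<le> a (k * m + 1)" for k
  proof (cases "k > 0")
    case True
    have cop: "coprime (k * m + 1) m" by (metis coprime_iff_gcd_eq_1 gcd.commute gcd_add_mult coprime_1_right gcd_1_nat add.commute)
    have "real (k * m + 1) \<le> real k * (real m + 1)" using True by (simp add: distrib_left Suc_le_eq)
    then have "(real k * (real m + 1)) powr - (1 + e) \<le> real (k * m + 1) powr - (1 + e)"
      using e by (intro powr_mono2') (auto simp: add_pos_nonneg)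
    moreover have "(real m + 1) powr - 2 \<le> (real m + 1) powr - (1 + e)"
      using e by (intro powr_mono) auto
    then have "1 / (real m + 1) ^ 2 \<le> (real m + 1) powr - (1 + e)"
      by (simp add: powr_minus_divide)
    then have "real k powr - (1 + e) * (1 / (real m + 1) ^ 2) \<le> (real k * (real m + 1)) powr - (1 + e)"
      unfolding powr_mult by (intro mult_left_mono) auto
    ultimately have "real k powr - (1 + e) * (1 / (real m + 1) ^ 2) \<le> real (k * m + 1) powr - (1 + e)"
      by linarith
    moreover have "k \<le> k * m + 1" using m by (cases m) auto
    then have "ln (real k) \<le> ln (real (k * m + 1))"
      using True by (subst ln_le_cancel_iff) (auto simp del: of_nat_add of_nat_mult)
    ultimately have "ln (real k) * (real k powr - (1 + e) * (1 / (real m + 1) ^ 2)) \<le> ln (real (k * m + 1)) * real (k * m + 1) powr - (1 + e)"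
      using True by (intro mult_mono) auto
    then show ?thesis using cop by (simp add: a_def b_def)
  qed (use a0 in \<open>simp add: b_def\<close>)
  have "1 / (4 * e ^ 2) / (real m + 1) ^ 2 \<le> suminf b / (real m + 1) ^ 2"
    using log_zeta_lower[OF e] unfolding b_def by (intro divide_right_mono) auto
  also have "\<dots> = (\<Sum>k. b k / (real m + 1) ^ 2)" by (rule suminf_divide[OF sumb, symmetric])
  also have "\<dots> \<le> suminf a"
  proof (rule suminf_le_const[OF summable_divide[OF sumb]])
    fix n
    have "(\<Sum>k<n. b k / (real m + 1) ^ 2) \<le> (\<Sum>k<n. a (k * m + 1))"
      by (intro sum_mono bound)
    also have "\<dots> = sum a ((\<lambda>k. k * m + 1) ` {..<n})"
      using m by (subst sum.reindex) (auto simp: inj_on_def)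
    also have "\<dots> \<le> suminf a"
      by (intro sum_le_suminf suma) (auto simp: a0)
    finally show "(\<Sum>k<n. b k / (real m + 1) ^ 2) \<le> suminf a" .
  qed
  also have "\<dots> \<le> norm (log_series (principal_character m) (1 + e))"
    unfolding log by simp
  finally show ?thesis by simp
qed

text \<open>The numerator -L' is at least of order e^(-2) and L is at most 2/e; the quotient has
  order at least 1/e. A positive constant in front suffices for the later contradiction.\<close>

lemma mangoldt_series_principal_lower:
  assumes m: "m > 0" and e: "0 < e" "e \<le> 1 / 4"
  shows "1 / (8 * (real m + 1) ^ 2) / e \<le> Re (mangoldt_series (principal_character m) (1 + e))"
proof -
  let ?V = "mangoldt_series (principal_character m) (1 + e)"
  define v where "v n = of_bool (coprime n m) * mangoldt n * real n powr - (1 + e)" for n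
  have sumv: "summable v"
  proof (rule summable_comparison_test'[OF summable_ln_powr[of "1 + e"]])
    fix n :: nat assume n: "n \<ge> 1"
    have "of_bool (coprime n m) * mangoldt n * real n powr - (1 + e) \<le> 1 * ln (real n) * real n powr - (1 + e)"
      using n mangoldt_le_ln[of n] mangoldt_nonneg[of n] by (intro mult_mono) auto
    then show "norm (v n) \<le> ln (real n) * real n powr - (1 + e)"
      by (simp add: v_def mangoldt_nonneg)
  qed (use e in auto)
  have V: "?V = of_real (suminf v)"
  proof -
    have "principal_character m n * mangoldt n * of_real (real n powr - (1 + e)) = of_real (v n)" for n
      by (cases "coprime n m") (simp_all add: v_def principal_character_def)
    then show ?thesis
      unfolding mangoldt_series_def suminf_of_real[OF sumv] by simp
  qed
  have "suminf v \<ge> 0" by (intro suminf_nonneg sumv) (simp add: v_def mangoldt_nonneg)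
  then have Vn: "Re ?V = norm ?V" by (simp add: V)
  have "1 / (4 * e ^ 2 * (real m + 1) ^ 2) \<le> norm ?V * norm (L_series (principal_character m) (1 + e))"
    using mangoldt_series_times_L_series[OF m dirichlet_character_principal, of "1 + e"]
      log_series_principal_lower[OF assms] e by (simp add: norm_mult[symmetric])
  also have "\<dots> \<le> norm ?V * (2 / e)"
  proof (intro mult_left_mono)
    have "norm (L_series (principal_character m) (1 + e)) \<le> 1 + 1 / e"
      using norm_L_series_le_zeta[OF m dirichlet_character_principal, of "1 + e"] zeta_bounds(2)[of "1 + e"] e by simp
    also have "\<dots> \<le> 2 / e" using e by (simp add: field_simps)
    finally show "norm (L_series (principal_character m) (1 + e)) \<le> 2 / e" .
  qed auto
  finally have "1 / (4 * e ^ 2 * (real m + 1) ^ 2) * (e / 2) \<le> norm ?V * (2 / e) * (e / 2)"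
    using e by (intro mult_right_mono) auto
  moreover have "1 / (4 * e ^ 2 * M) * (e / 2) = 1 / (8 * M) / e" if "M > 0" for M
    using e that by (simp add: field_simps power2_eq_square)
  ultimately show ?thesis using e unfolding Vn by (simp add: add_pos_nonneg)
qed

section \<open>From the pole at 1 to primes in a residue class\<close>

lemma mangoldt_nonprime_bounded:
  assumes "finite F" "\<And>n. n \<in> F \<Longrightarrow> \<not> prime n"
  shows "(\<Sum>n\<in>F. mangoldt n / real n) \<le> 2 * suminf log_weight"
proof -
  define B where "B = Suc (Max (insert 2 F))"
  have B: "n < B" if "n \<in> F" for n
    using that assms(1) by (simp add: B_def le_imp_less_Suc)
  have "(\<Sum>n\<in>F. mangoldt n / real n) = (\<Sum>n\<in>{n\<in>F. primepow n}. mangoldt n / real n)"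
    using assms(1) by (intro sum.mono_neutral_right) (auto simp: mangoldt_def)
  also have "\<dots> \<le> (\<Sum>n\<in>(\<lambda>(p, k). p ^ k) ` ({p. prime p \<and> p < B} \<times> {2..<B}). mangoldt n / real n)"
  proof (rule sum_mono2)
    show "{n \<in> F. primepow n} \<subseteq> (\<lambda>(p, k). p ^ k) ` ({p. prime p \<and> p < B} \<times> {2..<B})"
    proof
      fix n assume n: "n \<in> {n \<in> F. primepow n}"
      then obtain p k where pk: "prime p" "k > 0" "n = p ^ k" by (auto simp: primepow_def)
      have "k \<noteq> 1" using pk n assms(2) by auto
      moreover have "p \<le> p ^ k" using pk(2) prime_gt_0_nat[OF pk(1)] by (simp add: self_le_power)
      moreover have "k < p ^ k" using prime_gt_1_nat[OF pk(1)] by (simp add: power_gt_expt)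
      ultimately have "p < B" "k < B" "k \<ge> 2" using B[of n] n pk by auto
      then show "n \<in> (\<lambda>(p, k). p ^ k) ` ({p. prime p \<and> p < B} \<times> {2..<B})"
        using pk by (intro image_eqI[of _ _ "(p, k)"]) auto
    qed
  qed (auto simp: mangoldt_nonneg)
  also have "\<dots> \<le> (\<Sum>(p, k)\<in>{p. prime p \<and> p < B} \<times> {2..<B}. mangoldt (p ^ k) / real (p ^ k))"
    by (rule order_trans[OF sum_image_le]) (auto simp: mangoldt_nonneg case_prod_unfold o_def)
  also have "\<dots> = (\<Sum>p | prime p \<and> p < B. \<Sum>k\<in>{2..<B}. mangoldt (p ^ k) / real (p ^ k))"
    by (rule sum.cartesian_product[symmetric])
  also have "\<dots> \<le> (\<Sum>p | prime p \<and> p < B. 2 * log_weight p)"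
  proof (rule sum_mono)
    fix p assume "p \<in> {p. prime p \<and> p < B}"
    then have p: "prime p" "real p \<ge> 2" using prime_ge_2_nat by auto
    define q where "q = 1 / real p"
    have q: "0 \<le> q" "q \<le> 1 / 2" using p by (auto simp: q_def)
    have "(\<Sum>k\<in>{2..<B}. mangoldt (p ^ k) / real (p ^ k)) = ln (real p) * (\<Sum>k\<in>{2..<B}. q ^ k)"
      using p by (simp add: sum_distrib_left q_def power_divide)
    also have "(\<Sum>k\<in>{2..<B}. q ^ k) \<le> 2 * q ^ 2"
    proof -
      have pw: "q ^ 2 * q ^ (k - 2) = q ^ k" if "k \<ge> 2" for k
        using that power_add[of q 2 "k - 2"] by (metis le_add_diff_inverse)
      have "(\<Sum>k\<in>{2..<B}. q ^ k) = (\<Sum>k<B - 2. q ^ 2 * q ^ k)"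
        by (rule sum.reindex_bij_witness[of _ "\<lambda>k. k + 2" "\<lambda>k. k - 2"]) (auto simp: pw)
      also have "\<dots> = q ^ 2 * (\<Sum>k<B - 2. q ^ k)" by (simp add: sum_distrib_left)
      also have "\<dots> \<le> q ^ 2 * 2"
      proof (intro mult_left_mono)
        have "(\<Sum>k<B - 2. q ^ k) \<le> (\<Sum>k. q ^ k)"
          using q by (intro sum_le_suminf summable_geometric) auto
        also have "\<dots> = 1 / (1 - q)" using q by (intro suminf_geometric) auto
        also have "\<dots> \<le> 2" using q by (simp add: field_simps)
        finally show "(\<Sum>k<B - 2. q ^ k) \<le> 2" .
      qed auto
      finally show ?thesis by simp
    qed
    also have "ln (real p) * (2 * q ^ 2) \<le> 2 * log_weight p"
    proof -
      have "ln (real p) \<le> 1 + ln (real p + 1)"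
      proof -
        have "ln (real p) \<le> ln (real p + 1)" using p by (subst ln_le_cancel_iff) auto
        then show ?thesis by simp
      qed
      then have "ln (real p) * (2 / real p ^ 2) \<le> (1 + ln (real p + 1)) * (2 / real p ^ 2)"
        by (rule mult_right_mono) simp
      then show ?thesis by (simp add: log_weight_def q_def power_divide mult.commute)
    qed
    finally show "(\<Sum>k\<in>{2..<B}. mangoldt (p ^ k) / real (p ^ k)) \<le> 2 * log_weight p"
      using p by (simp add: mult_left_mono)
  qed
  also have "\<dots> = 2 * (\<Sum>p | prime p \<and> p < B. log_weight p)" by (simp add: sum_distrib_left)
  also have "\<dots> \<le> 2 * suminf log_weight"
    by (intro mult_left_mono sum_le_suminf summable_log_weight) (auto simp: log_weight_nonneg)
  finally show ?thesis .
qed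

lemma sum_cnj_character_mangoldt_series:
  assumes m: "m > 0" and a: "coprime a m" and s: "s > 1"
  shows "((\<lambda>n. mangoldt n * real n powr - s) has_sum
     (Re (\<Sum>\<psi>\<in>characters m. cnj (\<psi> a) * mangoldt_series \<psi> s) / real (card (characters m))))
       {n. n > 0 \<and> [a = n] (mod m)}"
proof -
  let ?N = "real (card (characters m))"
  have N: "?N > 0" using card_characters_pos[OF m] by simp
  have "((\<lambda>n. \<Sum>\<psi>\<in>characters m. cnj (\<psi> a) * (\<psi> n * mangoldt n * of_real (real n powr - s))) has_sum
     (\<Sum>\<psi>\<in>characters m. cnj (\<psi> a) * mangoldt_series \<psi> s)) {0<..}"
  proof (rule has_sum_finite_sum[OF finite_characters[OF m]])
    fix \<psi> assume "\<psi> \<in> characters m"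
    then show "((\<lambda>n. cnj (\<psi> a) * (\<psi> n * mangoldt n * of_real (real n powr - s))) has_sum
        cnj (\<psi> a) * mangoldt_series \<psi> s) {0<..}"
      unfolding mangoldt_series_def
      by (intro has_sum_cmult_right has_sum_greaterThan_0 summable_mangoldt_series[OF m _ s]) auto
  qed
  then have "((\<lambda>n. Re (\<Sum>\<psi>\<in>characters m. cnj (\<psi> a) * (\<psi> n * mangoldt n * of_real (real n powr - s)))) has_sum
     Re (\<Sum>\<psi>\<in>characters m. cnj (\<psi> a) * mangoldt_series \<psi> s)) {0<..}"
    by (rule has_sum_Re)
  then have "((\<lambda>n. Re (\<Sum>\<psi>\<in>characters m. cnj (\<psi> a) * (\<psi> n * mangoldt n * of_real (real n powr - s))) / ?N) has_sum
     Re (\<Sum>\<psi>\<in>characters m. cnj (\<psi> a) * mangoldt_series \<psi> s) / ?N) {0<..}"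
    by (rule has_sum_divide_const)
  moreover have "Re (\<Sum>\<psi>\<in>characters m. cnj (\<psi> a) * (\<psi> n * mangoldt n * of_real (real n powr - s))) / ?N
      = (if [a = n] (mod m) then mangoldt n * real n powr - s else 0)" for n
  proof -
    have "(\<Sum>\<psi>\<in>characters m. cnj (\<psi> a) * (\<psi> n * mangoldt n * of_real (real n powr - s))) =
       (\<Sum>\<psi>\<in>characters m. cnj (\<psi> a) * \<psi> n) * of_real (mangoldt n * real n powr - s)"
      by (simp add: sum_distrib_left sum_distrib_right mult_ac)
    also have "\<dots> = of_real (if [a = n] (mod m) then ?N * (mangoldt n * real n powr - s) else 0)"
      unfolding sum_characters_cnj[OF m a] by simp
    finally show ?thesis using N by simp
  qed
  ultimately have "((\<lambda>n. if [a = n] (mod m) then mangoldt n * real n powr - s else 0) has_sum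
     Re (\<Sum>\<psi>\<in>characters m. cnj (\<psi> a) * mangoldt_series \<psi> s) / ?N) {0<..}"
    by simp
  then show ?thesis
    by (rule has_sum_cong_neutral[THEN iffD1, rotated -1]) auto
qed

text \<open>If the reciprocals were summable, their tail outside a finite X would be at most
  \<delta>. As ln p \<le> p^e / e, the primes outside X contribute at most \<delta>/e to the series
  at 1 + e, and everything else is bounded. The principal character forces at least c/(N e) - O(1),
  where N is the number of characters; \<delta> = c/(2N) contradicts this as e tends to 0.\<close>

theorem dirichlet_primes_not_summable:
  assumes m: "m > 0" and a: "coprime a m"
  shows "\<not> (\<lambda>p. 1 / real p) summable_on {p. prime p \<and> [a = p] (mod m)}"
proof
  assume sum: "(\<lambda>p. 1 / real p) summable_on {p. prime p \<and> [a = p] (mod m)}"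
  let ?N = "real (card (characters m))"
  have N: "?N > 0" using card_characters_pos[OF m] by simp
  define c where "c = 1 / (8 * (real m + 1) ^ 2)"
  have c: "c > 0" by (simp add: c_def add_pos_nonneg)
  define \<delta> where "\<delta> = c / (2 * ?N)"
  have \<delta>: "\<delta> > 0" using c N by (simp add: \<delta>_def)
  define P where "P = {p. prime p \<and> [a = p] (mod m)}"
  obtain I where I: "infsum (\<lambda>p. 1 / real p) P = I" by blast
  have Is: "((\<lambda>p. 1 / real p) has_sum I) P" using sum I by (auto simp: P_def)
  from has_sum_finite_approximation[OF Is \<delta>] obtain X where
    X: "finite X" "X \<subseteq> P" "dist (\<Sum>p\<in>X. 1 / real p) I \<le> \<delta>"
    by blast
  have tail: "(\<Sum>p\<in>Y. 1 / real p) \<le> \<delta>" if "finite Y" "Y \<subseteq> P - X" for Y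
  proof -
    have "(\<Sum>p\<in>X. 1 / real p) + (\<Sum>p\<in>Y. 1 / real p) = (\<Sum>p\<in>X \<union> Y. 1 / real p)"
      using X(1) that by (intro sum.union_disjoint[symmetric]) auto
    also have "\<dots> \<le> I" by (rule finite_sum_le_has_sum[OF Is]) (use X that in auto)
    finally show ?thesis using X(3) by (simp add: dist_real_def)
  qed
  define K3 where "K3 = (\<Sum>p\<in>X. ln (real p))"
  define K2 where "K2 = 2 * suminf log_weight"
  have upper: "Re (\<Sum>\<psi>\<in>characters m. cnj (\<psi> a) * mangoldt_series \<psi> (1 + e)) / ?N \<le> K3 + \<delta> / e + K2"
    if e: "e > 0" for e
  proof (rule has_sum_le_finite_sums[OF sum_cnj_character_mangoldt_series[OF m a]])
    show "1 + e > 1" using e by simp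
    fix F assume F: "finite F" "F \<subseteq> {n. n > 0 \<and> [a = n] (mod m)}"
    have "(\<Sum>n\<in>F. mangoldt n * real n powr - (1 + e)) =
      (\<Sum>n\<in>F \<inter> X. mangoldt n * real n powr - (1 + e)) + (\<Sum>n\<in>{n\<in>F. prime n} - X. mangoldt n * real n powr - (1 + e))
      + (\<Sum>n\<in>{n\<in>F. \<not> prime n}. mangoldt n * real n powr - (1 + e))"
      using F(1) X(2) by (subst sum.union_disjoint[symmetric], simp, simp, force simp: P_def)+
         (auto intro!: sum.cong simp: P_def)
    also have "(\<Sum>n\<in>F \<inter> X. mangoldt n * real n powr - (1 + e)) \<le> K3"
    proof -
      have "(\<Sum>n\<in>F \<inter> X. mangoldt n * real n powr - (1 + e)) \<le> (\<Sum>n\<in>X. mangoldt n * real n powr - (1 + e))"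
        using X(1) by (intro sum_mono2) (auto simp: mangoldt_nonneg)
      also have "\<dots> \<le> K3"
        unfolding K3_def
      proof (rule sum_mono)
        fix p assume "p \<in> X"
        then have p: "prime p" "real p \<ge> 1" using X(2) prime_ge_1_nat by (auto simp: P_def)
        have "real p powr - (1 + e) \<le> real p powr 0" using p e by (intro powr_mono) auto
        then have "ln (real p) * real p powr - (1 + e) \<le> ln (real p) * 1"
          using p by (intro mult_left_mono) auto
        then show "mangoldt p * real p powr - (1 + e) \<le> ln (real p)" using p by simp
      qed
      finally show ?thesis .
    qed
    also have "(\<Sum>n\<in>{n\<in>F. prime n} - X. mangoldt n * real n powr - (1 + e)) \<le> \<delta> / e"
    proof -
      have "(\<Sum>n\<in>{n\<in>F. prime n} - X. mangoldt n * real n powr - (1 + e)) \<le> (\<Sum>n\<in>{n\<in>F. prime n} - X. (1 / e) * (1 / real n))"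
      proof (rule sum_mono)
        fix p assume "p \<in> {n\<in>F. prime n} - X"
        then have p: "prime p" "real p \<ge> 1" using prime_ge_1_nat by auto
        have "ln (real p) * real p powr - (1 + e) \<le> real p powr e / e * real p powr - (1 + e)"
          using p e by (intro mult_right_mono ln_powr_bound) auto
        also have "\<dots> = (1 / e) * (real p powr e * real p powr - (1 + e))" by simp
        also have "real p powr e * real p powr - (1 + e) = 1 / real p"
          using p by (simp add: powr_add[symmetric] powr_minus_divide)
        finally show "mangoldt p * real p powr - (1 + e) \<le> (1 / e) * (1 / real p)" using p by simp
      qed
      also have "\<dots> = (1 / e) * (\<Sum>n\<in>{n\<in>F. prime n} - X. 1 / real n)" by (simp add: sum_distrib_left)
      also have "\<dots> \<le> (1 / e) * \<delta>"
        using F e by (intro mult_left_mono tail) (auto simp: P_def)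
      finally show ?thesis by simp
    qed
    also have "(\<Sum>n\<in>{n\<in>F. \<not> prime n}. mangoldt n * real n powr - (1 + e)) \<le> K2"
    proof -
      have "(\<Sum>n\<in>{n\<in>F. \<not> prime n}. mangoldt n * real n powr - (1 + e)) \<le> (\<Sum>n\<in>{n\<in>F. \<not> prime n}. mangoldt n / real n)"
      proof (rule sum_mono)
        fix n assume "n \<in> {n\<in>F. \<not> prime n}"
        then have n: "real n \<ge> 1" using F(2) by auto
        have "real n powr - (1 + e) \<le> real n powr - 1" using n e by (intro powr_mono) auto
        then have "mangoldt n * real n powr - (1 + e) \<le> mangoldt n * real n powr - 1"
          by (intro mult_left_mono) (auto simp: mangoldt_nonneg)
        then show "mangoldt n * real n powr - (1 + e) \<le> mangoldt n / real n"
          using n by (simp add: powr_minus_divide)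
      qed
      also have "\<dots> \<le> K2" unfolding K2_def by (rule mangoldt_nonprime_bounded) (use F in auto)
      finally show ?thesis .
    qed
    finally show "(\<Sum>n\<in>F. mangoldt n * real n powr - (1 + e)) \<le> K3 + \<delta> / e + K2" by simp
  qed
  have "\<exists>K. \<forall>\<psi>\<in>characters m - {principal_character m}.
      eventually (\<lambda>e. norm (mangoldt_series \<psi> (1 + e)) \<le> K \<psi>) (at_right 0)"
    using mangoldt_series_bounded[OF m] by (intro bchoice) auto
  then obtain K where K: "\<And>\<psi>. \<psi> \<in> characters m - {principal_character m} \<Longrightarrow>
      eventually (\<lambda>e. norm (mangoldt_series \<psi> (1 + e)) \<le> K \<psi>) (at_right 0)" by blast
  define K' where "K' = sum K (characters m - {principal_character m})"
  have fin: "finite (characters m - {principal_character m})" using finite_characters[OF m] by simp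
  have "eventually (\<lambda>e. \<forall>\<psi>\<in>characters m - {principal_character m}. norm (mangoldt_series \<psi> (1 + e)) \<le> K \<psi>) (at_right 0)"
    using K fin by (intro eventually_ball_finite) auto
  moreover have "eventually (\<lambda>e::real. e \<le> 1 / 4) (at_right 0)"
    using eventually_at_right_real[of 0 "1 / 4"] by (auto elim: eventually_mono)
  ultimately have ev: "eventually (\<lambda>e. c \<le> ?N * \<delta> + e * (?N * (K3 + K2) + K')) (at_right 0)"
    using eventually_at_right_less[of 0]
  proof eventually_elim
    case (elim e)
    have pr: "principal_character m \<in> characters m" using dirichlet_character_principal by simp
    have "(\<Sum>\<psi>\<in>characters m. cnj (\<psi> a) * mangoldt_series \<psi> (1 + e)) =
       mangoldt_series (principal_character m) (1 + e) +
       (\<Sum>\<psi>\<in>characters m - {principal_character m}. cnj (\<psi> a) * mangoldt_series \<psi> (1 + e))"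
      using a by (subst sum.remove[OF finite_characters[OF m] pr]) (simp add: principal_character_def)
    moreover have "norm (\<Sum>\<psi>\<in>characters m - {principal_character m}. cnj (\<psi> a) * mangoldt_series \<psi> (1 + e)) \<le> K'"
      unfolding K'_def
    proof (rule sum_norm_le)
      fix \<psi> assume \<psi>: "\<psi> \<in> characters m - {principal_character m}"
      then have "norm (\<psi> a) \<le> 1" using dirichlet_character_norm_le_1[OF m] by auto
      then have "norm (\<psi> a) * norm (mangoldt_series \<psi> (1 + e)) \<le> 1 * K \<psi>"
        using elim \<psi> by (intro mult_mono) auto
      then show "norm (cnj (\<psi> a) * mangoldt_series \<psi> (1 + e)) \<le> K \<psi>" by (simp add: norm_mult)
    qed
    then have "Re (\<Sum>\<psi>\<in>characters m - {principal_character m}. cnj (\<psi> a) * mangoldt_series \<psi> (1 + e)) \<ge> - K'"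
      using abs_Re_le_cmod[of "\<Sum>\<psi>\<in>characters m - {principal_character m}. cnj (\<psi> a) * mangoldt_series \<psi> (1 + e)"]
      by linarith
    ultimately have "c / e - K' \<le> Re (\<Sum>\<psi>\<in>characters m. cnj (\<psi> a) * mangoldt_series \<psi> (1 + e))"
      using mangoldt_series_principal_lower[OF m, of e] elim by (simp add: c_def)
    also have "\<dots> \<le> ?N * (K3 + \<delta> / e + K2)"
      using upper[of e] elim N by (simp add: divide_le_eq mult.commute)
    finally have "e * (c / e - K') \<le> e * (?N * (K3 + \<delta> / e + K2))"
      using elim by (intro mult_left_mono) auto
    then show ?case using elim by (simp add: algebra_simps)
  qed
  have "((\<lambda>e. ?N * \<delta> + e * (?N * (K3 + K2) + K')) \<longlongrightarrow> ?N * \<delta> + 0 * (?N * (K3 + K2) + K')) (at_right 0)"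
    by (intro tendsto_intros)
  then have "c \<le> ?N * \<delta> + 0 * (?N * (K3 + K2) + K')"
    by (rule tendsto_lowerbound[OF _ ev]) simp
  then show False using c N by (simp add: \<delta>_def)
qed

section \<open>Tilting the signs on large primes\<close>

text \<open>Factors are exchanged one at a time, each costing |exp w - (1 + w)| \<le> exp |w| *
  |w|^2. For w of size 1/p the square sum is small when all primes are large, while the plain sum
  stays bounded.\<close>

lemma norm_prod_minus_exp_le:
  fixes w :: "'i \<Rightarrow> complex"
  assumes "finite F"
  shows "norm ((\<Prod>i\<in>F. 1 + w i) - exp (\<Sum>i\<in>F. w i)) \<le> exp (\<Sum>i\<in>F. norm (w i)) * (\<Sum>i\<in>F. norm (w i) ^ 2)"
  using assms
proof (induction F rule: finite_induct)
  case (insert i F)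
  define P E s q where "P = (\<Prod>i\<in>F. 1 + w i)" and "E = exp (\<Sum>i\<in>F. w i)"
    and "s = (\<Sum>i\<in>F. norm (w i))" and "q = (\<Sum>i\<in>F. norm (w i) ^ 2)"
  have IH: "norm (P - E) \<le> exp s * q" using insert.IH by (simp add: P_def E_def s_def q_def)
  have "norm E \<le> exp s"
    unfolding E_def s_def by (rule order_trans[OF norm_exp]) (simp add: norm_sum)
  have T: "norm (exp (w i) - (1 + w i)) \<le> exp (norm (w i)) * norm (w i) ^ 2"
    using Taylor_exp_field[of "w i" 1] by (simp add: power2_eq_square)
  have one: "norm (1 + w i) \<le> exp (norm (w i))"
    by (rule order_trans[OF norm_triangle_ineq]) (simp add: exp_ge_add_one_self)
  have "norm ((1 + w i) * P - exp (w i) * E) = norm ((1 + w i) * (P - E) - E * (exp (w i) - (1 + w i)))"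
    by (simp add: algebra_simps)
  also have "\<dots> \<le> norm (1 + w i) * norm (P - E) + norm E * norm (exp (w i) - (1 + w i))"
    unfolding norm_mult[symmetric] by (rule norm_triangle_ineq4)
  also have "\<dots> \<le> exp (norm (w i)) * (exp s * q) + exp s * (exp (norm (w i)) * norm (w i) ^ 2)"
    using IH \<open>norm E \<le> exp s\<close> T one by (intro add_mono mult_mono) auto
  also have "\<dots> = exp (norm (w i) + s) * (norm (w i) ^ 2 + q)"
    by (simp add: exp_add algebra_simps)
  finally show ?case
    using insert.hyps by (simp add: P_def E_def s_def q_def exp_add)
qed simp

text \<open>Primes are added in increasing order until the sum first reaches K; the last one
  overshoots by at most 1/(z + 1).\<close>

lemma exists_primes_in_class:
  assumes m: "m > 0" and a: "coprime a m" and K: "K \<ge> 0"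
  shows "\<exists>P. finite P \<and> (\<forall>p\<in>P. prime p \<and> [a = p] (mod m) \<and> p > z) \<and>
           K \<le> (\<Sum>p\<in>P. 1 / real p) \<and> (\<Sum>p\<in>P. 1 / real p) \<le> K + 1 / real (Suc z)"
proof -
  define Q where "Q = {p. prime p \<and> [a = p] (mod m) \<and> p > z}"
  define h where "h n = (\<Sum>p\<in>{p\<in>Q. p < n}. 1 / real p)" for n :: nat
  have "\<exists>n. h n \<ge> K"
  proof (rule ccontr)
    assume "\<not> ?thesis"
    then have lt: "h n < K" for n by (auto simp: not_le)
    have "(\<lambda>p. 1 / real p) summable_on Q"
    proof (rule nonneg_bdd_above_summable_on)
      show "bdd_above (sum (\<lambda>p. 1 / real p) ` {F. F \<subseteq> Q \<and> finite F})"
      proof (rule bdd_aboveI2)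
        fix F assume F: "F \<in> {F. F \<subseteq> Q \<and> finite F}"
        have "(\<Sum>p\<in>F. 1 / real p) \<le> h (Suc (Max (insert 0 F)))"
          unfolding h_def using F by (intro sum_mono2) (auto simp: le_imp_less_Suc)
        then show "(\<Sum>p\<in>F. 1 / real p) \<le> K" using lt by (meson less_imp_le order_trans)
      qed
    qed simp
    moreover have "finite {p. prime p \<and> [a = p] (mod m) \<and> p \<le> z}"
      by (rule finite_subset[of _ "{..z}"]) auto
    ultimately have "(\<lambda>p. 1 / real p) summable_on (Q \<union> {p. prime p \<and> [a = p] (mod m) \<and> p \<le> z})"
      by (rule summable_on_union[OF _ summable_on_finite])
    moreover have "Q \<union> {p. prime p \<and> [a = p] (mod m) \<and> p \<le> z} = {p. prime p \<and> [a = p] (mod m)}"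
      by (auto simp: Q_def)
    ultimately show False using dirichlet_primes_not_summable[OF m a] by simp
  qed
  define n where "n = (LEAST n. h n \<ge> K)"
  have n: "h n \<ge> K" unfolding n_def using \<open>\<exists>n. h n \<ge> K\<close> by (rule LeastI_ex)
  have "h n \<le> K + 1 / real (Suc z)"
  proof (cases n)
    case 0
    then show ?thesis using K by (simp add: h_def)
  next
    case (Suc k)
    have hk: "h k < K" using not_less_Least[of k "\<lambda>n. h n \<ge> K"] Suc by (simp add: n_def)
    have "h n \<le> h k + 1 / real (Suc z)"
    proof (cases "k \<in> Q")
      case True
      have "{p \<in> Q. p < n} = insert k {p \<in> Q. p < k}" using True Suc by auto
      then have "h n = 1 / real k + h k" by (simp add: h_def)
      moreover have "1 / real k \<le> 1 / real (Suc z)" using True by (intro divide_left_mono) (auto simp: Q_def)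
      ultimately show ?thesis by simp
    next
      case False
      have "{p \<in> Q. p < n} = {p \<in> Q. p < k}" using False Suc by (auto simp: less_Suc_eq)
      then show ?thesis by (simp add: h_def)
    qed
    then show ?thesis using hk by simp
  qed
  then show ?thesis using n unfolding h_def
    by (intro exI[of _ "{p\<in>Q. p < n}"]) (auto simp: Q_def)
qed

lemma sum_character_cnj_character:
  assumes m: "m > 0" and \<psi>: "dirichlet_character m \<psi>" and \<kappa>: "dirichlet_character m \<kappa>"
  shows "(\<Sum>a<m. cnj (\<kappa> a) * \<psi> a) = (if \<psi> = \<kappa> then of_nat (card {a\<in>{..<m}. coprime a m}) else 0)"
proof (cases "\<psi> = \<kappa>")
  case True
  then have "(\<Sum>a<m. cnj (\<kappa> a) * \<psi> a) = (\<Sum>a<m. if coprime a m then 1 else 0)"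
    using dirichlet_character_mult_cnj[OF m \<psi>] by (simp add: mult.commute)
  then show ?thesis using True by (simp add: sum.If_cases Int_def)
next
  case False
  then obtain g where g: "\<psi> g \<noteq> \<kappa> g" by blast
  have "cnj (\<kappa> g) * \<psi> g \<noteq> principal_character m g"
  proof (cases "coprime g m")
    case True
    have "\<kappa> g * cnj (\<kappa> g) = 1" using True dirichlet_character_mult_cnj[OF m \<kappa>] by simp
    then have "cnj (\<kappa> g) * \<psi> g \<noteq> 1" using g by (metis mult.assoc mult.commute mult.right_neutral)
    then show ?thesis using True by (simp add: principal_character_def)
  next
    case False
    then have "\<psi> g = 0" "\<kappa> g = 0"
      using dirichlet_character_eq_0_iff[OF \<psi>] dirichlet_character_eq_0_iff[OF \<kappa>] by auto
    then show ?thesis using g by simp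
  qed
  then have "(\<lambda>a. cnj (\<kappa> a) * \<psi> a) \<noteq> principal_character m" by metis
  then show ?thesis
    using sum_character_totatives[OF m dirichlet_character_times[OF dirichlet_character_cnj[OF \<kappa>] \<psi>]] False
    by simp
qed

text \<open>Putting \<open>f(p) = sgn (v a)\<close> on finitely many large primes \<open>p \<equiv> a\<close> with reciprocal sum about
  \<open>|v a|\<close> multiplies the \<open>\<psi>\<close>-component by about \<open>exp (\<Sum> v(a) \<psi>(a))\<close>, for all \<open>\<psi>\<close> simultaneously.\<close>

lemma exists_tilts_tendsto_exp:
  fixes v :: "nat \<Rightarrow> real"
  assumes m: "m > 0"
  shows "\<exists>F t. (\<forall>z. finite (F z) \<and> (\<forall>p\<in>F z. prime p)) \<and> (\<forall>p. \<bar>t p\<bar> \<le> 1) \<and>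
     (\<forall>\<psi>. dirichlet_character m \<psi> \<longrightarrow>
       (\<lambda>z. \<Prod>p\<in>F z. 1 + of_real (t p) * \<psi> p / of_nat p) \<longlonglongrightarrow> exp (\<Sum>a<m. of_real (v a) * \<psi> a))"
proof -
  define U where "U = {a\<in>{..<m}. coprime a m}"
  have finU: "finite U" by (simp add: U_def)
  have "\<forall>z. \<forall>a\<in>U. \<exists>P. finite P \<and> (\<forall>p\<in>P. prime p \<and> [a = p] (mod m) \<and> p > z) \<and>
           \<bar>v a\<bar> \<le> (\<Sum>p\<in>P. 1 / real p) \<and> (\<Sum>p\<in>P. 1 / real p) \<le> \<bar>v a\<bar> + 1 / real (Suc z)"
    using exists_primes_in_class[OF m] by (auto simp: U_def)
  then obtain P where P: "\<And>z a. a \<in> U \<Longrightarrow> finite (P z a)"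
    "\<And>z a p. a \<in> U \<Longrightarrow> p \<in> P z a \<Longrightarrow> prime p \<and> [a = p] (mod m) \<and> p > z"
    "\<And>z a. a \<in> U \<Longrightarrow> \<bar>v a\<bar> \<le> (\<Sum>p\<in>P z a. 1 / real p)"
    "\<And>z a. a \<in> U \<Longrightarrow> (\<Sum>p\<in>P z a. 1 / real p) \<le> \<bar>v a\<bar> + 1 / real (Suc z)"
    by (auto simp: bchoice_iff choice_iff) metis
  define F where "F z = (\<Union>a\<in>U. P z a)" for z
  \<comment> \<open>The sign depends on the residue class only, so a single t serves all z.\<close>
  define t where "t p = sgn (v (p mod m))" for p
  have pm: "p mod m = a" if "a \<in> U" "p \<in> P z a" for p a z
    using P(2)[OF that] that(1) by (auto simp: U_def cong_def)
  have finF: "finite (F z)" for z using finU P(1) by (auto simp: F_def)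
  have t1: "\<bar>t p\<bar> \<le> 1" for p by (simp add: t_def sgn_if)
  have sumF: "(\<Sum>p\<in>F z. g p) = (\<Sum>a\<in>U. \<Sum>p\<in>P z a. g p)" for g :: "nat \<Rightarrow> 'b :: comm_monoid_add" and z
    unfolding F_def
  proof (rule sum.UNION_disjoint[OF finU])
    show "\<forall>a\<in>U. \<forall>b\<in>U. a \<noteq> b \<longrightarrow> P z a \<inter> P z b = {}"
      using pm by blast
  qed (use P(1) in auto)
  define V where "V = (\<Sum>a\<in>U. \<bar>v a\<bar> + 1)"
  have lim: "(\<lambda>z. \<Prod>p\<in>F z. 1 + of_real (t p) * \<psi> p / of_nat p) \<longlonglongrightarrow> exp (\<Sum>a<m. of_real (v a) * \<psi> a)"
    if \<psi>: "dirichlet_character m \<psi>" for \<psi>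
  proof -
    define w where "w p = of_real (t p) * \<psi> p / of_nat p" for p
    have nw: "norm (w p) \<le> 1 / real p" for p
    proof -
      have "\<bar>t p\<bar> * norm (\<psi> p) \<le> 1 * 1"
        using t1 dirichlet_character_norm_le_1[OF m \<psi>] by (intro mult_mono) auto
      then show ?thesis by (simp add: w_def norm_mult norm_divide divide_right_mono)
    qed
    have s1: "(\<Sum>p\<in>F z. norm (w p)) \<le> V" for z
    proof -
      have "(\<Sum>p\<in>F z. norm (w p)) \<le> (\<Sum>p\<in>F z. 1 / real p)" by (rule sum_mono[OF nw])
      also have "\<dots> \<le> (\<Sum>a\<in>U. \<bar>v a\<bar> + 1)"
        unfolding sumF
      proof (rule sum_mono)
        fix a assume "a \<in> U"
        moreover have "1 / real (Suc z) \<le> 1" by simp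
        ultimately show "(\<Sum>p\<in>P z a. 1 / real p) \<le> \<bar>v a\<bar> + 1" using P(4)[of a z] by linarith
      qed
      finally show ?thesis by (simp add: V_def)
    qed
    have s2: "(\<Sum>p\<in>F z. norm (w p) ^ 2) \<le> V / real (Suc z)" for z
    proof -
      have "(\<Sum>p\<in>F z. norm (w p) ^ 2) \<le> (\<Sum>p\<in>F z. norm (w p) * (1 / real (Suc z)))"
      proof (rule sum_mono)
        fix p assume "p \<in> F z"
        then have "p > z" using P(2) by (auto simp: F_def)
        then have "1 / real p \<le> 1 / real (Suc z)" by (intro divide_left_mono) auto
        then have "norm (w p) \<le> 1 / real (Suc z)" using nw[of p] by linarith
        then show "norm (w p) ^ 2 \<le> norm (w p) * (1 / real (Suc z))"
          unfolding power2_eq_square by (intro mult_left_mono) auto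
      qed
      also have "\<dots> = (\<Sum>p\<in>F z. norm (w p)) / real (Suc z)" by (simp add: sum_divide_distrib)
      also have "\<dots> \<le> V / real (Suc z)" by (intro divide_right_mono s1) auto
      finally show ?thesis .
    qed
    have "(\<lambda>z. (\<Prod>p\<in>F z. 1 + w p) - exp (\<Sum>p\<in>F z. w p)) \<longlonglongrightarrow> 0"
    proof (rule Lim_null_comparison)
      show "\<forall>\<^sub>F z in sequentially. norm ((\<Prod>p\<in>F z. 1 + w p) - exp (\<Sum>p\<in>F z. w p)) \<le> exp V * (V / real (Suc z))"
      proof (intro always_eventually allI)
        fix z
        show "norm ((\<Prod>p\<in>F z. 1 + w p) - exp (\<Sum>p\<in>F z. w p)) \<le> exp V * (V / real (Suc z))"
          by (rule order_trans[OF norm_prod_minus_exp_le[OF finF]])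
             (intro mult_mono s2, use s1 in \<open>auto intro!: sum_nonneg\<close>)
      qed
      show "(\<lambda>z. exp V * (V / real (Suc z))) \<longlonglongrightarrow> 0" by real_asymp
    qed
    moreover have "(\<lambda>z. exp (\<Sum>p\<in>F z. w p)) \<longlonglongrightarrow> exp (\<Sum>a<m. of_real (v a) * \<psi> a)"
    proof (intro tendsto_intros)
      have "(\<lambda>z. \<Sum>a\<in>U. of_real (sgn (v a) * (\<Sum>p\<in>P z a. 1 / real p)) * \<psi> a) \<longlonglongrightarrow> (\<Sum>a\<in>U. of_real (sgn (v a) * \<bar>v a\<bar>) * \<psi> a)"
      proof (intro tendsto_intros)
        fix a assume a: "a \<in> U"
        show "(\<lambda>z. \<Sum>p\<in>P z a. 1 / real p) \<longlonglongrightarrow> \<bar>v a\<bar>"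
        proof (rule tendsto_sandwich[of "\<lambda>_. \<bar>v a\<bar>" _ _ "\<lambda>z. \<bar>v a\<bar> + 1 / real (Suc z)"])
          show "(\<lambda>z. \<bar>v a\<bar> + 1 / real (Suc z)) \<longlonglongrightarrow> \<bar>v a\<bar>" by real_asymp
        qed (use P(3,4)[OF a] in auto)
      qed
      also have "(\<Sum>a\<in>U. of_real (sgn (v a) * \<bar>v a\<bar>) * \<psi> a) = (\<Sum>a<m. of_real (v a) * \<psi> a)"
        using dirichlet_character_eq_0_iff[OF \<psi>]
        by (intro sum.mono_neutral_cong_left) (auto simp: U_def sgn_mult_abs)
      also have "(\<lambda>z. \<Sum>a\<in>U. of_real (sgn (v a) * (\<Sum>p\<in>P z a. 1 / real p)) * \<psi> a) = (\<lambda>z. \<Sum>p\<in>F z. w p)"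
      proof (rule ext, unfold sumF, rule sum.cong[OF refl])
        fix z a assume a: "a \<in> U"
        have "w p = of_real (sgn (v a)) * of_real (1 / real p) * \<psi> a" if "p \<in> P z a" for p
        proof -
          have "\<psi> p = \<psi> a"
            using P(2)[OF a that] by (intro dirichlet_character_cong[OF \<psi>]) (auto intro: cong_sym)
          then show ?thesis by (simp add: w_def t_def pm[OF a that])
        qed
        then show "of_real (sgn (v a) * (\<Sum>p\<in>P z a. 1 / real p)) * \<psi> a = (\<Sum>p\<in>P z a. w p)"
          by (simp add: sum_distrib_left sum_distrib_right)
      qed
      finally show "(\<lambda>z. \<Sum>p\<in>F z. w p) \<longlonglongrightarrow> (\<Sum>a<m. of_real (v a) * \<psi> a)" .
    qed
    ultimately have "(\<lambda>z. ((\<Prod>p\<in>F z. 1 + w p) - exp (\<Sum>p\<in>F z. w p)) + exp (\<Sum>p\<in>F z. w p)) \<longlonglongrightarrow> 0 + exp (\<Sum>a<m. of_real (v a) * \<psi> a)"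
      by (rule tendsto_add)
    then show ?thesis by (simp add: w_def)
  qed
  have "\<forall>z. finite (F z) \<and> (\<forall>p\<in>F z. prime p)"
    using finF P(2) by (auto simp: F_def)
  then show ?thesis using t1 lim by blast
qed

text \<open>The first terms give 5/4 and a telescoping bound for the rest gives 1/2. The bound 2
  serves twice: for L(2) \<noteq> 0 and for the second moment bound 8.\<close>

lemma zeta_2_less_2: "zeta 2 < 2"
proof -
  have s: "summable (\<lambda>n. real n powr - 2)" by (rule summable_zeta) simp
  have s3: "summable (\<lambda>n. real (n + 3) powr - 2)" using s by (subst summable_iff_shift)
  have "zeta 2 = (\<Sum>n. real (n + 3) powr - 2) + (\<Sum>n<3. real n powr - 2)"
    by (rule suminf_split_initial_segment[OF s])
  also have "(\<Sum>n<3. real n powr - 2) = 5 / 4"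
    by (simp add: eval_nat_numeral powr_minus_divide)
  also have "(\<Sum>n. real (n + 3) powr - 2) \<le> 1 / 2"
  proof (rule suminf_le_const[OF s3])
    fix N
    have "(\<Sum>n<N. real (n + 3) powr - 2) \<le> (\<Sum>n<N. real (n + 2) powr - 1 - real (Suc n + 2) powr - 1)"
    proof (rule sum_mono)
      fix n
      have "real (Suc (n + 2)) powr - 2 \<le> real (n + 2) powr - 1 - real (Suc (n + 2)) powr - 1"
        using powr_telescope_bounds(1)[of 1 "n + 2"] by (simp del: of_nat_Suc of_nat_add)
      moreover have "Suc (n + 2) = n + 3" "Suc (n + 2) = Suc n + 2" by simp_all
      ultimately show "real (n + 3) powr - 2 \<le> real (n + 2) powr - 1 - real (Suc n + 2) powr - 1"
        by (simp add: add.commute)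
    qed
    also have "\<dots> = real (0 + 2) powr - 1 - real (N + 2) powr - 1"
      by (rule sum_lessThan_telescope')
    also have "\<dots> \<le> 1 / 2" by (simp add: powr_minus_divide)
    finally show "(\<Sum>n<N. real (n + 3) powr - 2) \<le> 1 / 2" .
  qed
  finally show ?thesis by simp
qed

text \<open>The term n = 1 dominates, since the remaining ones add up to at most zeta(2) - 1 < 1 in
  norm.\<close>

lemma L_series_2_nonzero:
  assumes m: "m > 0" and \<psi>: "dirichlet_character m \<psi>"
  shows "L_series \<psi> 2 \<noteq> 0"
proof
  assume z: "L_series \<psi> 2 = 0"
  define g where "g n = \<psi> n * of_real (real n powr - 2)" for n
  have sn: "summable (\<lambda>n. norm (g n))" unfolding g_def by (rule character_euler_product(2)[OF assms]) simp
  have s2: "summable (\<lambda>n. norm (g (n + 2)))" using sn by (subst summable_iff_shift)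
  have sz: "summable (\<lambda>n. real n powr - 2)" by (rule summable_zeta) simp
  have "0 = (\<Sum>n. g (n + 2)) + (\<Sum>n<2. g n)"
    using suminf_split_initial_segment[OF summable_norm_cancel[OF sn], of 2] z by (simp add: L_series_def g_def)
  also have "(\<Sum>n<2. g n) = 1" by (simp add: eval_nat_numeral g_def dirichlet_character_one[OF \<psi>])
  finally have "(\<Sum>n. g (n + 2)) = - 1" by (simp add: eq_neg_iff_add_eq_0)
  then have "1 \<le> (\<Sum>n. norm (g (n + 2)))" using summable_norm[OF s2] by simp
  also have "\<dots> \<le> (\<Sum>n. real (n + 2) powr - 2)"
  proof (rule suminf_le[OF _ s2])
    show "norm (g (n + 2)) \<le> real (n + 2) powr - 2" for n
      using dirichlet_character_norm_le_1[OF m \<psi>, of "n + 2"] by (simp add: g_def norm_mult mult_left_le_one_le)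
    show "summable (\<lambda>n. real (n + 2) powr - 2)"
      using sz by (subst summable_iff_shift)
  qed
  also have "\<dots> = zeta 2 - 1"
    using suminf_split_initial_segment[OF sz, of 2] by (simp add: eval_nat_numeral)
  finally show False using zeta_2_less_2 by simp
qed

section \<open>A tilt with negative limiting expectation\<close>

lemma L_series_cnj:
  assumes m: "m > 0" and \<psi>: "dirichlet_character m \<psi>" and s: "s > 1"
  shows "L_series (\<lambda>n. cnj (\<psi> n)) s = cnj (L_series \<psi> s)"
proof -
  have "(\<lambda>n. \<psi> n * of_real (real n powr - s)) sums L_series \<psi> s"
    unfolding L_series_def
    by (rule summable_sums[OF summable_norm_cancel[OF character_euler_product(2)[OF assms]]])
  then have "(\<lambda>n. cnj (\<psi> n * of_real (real n powr - s))) sums cnj (L_series \<psi> s)"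
    by (simp only: sums_cnj)
  then have "(\<lambda>n. cnj (\<psi> n) * of_real (real n powr - s)) sums cnj (L_series \<psi> s)" by simp
  then show ?thesis
    unfolding L_series_def[of "\<lambda>n. cnj (\<psi> n)"] by (rule sums_unique[symmetric])
qed

lemma char_coeff_cnj: "char_coeff m S (\<lambda>n. cnj (\<psi> n)) = cnj (char_coeff m S \<psi>)"
  by (simp add: char_coeff_def)

theorem exists_negative_tilt:
  assumes m: "m > 0"
    and fails: "\<not> (\<forall>\<psi>. dirichlet_character m \<psi> \<longrightarrow>
              (if real_character \<psi> then char_coeff m S \<psi> \<in> \<real>\<^sub>\<ge>\<^sub>0 else char_coeff m S \<psi> = 0))"
  shows "\<exists>F t. finite F \<and> (\<forall>p\<in>F. prime p) \<and> (\<forall>p. \<bar>t p\<bar> \<le> 1) \<and>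
    Re (\<Sum>\<psi>\<in>characters m. char_coeff m S \<psi> * L_series (\<lambda>n. \<psi> n * \<psi> n) 2 *
          (\<Prod>p\<in>F. 1 + of_real (t p) * \<psi> p / of_nat p)) < 0"
proof -
  define c where "c \<psi> = char_coeff m S \<psi> * L_series (\<lambda>n. \<psi> n * \<psi> n) 2" for \<psi>
  obtain \<kappa> where \<kappa>: "dirichlet_character m \<kappa>"
    "\<not> (if real_character \<kappa> then char_coeff m S \<kappa> \<in> \<real>\<^sub>\<ge>\<^sub>0 else char_coeff m S \<kappa> = 0)"
    using fails by blast
  define \<kappa>' where "\<kappa>' = (\<lambda>n. cnj (\<kappa> n))"
  have \<kappa>': "dirichlet_character m \<kappa>'" unfolding \<kappa>'_def by (rule dirichlet_character_cnj[OF \<kappa>(1)])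
  note sq = dirichlet_character_times[OF \<kappa>(1) \<kappa>(1)]
  have c': "c \<kappa>' = cnj (c \<kappa>)"
    using L_series_cnj[OF m sq, of 2] by (simp add: c_def \<kappa>'_def char_coeff_cnj)
  have "char_coeff m S \<kappa> \<noteq> 0" using \<kappa>(2) by (auto split: if_splits)
  then have c0: "c \<kappa> \<noteq> 0" using L_series_2_nonzero[OF m sq] by (simp add: c_def)
  define \<phi> where "\<phi> = real (card {a\<in>{..<m}. coprime a m})"
  have "1 mod m \<in> {a\<in>{..<m}. coprime a m}" using m by (simp add: coprime_mod_left_iff)
  then have \<phi>: "\<phi> > 0" unfolding \<phi>_def by (subst of_nat_0_less_iff, subst card_gt_0_iff) auto
  \<comment> \<open>The real part keeps \<open>v \<eta>\<close> real at the price of involving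
    \<kappa> and its conjugate together. By orthogonality the exponent is \<eta>/2 at \<kappa>, its
    conjugate at \<open>\<kappa>'\<close>, Re \<eta> if the two coincide, and 0 at all other
    characters, whose total therefore does not change with \<eta>.\<close>
  define v where "v \<eta> a = Re (\<eta> * cnj (\<kappa> a)) / \<phi>" for \<eta> a
  have Ev: "(\<Sum>a<m. of_real (v \<eta> a) * \<psi> a) =
     (\<eta> * of_bool (\<psi> = \<kappa>) + cnj \<eta> * of_bool (\<psi> = \<kappa>')) / 2" if \<psi>: "dirichlet_character m \<psi>" for \<eta> \<psi>
  proof -
    have "of_real (v \<eta> a) = (\<eta> * cnj (\<kappa> a) + cnj \<eta> * cnj (\<kappa>' a)) / (2 * \<phi>)" for a
    proof -
      have "\<eta> * cnj (\<kappa> a) + cnj \<eta> * cnj (\<kappa>' a) = of_real (2 * Re (\<eta> * cnj (\<kappa> a)))"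
        using complex_add_cnj[of "\<eta> * cnj (\<kappa> a)"] unfolding \<kappa>'_def complex_cnj_mult complex_cnj_cnj .
      moreover have "complex_of_real (r / \<phi>) = complex_of_real (2 * r) / complex_of_real (2 * \<phi>)" for r
        by simp
      ultimately show ?thesis by (simp only: v_def)
    qed
    then have "of_real (v \<eta> a) * \<psi> a =
        (\<eta> * (cnj (\<kappa> a) * \<psi> a) + cnj \<eta> * (cnj (\<kappa>' a) * \<psi> a)) / of_real (2 * \<phi>)" for a
      by (simp only: times_divide_eq_left distrib_right mult.assoc)
    then have "(\<Sum>a<m. of_real (v \<eta> a) * \<psi> a) =
       (\<eta> * (\<Sum>a<m. cnj (\<kappa> a) * \<psi> a) + cnj \<eta> * (\<Sum>a<m. cnj (\<kappa>' a) * \<psi> a)) / of_real (2 * \<phi>)"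
      by (simp only: sum_divide_distrib[symmetric] sum.distrib sum_distrib_left)
    also have "(\<Sum>a<m. cnj (\<kappa> a) * \<psi> a) = of_bool (\<psi> = \<kappa>) * of_real \<phi>"
      using sum_character_cnj_character[OF m \<psi> \<kappa>(1)] by (simp add: \<phi>_def)
    also have "(\<Sum>a<m. cnj (\<kappa>' a) * \<psi> a) = of_bool (\<psi> = \<kappa>') * of_real \<phi>"
      using sum_character_cnj_character[OF m \<psi> \<kappa>'] by (simp add: \<phi>_def)
    also have "(\<eta> * (of_bool (\<psi> = \<kappa>) * of_real \<phi>) + cnj \<eta> * (of_bool (\<psi> = \<kappa>') * of_real \<phi>)) / of_real (2 * \<phi>) =
        (\<eta> * of_bool (\<psi> = \<kappa>) + cnj \<eta> * of_bool (\<psi> = \<kappa>')) / 2"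
    proof -
      have "(x * (b * y) + x' * (b' * y)) / (2 * y) = (x * b + x' * b') / 2" if "y \<noteq> 0" for x b x' b' y :: complex
        using that by (simp add: field_simps)
      then show ?thesis using \<phi> by simp
    qed
    finally show ?thesis .
  qed
  have "\<exists>\<eta>. Re (\<Sum>\<psi>\<in>characters m. c \<psi> * exp (\<Sum>a<m. of_real (v \<eta> a) * \<psi> a)) < 0"
  proof -
    define B where "B = (\<Sum>\<psi>\<in>characters m - {\<kappa>, \<kappa>'}. c \<psi>)"
    have rest: "(\<Sum>\<psi>\<in>characters m - {\<kappa>, \<kappa>'}. c \<psi> * exp (\<Sum>a<m. of_real (v \<eta> a) * \<psi> a)) = B" for \<eta>
      unfolding B_def by (rule sum.cong) (auto simp: Ev)
    have reB: "Re B \<le> norm B" by (rule complex_Re_le_cmod)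
    show ?thesis
    proof (cases "real_character \<kappa>")
      case True
      have eq: "\<kappa>' = \<kappa>" using True by (auto simp: \<kappa>'_def real_character_def Reals_cnj_iff)
      have cr: "c \<kappa> = of_real (Re (c \<kappa>))" using c' eq by (metis Reals_cnj_iff of_real_Re)
      \<comment> \<open>The multiplier of a real character is a positive real, so the sign has to
        come from the coefficient itself: L(2, \<kappa>^2) is a series of non-negative
        reals.\<close>
      have neg: "Re (c \<kappa>) < 0"
      proof -
        have coeff: "cnj (char_coeff m S \<kappa>) = char_coeff m S \<kappa>"
          using char_coeff_cnj[of m S \<kappa>] eq by (simp add: \<kappa>'_def)
        then have "char_coeff m S \<kappa> = of_real (Re (char_coeff m S \<kappa>))" by (metis Reals_cnj_iff of_real_Re)
        moreover have "Im (char_coeff m S \<kappa>) = 0" using coeff by (simp add: complex_eq_iff)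
        then have "Re (char_coeff m S \<kappa>) < 0"
          using \<kappa>(2) True by (simp add: complex_nonneg_Reals_iff not_le)
        moreover have "Re (L_series (\<lambda>n. \<kappa> n * \<kappa> n) 2) \<ge> 0"
        proof -
          have "(\<lambda>n. \<kappa> n * \<kappa> n * of_real (real n powr - 2)) sums L_series (\<lambda>n. \<kappa> n * \<kappa> n) 2"
            unfolding L_series_def
            by (rule summable_sums[OF summable_norm_cancel[OF character_euler_product(2)[OF m sq]]]) simp
          from sums_Re[OF this] show ?thesis
          proof (rule sums_le[OF _ sums_zero, rotated])
            fix n
            have "\<kappa> n = of_real (Re (\<kappa> n))" using True by (simp add: real_character_def)
            then have "\<kappa> n * \<kappa> n * of_real (real n powr - 2) = of_real (Re (\<kappa> n) * Re (\<kappa> n) * real n powr - 2)"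
              by (metis of_real_mult)
            then show "0 \<le> Re (\<kappa> n * \<kappa> n * of_real (real n powr - 2))"
              by (simp only: Re_complex_of_real) simp
          qed
        qed
        ultimately have "Re (c \<kappa>) \<le> 0"
          using \<open>Im (char_coeff m S \<kappa>) = 0\<close> by (simp add: c_def mult_nonpos_nonneg)
        then show ?thesis using c0 cr by (metis less_eq_real_def of_real_0)
      qed
      define \<eta> where "\<eta> = ln ((norm B + 1) / - Re (c \<kappa>))"
      have e: "exp \<eta> = (norm B + 1) / - Re (c \<kappa>)" unfolding \<eta>_def using neg
        by (intro exp_ln divide_pos_pos) (auto simp: add_nonneg_pos)
      have "(\<Sum>\<psi>\<in>characters m. c \<psi> * exp (\<Sum>a<m. of_real (v \<eta> a) * \<psi> a)) =
         c \<kappa> * exp (\<Sum>a<m. of_real (v \<eta> a) * \<kappa> a) + B"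
      proof (subst sum.remove[OF finite_characters[OF m], of \<kappa>])
        show "\<kappa> \<in> characters m" using \<kappa>(1) by simp
      qed (use rest[of \<eta>] eq in simp)
      also have "exp (\<Sum>a<m. of_real (v \<eta> a) * \<kappa> a) = of_real (exp \<eta>)"
        unfolding Ev[OF \<kappa>(1)] by (simp add: eq exp_of_real)
      also have "c \<kappa> * of_real (exp \<eta>) = of_real (Re (c \<kappa>) * exp \<eta>)" using cr by (metis of_real_mult)
      finally have "Re (\<Sum>\<psi>\<in>characters m. c \<psi> * exp (\<Sum>a<m. of_real (v \<eta> a) * \<psi> a)) = Re (c \<kappa>) * exp \<eta> + Re B"
        by simp
      also have "Re (c \<kappa>) * exp \<eta> = - (norm B + 1)" unfolding e using neg by (simp add: field_simps)
      finally show ?thesis using reB by (intro exI[of _ "of_real \<eta>"]) simp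
    next
      case False
      have neq: "\<kappa>' \<noteq> \<kappa>"
      proof
        assume "\<kappa>' = \<kappa>"
        then have "cnj (\<kappa> n) = \<kappa> n" for n by (metis \<kappa>'_def)
        then show False using False by (auto simp: real_character_def Reals_cnj_iff)
      qed
      \<comment> \<open>With the multiplier w at \<kappa>, this character and its conjugate
        contribute -2 (|B| + 1) together, which outweighs \<open>B\<close>.\<close>
      define w where "w = - of_real (norm B + 1) / c \<kappa>"
      have "norm B + 1 \<noteq> 0" by (smt (verit) norm_ge_zero)
      then have w: "w \<noteq> 0" "c \<kappa> * w = - of_real (norm B + 1)"
        using c0 of_real_eq_0_iff[where 'a = complex, of "norm B + 1"] by (simp_all add: w_def del: of_real_add)
      define \<eta> where "\<eta> = 2 * Ln w"
      have e: "exp (\<eta> / 2) = w" "exp (cnj \<eta> / 2) = cnj w"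
        using w(1) exp_cnj[of "Ln w"] by (simp_all add: \<eta>_def)
      have "(\<Sum>\<psi>\<in>characters m. c \<psi> * exp (\<Sum>a<m. of_real (v \<eta> a) * \<psi> a)) =
         (\<Sum>\<psi>\<in>characters m - {\<kappa>, \<kappa>'}. c \<psi> * exp (\<Sum>a<m. of_real (v \<eta> a) * \<psi> a)) +
         (\<Sum>\<psi>\<in>{\<kappa>, \<kappa>'}. c \<psi> * exp (\<Sum>a<m. of_real (v \<eta> a) * \<psi> a))"
        using \<kappa>(1) \<kappa>' by (intro sum.subset_diff finite_characters[OF m]) auto
      also have "\<dots> = B + (c \<kappa> * w + c \<kappa>' * cnj w)"
        unfolding rest using neq by (simp add: Ev \<kappa>(1) \<kappa>' e)
      also have "c \<kappa>' * cnj w = cnj (c \<kappa> * w)" by (simp add: c')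
      finally have "Re (\<Sum>\<psi>\<in>characters m. c \<psi> * exp (\<Sum>a<m. of_real (v \<eta> a) * \<psi> a)) = Re B - 2 * (norm B + 1)"
        unfolding w(2) by simp
      moreover have "r \<le> s \<Longrightarrow> 0 \<le> s \<Longrightarrow> r - 2 * (s + 1) < 0" for r s :: real by simp
      then have "Re B - 2 * (norm B + 1) < 0" using reB norm_ge_zero by blast
      ultimately show ?thesis by (intro exI[of _ \<eta>]) (simp only:)
    qed
  qed
  then obtain \<eta> where \<eta>: "Re (\<Sum>\<psi>\<in>characters m. c \<psi> * exp (\<Sum>a<m. of_real (v \<eta> a) * \<psi> a)) < 0" by blast
  from exists_tilts_tendsto_exp[OF m, of "v \<eta>"] obtain F t where
    F: "\<forall>z. finite (F z) \<and> (\<forall>p\<in>F z. prime p)" and t: "\<forall>p. \<bar>t p\<bar> \<le> 1" and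
    lim: "\<And>\<psi>. dirichlet_character m \<psi> \<Longrightarrow>
       (\<lambda>z. \<Prod>p\<in>F z. 1 + of_real (t p) * \<psi> p / of_nat p) \<longlonglongrightarrow> exp (\<Sum>a<m. of_real (v \<eta> a) * \<psi> a)"
    by blast
  have "(\<lambda>z. Re (\<Sum>\<psi>\<in>characters m. c \<psi> * (\<Prod>p\<in>F z. 1 + of_real (t p) * \<psi> p / of_nat p))) \<longlonglongrightarrow>
     Re (\<Sum>\<psi>\<in>characters m. c \<psi> * exp (\<Sum>a<m. of_real (v \<eta> a) * \<psi> a))"
    by (intro tendsto_Re tendsto_sum tendsto_mult tendsto_const lim) auto
  from order_tendstoD(2)[OF this \<eta>] obtain z where
    "Re (\<Sum>\<psi>\<in>characters m. c \<psi> * (\<Prod>p\<in>F z. 1 + of_real (t p) * \<psi> p / of_nat p)) < 0"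
    by (auto simp: eventually_sequentially)
  then show ?thesis using F t unfolding c_def by blast
qed

section \<open>The random partial sums\<close>

lemma squarefree_eq_prod_prime_factors:
  fixes q :: nat
  assumes "squarefree q"
  shows "q = \<Prod>(prime_factors q)"
proof -
  have q: "q \<noteq> 0" using assms by (metis Squarefree.not_squarefree_0)
  have "(\<Prod>p\<in>prime_factors q. p ^ multiplicity p q) = \<Prod>(prime_factors q)"
  proof (rule prod.cong[OF refl])
    fix p assume p: "p \<in> prime_factors q"
    then have "multiplicity p q = 1"
      using assms squarefree_factorial_semiring'[OF q] by blast
    then show "p ^ multiplicity p q = p" by simp
  qed
  then show ?thesis using prod_prime_factors[OF q] by simp
qed

lemma squarefree_part_mult_square:
  fixes q b :: nat
  assumes q: "squarefree q" and b: "b > 0"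
  shows "squarefree_part (q * b ^ 2) = q"
proof (rule multiplicity_eq_nat)
  have q0: "q > 0" using q by (metis Squarefree.not_squarefree_0 neq0_conv)
  show "squarefree_part (q * b ^ 2) > 0" by (rule gr0I) simp
  show "q > 0" by (rule q0)
  fix p :: nat assume p: "prime p"
  have "multiplicity p q \<le> 1"
    using q q0 p by (auto simp: squarefree_factorial_semiring'')
  moreover have "multiplicity p (q * b ^ 2) = multiplicity p q + 2 * multiplicity p b"
    using p q0 b by (simp add: prime_elem_multiplicity_mult_distrib prime_elem_multiplicity_power_distrib)
  ultimately show "multiplicity p (squarefree_part (q * b ^ 2)) = multiplicity p q"
    using p by (simp add: prime_multiplicity_squarefree_part)
qed

context random_completely_multiplicative
begin

section \<open>Values, measurability and correlations of the random signs\<close>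

lemma f_values:
  assumes "n > 0" "\<omega> \<in> space M"
  shows "f n \<omega> \<in> {1, -1}"
  using assms(1)
proof (induction n rule: less_induct)
  case (less n)
  show ?case
  proof (cases "n = 1")
    case True
    then show ?thesis using f_one[OF assms(2)] by simp
  next
    case False
    then obtain p where p: "prime p" "p dvd n" using prime_factor_nat by blast
    then obtain k where k: "n = p * k" by (auto elim: dvdE)
    have k0: "k > 0" "p > 0" using k less.prems by auto
    then have "k < n" using k prime_gt_1_nat[OF p(1)] by simp
    then show ?thesis
      using less.IH[of k] k0 prime_values[OF p(1) assms(2)] f_mult[OF k0(2,1) assms(2)] k by auto
  qed
qed

lemma abs_f: "n > 0 \<Longrightarrow> \<omega> \<in> space M \<Longrightarrow> \<bar>f n \<omega>\<bar> = 1"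
  using f_values[of n \<omega>] by auto

lemma f_square: "n > 0 \<Longrightarrow> \<omega> \<in> space M \<Longrightarrow> f n \<omega> * f n \<omega> = 1"
  using f_values[of n \<omega>] by auto

lemma f_prime_measurable: "prime p \<Longrightarrow> f p \<in> borel_measurable M"
  using indep_primes unfolding indep_vars_def by auto

lemma f_measurable:
  assumes "n > 0"
  shows "f n \<in> borel_measurable M"
  using assms
proof (induction n rule: less_induct)
  case (less n)
  show ?case
  proof (cases "n = 1")
    case True
    have "f 1 \<in> borel_measurable M \<longleftrightarrow> (\<lambda>_. 1 :: real) \<in> borel_measurable M"
      by (rule measurable_cong) (use f_one in simp)
    then show ?thesis using True by simp
  next
    case False
    then obtain p where p: "prime p" "p dvd n" using prime_factor_nat by blast
    then obtain k where k: "n = p * k" by (auto elim: dvdE)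
    have k0: "k > 0" "p > 0" using k less.prems by auto
    then have "k < n" using k prime_gt_1_nat[OF p(1)] by simp
    then have "(\<lambda>\<omega>. f p \<omega> * f k \<omega>) \<in> borel_measurable M"
      using less.IH[of k] k0 f_prime_measurable[OF p(1)] by simp
    then show ?thesis
      using k k0 f_mult by (subst measurable_cong[of M _ "\<lambda>\<omega>. f p \<omega> * f k \<omega>"]) auto
  qed
qed

lemma f_prod:
  assumes "finite Q" "\<And>p. p \<in> Q \<Longrightarrow> prime p" "\<omega> \<in> space M"
  shows "f (\<Prod>Q) \<omega> = (\<Prod>p\<in>Q. f p \<omega>)"
  using assms(1,2)
proof (induction Q rule: finite_induct)
  case empty
  then show ?case using f_one[OF assms(3)] by simp
next
  case (insert p Q)
  have "p > 0" "\<Prod>Q > 0"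
    using insert by (auto simp: prime_gt_0_nat intro!: prod_pos)
  then show ?case
    using insert f_mult[OF _ _ assms(3), of p "\<Prod>Q"] by simp
qed

lemma integrable_of_f_prime:
  assumes "prime p" "g \<in> borel_measurable borel"
  shows "integrable M (\<lambda>\<omega>. g (f p \<omega>) :: real)"
proof (rule integrable_const_bound[of _ "\<bar>g 1\<bar> + \<bar>g (- 1)\<bar>"])
  show "AE \<omega> in M. norm (g (f p \<omega>)) \<le> \<bar>g 1\<bar> + \<bar>g (- 1)\<bar>"
    using prime_values[OF assms(1)] by (intro AE_I2) force
  show "(\<lambda>\<omega>. g (f p \<omega>)) \<in> borel_measurable M"
    using f_prime_measurable[OF assms(1)] assms(2) by (rule measurable_compose)
qed

lemma expectation_prod_primes:
  fixes g :: "nat \<Rightarrow> real \<Rightarrow> real"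
  assumes "finite Q" "\<And>p. p \<in> Q \<Longrightarrow> prime p" "\<And>p. p \<in> Q \<Longrightarrow> g p \<in> borel_measurable borel"
  shows "expectation (\<lambda>\<omega>. \<Prod>p\<in>Q. g p (f p \<omega>)) = (\<Prod>p\<in>Q. expectation (\<lambda>\<omega>. g p (f p \<omega>)))"
proof (rule indep_vars_lebesgue_integral[OF assms(1)])
  have "indep_vars (\<lambda>_. borel) f Q"
    by (rule indep_vars_subset[OF indep_primes]) (use assms(2) in auto)
  then show "indep_vars (\<lambda>_. borel) (\<lambda>p \<omega>. g p (f p \<omega>)) Q"
    by (rule indep_vars_compose2) (use assms(3) in auto)
  show "integrable M (\<lambda>\<omega>. g p (f p \<omega>))" if "p \<in> Q" for p
    using integrable_of_f_prime assms that by blast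
qed

lemma expectation_f_prime:
  assumes p: "prime p"
  shows "expectation (f p) = 0"
proof -
  have m[measurable]: "f p \<in> borel_measurable M" by (rule f_prime_measurable[OF p])
  have s: "{\<omega> \<in> space M. f p \<omega> = 1} \<in> sets M" "{\<omega> \<in> space M. f p \<omega> = -1} \<in> sets M"
    by measurable
  have "expectation (f p) = expectation (\<lambda>\<omega>. indicator {\<omega> \<in> space M. f p \<omega> = 1} \<omega> - indicator {\<omega> \<in> space M. f p \<omega> = -1} \<omega>)"
    using prime_values[OF p] by (intro Bochner_Integration.integral_cong) (auto simp: indicator_def)
  also have "\<dots> = prob {\<omega> \<in> space M. f p \<omega> = 1} - prob {\<omega> \<in> space M. f p \<omega> = -1}"
    using s by (subst Bochner_Integration.integral_diff) (auto simp: Int_absorb1 less_top[symmetric])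
  also have "\<dots> = 0" using prob_plus[OF p] prob_minus[OF p] by simp
  finally show ?thesis .
qed

lemma f_eq_f_squarefree_part:
  assumes "n > 0" "\<omega> \<in> space M"
  shows "f n \<omega> = (\<Prod>p\<in>prime_factors (squarefree_part n). f p \<omega>)"
proof -
  let ?q = "squarefree_part n" and ?s = "square_part n"
  have pos: "?q > 0" "?s > 0" using assms(1) by (auto intro: gr0I)
  have "f n \<omega> = f (?q * (?s * ?s)) \<omega>"
    using squarefree_decompose[of n] by (simp add: power2_eq_square)
  also have "\<dots> = f ?q \<omega> * (f ?s \<omega> * f ?s \<omega>)" using pos assms(2) by (simp add: f_mult)
  also have "\<dots> = f (\<Prod>(prime_factors ?q)) \<omega>"
    using f_square[OF pos(2) assms(2)] squarefree_eq_prod_prime_factors[of ?q] by simp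
  also have "\<dots> = (\<Prod>p\<in>prime_factors ?q. f p \<omega>)" by (intro f_prod assms(2)) auto
  finally show ?thesis .
qed

lemma integrable_f_mult:
  assumes "n > 0" "k > 0"
  shows "integrable M (\<lambda>\<omega>. f n \<omega> * f k \<omega>)"
proof (rule integrable_const_bound[of _ 1])
  show "AE \<omega> in M. norm (f n \<omega> * f k \<omega>) \<le> 1"
    using abs_f assms by (intro AE_I2) (simp add: abs_mult)
qed (use f_measurable assms in auto)

text \<open>Squares drop out of f. A prime dividing exactly one of the two squarefree parts yields
  an independent factor of mean zero; equal parts give a product identically 1.\<close>

lemma expectation_f_mult:
  assumes "n > 0" "k > 0"
  shows "expectation (\<lambda>\<omega>. f n \<omega> * f k \<omega>) = of_bool (squarefree_part n = squarefree_part k)"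
proof -
  define P Q where "P = prime_factors (squarefree_part n)" and "Q = prime_factors (squarefree_part k)"
  have fin: "finite P" "finite Q" and pr: "\<And>p. p \<in> P \<union> Q \<Longrightarrow> prime p"
    by (auto simp: P_def Q_def)
  define g where "g p x = (if p \<in> P then x else 1) * (if p \<in> Q then x else 1 :: real)" for p and x :: real
  have gm: "g p \<in> borel_measurable borel" for p unfolding g_def by (cases "p \<in> P"; cases "p \<in> Q") auto
  have "f n \<omega> * f k \<omega> = (\<Prod>p\<in>P \<union> Q. g p (f p \<omega>))" if "\<omega> \<in> space M" for \<omega>
  proof -
    have "(\<Prod>p\<in>P. f p \<omega>) = (\<Prod>p\<in>P \<union> Q. if p \<in> P then f p \<omega> else 1)"
         "(\<Prod>p\<in>Q. f p \<omega>) = (\<Prod>p\<in>P \<union> Q. if p \<in> Q then f p \<omega> else 1)"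
      using fin by (intro prod.mono_neutral_cong_left; auto)+
    then show ?thesis
      using f_eq_f_squarefree_part[OF assms(1) that] f_eq_f_squarefree_part[OF assms(2) that]
      by (simp add: P_def[symmetric] Q_def[symmetric] g_def prod.distrib)
  qed
  then have "expectation (\<lambda>\<omega>. f n \<omega> * f k \<omega>) = expectation (\<lambda>\<omega>. \<Prod>p\<in>P \<union> Q. g p (f p \<omega>))"
    by (intro Bochner_Integration.integral_cong) auto
  also have "\<dots> = (\<Prod>p\<in>P \<union> Q. expectation (\<lambda>\<omega>. g p (f p \<omega>)))"
    using fin pr gm by (intro expectation_prod_primes) auto
  also have "\<dots> = of_bool (P = Q)"
  proof (cases "P = Q")
    case True
    have "expectation (\<lambda>\<omega>. g p (f p \<omega>)) = 1" if "p \<in> P \<union> Q" for p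
    proof -
      have "expectation (\<lambda>\<omega>. g p (f p \<omega>)) = expectation (\<lambda>_. 1)"
        using that True f_square[of p] pr[OF that]
        by (intro Bochner_Integration.integral_cong) (auto simp: g_def prime_gt_0_nat)
      then show ?thesis by (simp add: prob_space)
    qed
    then show ?thesis using True by simp
  next
    case False
    then obtain p where p: "p \<in> P \<union> Q" "p \<notin> P \<or> p \<notin> Q" by blast
    then have "(\<lambda>\<omega>. g p (f p \<omega>)) = f p" by (auto simp: g_def)
    then have "expectation (\<lambda>\<omega>. g p (f p \<omega>)) = 0" using expectation_f_prime[OF pr[OF p(1)]] by simp
    then have "(\<Prod>p\<in>P \<union> Q. expectation (\<lambda>\<omega>. g p (f p \<omega>))) = 0"
      using p(1) fin by (intro prod_zero) auto
    then show ?thesis using False by simp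
  qed
  also have "P = Q \<longleftrightarrow> squarefree_part n = squarefree_part k"
    unfolding P_def Q_def
    by (metis squarefree_eq_prod_prime_factors squarefree_squarefree_part)
  finally show ?thesis .
qed

definition partial_sum :: "nat set \<Rightarrow> nat \<Rightarrow> 'w \<Rightarrow> real" where
  "partial_sum A N \<omega> = (\<Sum>n | n \<in> A \<and> 1 \<le> n \<and> n < N. f n \<omega> / real n)"

lemma finite_range_below: "finite {n::nat. n \<in> A \<and> 1 \<le> n \<and> n < N}"
  by (rule finite_subset[of _ "{..<N}"]) auto

lemma partial_sum_measurable: "partial_sum A N \<in> borel_measurable M"
  unfolding partial_sum_def using f_measurable by (intro borel_measurable_sum borel_measurable_divide) auto

text \<open>For integers n, n < x means n < \<lceil>x\<rceil>, so integer cutoffs cover real x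
  exactly.\<close>

lemma prob_negative_eq:
  "prob_negative M f A x = prob {\<omega> \<in> space M. partial_sum A (nat \<lceil>x\<rceil>) \<omega> < 0}"
proof -
  have "real n < x \<longleftrightarrow> n < nat \<lceil>x\<rceil>" for n
    by (simp add: zless_nat_eq_int_zless less_ceiling_iff)
  then show ?thesis by (simp add: prob_negative_def partial_sum_def)
qed

text \<open>Only pairs n = q s^2, k = q r^2 with the same squarefree q correlate. The triple (q, s,
  r) determines the pair and 1/(n k) = (q s r)^(-2), so the moment is at most zeta(2)^3 < 8,
  whatever A and N are.\<close>

lemma partial_sum_second_moment:
  "integrable M (\<lambda>\<omega>. partial_sum A N \<omega> ^ 2)" (is ?int)
  "expectation (\<lambda>\<omega>. partial_sum A N \<omega> ^ 2) \<le> 8" (is ?le)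
proof -
  define I where "I = {n. n \<in> A \<and> 1 \<le> n \<and> n < N}"
  have finI: "finite I" unfolding I_def by (rule finite_range_below)
  have sq: "partial_sum A N \<omega> ^ 2 = (\<Sum>(n, k)\<in>I \<times> I. f n \<omega> * f k \<omega> * (1 / (real n * real k)))" for \<omega>
    unfolding partial_sum_def I_def[symmetric] power2_eq_square sum_product sum.cartesian_product
    by (intro sum.cong) auto
  have int: "integrable M (\<lambda>\<omega>. case z of (n, k) \<Rightarrow> f n \<omega> * f k \<omega> * (1 / (real n * real k)))" if "z \<in> I \<times> I" for z
    using that integrable_f_mult by (auto simp: I_def intro!: integrable_mult_left)
  show ?int unfolding sq by (intro Bochner_Integration.integrable_sum int)
  have "expectation (\<lambda>\<omega>. partial_sum A N \<omega> ^ 2) =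
     (\<Sum>z\<in>I \<times> I. expectation (\<lambda>\<omega>. case z of (n, k) \<Rightarrow> f n \<omega> * f k \<omega> * (1 / (real n * real k))))"
    unfolding sq by (intro Bochner_Integration.integral_sum int)
  also have "\<dots> = (\<Sum>z\<in>I \<times> I. case z of (n, k) \<Rightarrow> of_bool (squarefree_part n = squarefree_part k) * (1 / (real n * real k)))"
    by (intro sum.cong refl) (auto simp: I_def expectation_f_mult)
  also have "\<dots> = (\<Sum>z\<in>{z\<in>I \<times> I. squarefree_part (fst z) = squarefree_part (snd z)}. 1 / (real (fst z) * real (snd z)))"
    using finI by (intro sum.mono_neutral_cong_right) auto
  also have "\<dots> = (\<Sum>z\<in>{z\<in>I \<times> I. squarefree_part (fst z) = squarefree_part (snd z)}.
      (\<lambda>(q, s, r). real q powr - 2 * (real s powr - 2 * real r powr - 2))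
         (squarefree_part (fst z), square_part (fst z), square_part (snd z)))"
  proof (rule sum.cong[OF refl])
    fix z assume z: "z \<in> {z\<in>I \<times> I. squarefree_part (fst z) = squarefree_part (snd z)}"
    obtain n k where nk: "z = (n, k)" by force
    define q s r where "q = squarefree_part n" and "s = square_part n" and "r = square_part k"
    have "n = q * s ^ 2" "k = q * r ^ 2"
      using squarefree_decompose[of n] squarefree_decompose[of k] z by (simp_all add: q_def s_def r_def nk)
    then have "1 / (real n * real k) = real q powr - 2 * (real s powr - 2 * real r powr - 2)"
      by (simp add: powr_minus_divide power2_eq_square)
    then show "1 / (real (fst z) * real (snd z)) =
        (\<lambda>(q, s, r). real q powr - 2 * (real s powr - 2 * real r powr - 2))
         (squarefree_part (fst z), square_part (fst z), square_part (snd z))"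
      unfolding nk fst_conv snd_conv prod.case q_def s_def r_def .
  qed
  also have "\<dots> = (\<Sum>z\<in>(\<lambda>z. (squarefree_part (fst z), square_part (fst z), square_part (snd z))) `
      {z\<in>I \<times> I. squarefree_part (fst z) = squarefree_part (snd z)}.
      (\<lambda>(q, s, r). real q powr - 2 * (real s powr - 2 * real r powr - 2)) z)"
  proof (subst sum.reindex)
    show "inj_on (\<lambda>z. (squarefree_part (fst z), square_part (fst z), square_part (snd z)))
        {z\<in>I \<times> I. squarefree_part (fst z) = squarefree_part (snd z)}"
      by (rule inj_onI) (auto intro!: prod_eqI intro: squarefree_decomposition_unique)
  qed simp
  also have "\<dots> \<le> (\<Sum>z\<in>{..<N} \<times> ({..<N} \<times> {..<N}). (\<lambda>(q, s, r). real q powr - 2 * (real s powr - 2 * real r powr - 2)) z)"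
  proof (rule sum_mono2)
    have "squarefree_part n < N \<and> square_part n < N" if n: "n \<in> I" for n
    proof -
      have n0: "n > 0" "n < N" using n by (auto simp: I_def)
      have "squarefree_part n dvd n"
        by (subst (2) squarefree_decompose) (rule dvd_triv_left)
      moreover have "square_part n dvd n"
        by (rule dvd_trans[OF _ square_part_square_dvd]) (simp add: power2_eq_square)
      ultimately show ?thesis using n0 by (meson dvd_imp_le le_less_trans)
    qed
    then show "(\<lambda>z. (squarefree_part (fst z), square_part (fst z), square_part (snd z))) `
      {z\<in>I \<times> I. squarefree_part (fst z) = squarefree_part (snd z)} \<subseteq> {..<N} \<times> ({..<N} \<times> {..<N})"
      by auto
  qed auto
  also have "\<dots> = (\<Sum>q<N. real q powr - 2) * ((\<Sum>s<N. real s powr - 2) * (\<Sum>r<N. real r powr - 2))"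
    by (simp add: sum_product sum.cartesian_product case_prod_unfold mult.assoc) 
  also have "\<dots> \<le> 2 * (2 * 2)"
  proof -
    have "(\<Sum>q<N. real q powr - 2) \<le> zeta 2" by (intro sum_le_suminf summable_zeta) auto
    then have "(\<Sum>q<N. real q powr - 2) \<le> 2" using zeta_2_less_2 by linarith
    then show ?thesis by (intro mult_mono) (auto intro!: sum_nonneg)
  qed
  finally show ?le by simp
qed

end

section \<open>The residue class set expressed through characters\<close>

lemma residue_class_set_iff:
  assumes m: "m > 0" and S: "S \<subseteq> totatives m" and n: "n > 0"
  shows "n \<in> residue_class_set m S \<longleftrightarrow> (\<exists>a\<in>S. [a = n] (mod m))"
proof
  assume "n \<in> residue_class_set m S"
  then show "\<exists>a\<in>S. [a = n] (mod m)"
    by (auto simp: residue_class_set_def cong_def)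
next
  assume "\<exists>a\<in>S. [a = n] (mod m)"
  then obtain a where a: "a \<in> S" "[a = n] (mod m)" by blast
  have am: "0 < a" "a \<le> m" using a(1) S by (auto simp: totatives_def)
  have "a \<le> n"
  proof (rule ccontr)
    assume "\<not> a \<le> n"
    then have "n < m" using am by simp
    then have "a mod m = n" using a(2) by (simp add: cong_def)
    \<comment> \<open>The representative m stands for residue 0, hence the separate case: there
      \<open>a mod m = 0\<close> contradicts \<open>n > 0\<close>, otherwise
      \<open>a mod m = a\<close>.\<close>
    then show False using \<open>\<not> a \<le> n\<close> n am by (cases "a = m") auto
  qed
  then obtain k where "n = a + m * k"
    using a(2) cong_le_nat[of a n m] by (auto simp: cong_sym_eq mult.commute add.commute)
  then show "n \<in> residue_class_set m S" using a(1) by (auto simp: residue_class_set_def)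
qed

text \<open>Orthogonality produces \<open>card (characters m)\<close>, while
  \<open>char_coeff\<close> is normalised by \<open>totient m\<close>. Their ratio is carried along
  as a positive constant, which affects no sign.\<close>

lemma residue_class_set_character_expansion:
  assumes m: "m > 0" and S: "S \<subseteq> totatives m" and n: "n > 0"
  shows "(\<Sum>\<psi>\<in>characters m. char_coeff m S \<psi> * \<psi> n) =
    of_real (real (card (characters m)) / real (totient m)) * of_bool (n \<in> residue_class_set m S)"
proof -
  let ?N = "complex_of_nat (card (characters m))"
  have finS: "finite S" using S finite_subset by (metis finite_totatives)
  have "(\<Sum>\<psi>\<in>characters m. char_coeff m S \<psi> * \<psi> n) =
     (\<Sum>\<psi>\<in>characters m. \<Sum>a\<in>S. cnj (\<psi> a) * \<psi> n) / of_nat (totient m)"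
    by (simp add: char_coeff_def sum_distrib_right sum_divide_distrib)
  also have "(\<Sum>\<psi>\<in>characters m. \<Sum>a\<in>S. cnj (\<psi> a) * \<psi> n) = (\<Sum>a\<in>S. \<Sum>\<psi>\<in>characters m. cnj (\<psi> a) * \<psi> n)"
    by (rule sum.swap)
  also have "\<dots> = (\<Sum>a\<in>S. if [a = n] (mod m) then ?N else 0)"
    using S by (intro sum.cong refl sum_characters_cnj[OF m]) (auto simp: totatives_def)
  also have "\<dots> = ?N * of_bool (n \<in> residue_class_set m S)"
  proof (cases "\<exists>a\<in>S. [a = n] (mod m)")
    case True
    then obtain a where a: "a \<in> S" "[a = n] (mod m)" by blast
    have "b = a" if "b \<in> S" "[b = n] (mod m)" for b
    proof -
      have r: "0 < b" "b \<le> m" "0 < a" "a \<le> m" using that(1) a(1) S by (auto simp: totatives_def)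
      have "b mod m = a mod m" using that(2) a(2) by (simp add: cong_def)
      then show ?thesis using r by (cases "b = m"; cases "a = m") auto
    qed
    then have "[b = n] (mod m) \<longleftrightarrow> b = a" if "b \<in> S" for b
      using that a(2) by blast
    then have "(\<Sum>b\<in>S. if [b = n] (mod m) then ?N else 0) = (\<Sum>b\<in>S. if b = a then ?N else 0)"
      by (intro sum.cong refl) simp
    also have "\<dots> = ?N" using a(1) finS by simp
    finally show ?thesis using residue_class_set_iff[OF assms, THEN iffD2, OF True] by simp
  next
    case False
    then have "(\<Sum>b\<in>S. if [b = n] (mod m) then ?N else 0) = 0"
      by (intro sum.neutral ballI) (meson if_not_P)
    moreover have "n \<notin> residue_class_set m S"
      using False residue_class_set_iff[OF assms] by blast
    ultimately show ?thesis by simp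
  qed
  finally show ?thesis by simp
qed

text \<open>The integers with squarefree part q are exactly the q b^2, so the \<psi>-component of
  the sum is (\<psi>(q)/q) \<Sum> \<psi>(b)^2 / b^2. This is where L(2, \<psi>^2) enters.\<close>

lemma finite_sum_squarefree_class_tendsto:
  assumes m: "m > 0" and S: "S \<subseteq> totatives m" and q: "squarefree q"
  shows "(\<lambda>N. \<Sum>n | n \<in> residue_class_set m S \<and> 1 \<le> n \<and> n < N. of_bool (squarefree_part n = q) / real n)
    \<longlonglongrightarrow> real (totient m) / real (card (characters m)) *
      Re (\<Sum>\<psi>\<in>characters m. char_coeff m S \<psi> * (\<psi> q / of_nat q * L_series (\<lambda>n. \<psi> n * \<psi> n) 2))"
    (is "_ \<longlonglongrightarrow> ?X")
proof -
  let ?A = "residue_class_set m S" and ?N = "real (card (characters m))" and ?\<phi> = "real (totient m)"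
  have pos: "?N > 0" "?\<phi> > 0" using card_characters_pos[OF m] m by simp_all
  have q0: "q > 0" using q by (metis Squarefree.not_squarefree_0 neq0_conv)
  have "((\<lambda>b. \<Sum>\<psi>\<in>characters m. char_coeff m S \<psi> * (\<psi> q / of_nat q * (\<psi> b * \<psi> b * of_real (real b powr - 2)))) has_sum
     (\<Sum>\<psi>\<in>characters m. char_coeff m S \<psi> * (\<psi> q / of_nat q * L_series (\<lambda>n. \<psi> n * \<psi> n) 2))) {0<..}"
  proof (intro has_sum_finite_sum finite_characters[OF m] has_sum_cmult_right)
    fix \<psi> assume "\<psi> \<in> characters m"
    then have "dirichlet_character m (\<lambda>n. \<psi> n * \<psi> n)" by (auto intro: dirichlet_character_times)
    then show "((\<lambda>b. \<psi> b * \<psi> b * of_real (real b powr - 2)) has_sum L_series (\<lambda>n. \<psi> n * \<psi> n) 2) {0<..}"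
      unfolding L_series_def
      by (intro has_sum_greaterThan_0 character_euler_product(2)[OF m]) auto
  qed
  from has_sum_cmult_right[OF has_sum_Re[OF this], of "?\<phi> / ?N"]
  have "((\<lambda>b. ?\<phi> / ?N * Re (\<Sum>\<psi>\<in>characters m. char_coeff m S \<psi> * (\<psi> q / of_nat q * (\<psi> b * \<psi> b * of_real (real b powr - 2))))) has_sum ?X) {0<..}" .
  moreover have "?\<phi> / ?N * Re (\<Sum>\<psi>\<in>characters m. char_coeff m S \<psi> * (\<psi> q / of_nat q * (\<psi> b * \<psi> b * of_real (real b powr - 2))))
      = of_bool (q * b ^ 2 \<in> ?A) / real (q * b ^ 2)" if b: "b \<in> {0<..}" for b
  proof -
    have "char_coeff m S \<psi> * (\<psi> q / of_nat q * (\<psi> b * \<psi> b * of_real (real b powr - 2))) =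
       char_coeff m S \<psi> * \<psi> (q * b ^ 2) * of_real (1 / real (q * b ^ 2))" if "\<psi> \<in> characters m" for \<psi>
      using that by (simp add: dirichlet_character_mult dirichlet_character_power powr_minus_divide power2_eq_square)
    then have "(\<Sum>\<psi>\<in>characters m. char_coeff m S \<psi> * (\<psi> q / of_nat q * (\<psi> b * \<psi> b * of_real (real b powr - 2)))) =
       (\<Sum>\<psi>\<in>characters m. char_coeff m S \<psi> * \<psi> (q * b ^ 2)) * of_real (1 / real (q * b ^ 2))"
      unfolding sum_distrib_right by (intro sum.cong) auto
    also have "\<dots> = of_real (?N / ?\<phi> * (of_bool (q * b ^ 2 \<in> ?A) / real (q * b ^ 2)))"
      using residue_class_set_character_expansion[OF m S, of "q * b ^ 2"] q0 b by simp
    finally show ?thesis using pos by (simp only: Re_complex_of_real) simp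
  qed
  ultimately have "((\<lambda>b. of_bool (q * b ^ 2 \<in> ?A) / real (q * b ^ 2)) has_sum ?X) {0<..}"
    by (rule has_sum_cong[THEN iffD1, rotated])
  moreover have inj: "inj_on (\<lambda>b. q * b ^ 2) {0<..}"
    using q0 by (auto simp: inj_on_def)
  ultimately have "((\<lambda>n. of_bool (n \<in> ?A) / real n) has_sum ?X) ((\<lambda>b. q * b ^ 2) ` {0<..})"
    by (simp add: has_sum_reindex o_def)
  moreover have "(\<lambda>b. q * b ^ 2) ` {0<..} = {n. n > 0 \<and> squarefree_part n = q}"
  proof (intro equalityI subsetI)
    fix n assume "n \<in> {n. n > 0 \<and> squarefree_part n = q}"
    then have n: "n > 0" "n = q * square_part n ^ 2" using squarefree_decompose[of n] by auto
    moreover have "square_part n > 0" using n(1) by (auto intro: gr0I)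
    ultimately show "n \<in> (\<lambda>b. q * b ^ 2) ` {0<..}" by auto
  qed (use q0 squarefree_part_mult_square[OF q] in auto)
  ultimately have "((\<lambda>n. of_bool (n \<in> ?A) / real n) has_sum ?X) {n. n > 0 \<and> squarefree_part n = q}" by simp
  then have "((\<lambda>n. if n \<in> ?A \<and> 1 \<le> n then of_bool (squarefree_part n = q) / real n else 0) has_sum ?X) UNIV"
    by (rule has_sum_cong_neutral[THEN iffD1, rotated -1]) auto
  then have "(\<lambda>n. if n \<in> ?A \<and> 1 \<le> n then of_bool (squarefree_part n = q) / real n else 0) sums ?X"
    by (rule has_sum_imp_sums)
  moreover have "(\<Sum>n<N. if n \<in> ?A \<and> 1 \<le> n then of_bool (squarefree_part n = q) / real n else 0) =
     (\<Sum>n | n \<in> ?A \<and> 1 \<le> n \<and> n < N. of_bool (squarefree_part n = q) / real n)" for N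
    by (intro sum.mono_neutral_cong_right) auto
  ultimately show ?thesis by (simp add: sums_def)
qed

lemma squarefree_prod_primes:
  fixes Q :: "nat set"
  assumes "\<And>p. p \<in> Q \<Longrightarrow> prime p"
  shows "squarefree (\<Prod>Q)"
  using assms by (intro squarefree_prod_coprime primes_coprime squarefree_prime) auto

context random_completely_multiplicative
begin

text \<open>Expanding the weight over the subsets Q of F gives terms t(Q) f(\<Prod>Q) with \<Prod>Q
  squarefree, and expectation selects the n with that squarefree part. In the limit the sum over Q
  folds back into a product over F for each character.\<close>

lemma tilted_expectation_tendsto:
  fixes t :: "nat \<Rightarrow> real"
  assumes m: "m > 0" and S: "S \<subseteq> totatives m" and F: "finite F" "\<And>p. p \<in> F \<Longrightarrow> prime p"
  shows "(\<lambda>N. expectation (\<lambda>\<omega>. partial_sum (residue_class_set m S) N \<omega> * (\<Prod>p\<in>F. 1 + t p * f p \<omega>)))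
     \<longlonglongrightarrow> real (totient m) / real (card (characters m)) *
       Re (\<Sum>\<psi>\<in>characters m. char_coeff m S \<psi> * L_series (\<lambda>n. \<psi> n * \<psi> n) 2 *
          (\<Prod>p\<in>F. 1 + of_real (t p) * \<psi> p / of_nat p))"
proof -
  let ?A = "residue_class_set m S" and ?r = "real (totient m) / real (card (characters m))"
  define I where "I N = {n. n \<in> ?A \<and> 1 \<le> n \<and> n < N}" for N
  have finI: "finite (I N)" for N unfolding I_def by (rule finite_range_below)
  have Q: "finite Q" "\<And>p. p \<in> Q \<Longrightarrow> prime p" if "Q \<in> Pow F" for Q
    using that F finite_subset by auto
  have Qpos: "\<Prod>Q > 0" if "Q \<in> Pow F" for Q
    using Q[OF that] by (intro prod_pos) (auto simp: prime_gt_0_nat)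
  have Qsf: "squarefree (\<Prod>Q)" if "Q \<in> Pow F" for Q
    by (rule squarefree_prod_primes) (rule Q(2)[OF that])
  have expand: "partial_sum ?A N \<omega> * (\<Prod>p\<in>F. 1 + t p * f p \<omega>) =
     (\<Sum>Q\<in>Pow F. \<Sum>n\<in>I N. prod t Q / real n * (f n \<omega> * f (\<Prod>Q) \<omega>))" if \<omega>: "\<omega> \<in> space M" for \<omega> N
  proof -
    have "(\<Prod>p\<in>F. 1 + t p * f p \<omega>) = (\<Sum>Q\<in>Pow F. \<Prod>p\<in>Q. t p * f p \<omega>)"
      using prod_add[OF F(1), of "\<lambda>p. t p * f p \<omega>" "\<lambda>_. 1"] by (simp add: add.commute)
    also have "\<dots> = (\<Sum>Q\<in>Pow F. prod t Q * f (\<Prod>Q) \<omega>)"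
      using Q by (intro sum.cong refl) (simp add: prod.distrib f_prod \<omega>)
    finally show ?thesis
      unfolding partial_sum_def I_def[symmetric]
      by (simp add: sum_product mult_ac) (rule sum.swap)
  qed
  have int: "integrable M (\<lambda>\<omega>. prod t Q / real n * (f n \<omega> * f (\<Prod>Q) \<omega>))" if "Q \<in> Pow F" "n \<in> I N" for Q n N
    using that Qpos[OF that(1)] by (intro integrable_mult_right integrable_f_mult) (auto simp: I_def)
  have e: "expectation (\<lambda>\<omega>. partial_sum ?A N \<omega> * (\<Prod>p\<in>F. 1 + t p * f p \<omega>)) =
     (\<Sum>Q\<in>Pow F. prod t Q * (\<Sum>n\<in>I N. of_bool (squarefree_part n = \<Prod>Q) / real n))" for N
  proof -
    have "expectation (\<lambda>\<omega>. partial_sum ?A N \<omega> * (\<Prod>p\<in>F. 1 + t p * f p \<omega>)) =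
      expectation (\<lambda>\<omega>. \<Sum>Q\<in>Pow F. \<Sum>n\<in>I N. prod t Q / real n * (f n \<omega> * f (\<Prod>Q) \<omega>))"
      by (intro Bochner_Integration.integral_cong refl expand)
    also have "\<dots> = (\<Sum>Q\<in>Pow F. \<Sum>n\<in>I N. expectation (\<lambda>\<omega>. prod t Q / real n * (f n \<omega> * f (\<Prod>Q) \<omega>)))"
      using int by (subst Bochner_Integration.integral_sum)
        (auto intro!: Bochner_Integration.integrable_sum sum.cong Bochner_Integration.integral_sum)
    also have "\<dots> = (\<Sum>Q\<in>Pow F. \<Sum>n\<in>I N. prod t Q / real n * of_bool (squarefree_part n = \<Prod>Q))"
    proof (intro sum.cong refl)
      fix Q n assume Qn: "Q \<in> Pow F" "n \<in> I N"
      have "squarefree_part (\<Prod>Q) = \<Prod>Q"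
        using squarefree_part_mult_square[OF Qsf[OF Qn(1)], of 1] by simp
      then show "expectation (\<lambda>\<omega>. prod t Q / real n * (f n \<omega> * f (\<Prod>Q) \<omega>)) = prod t Q / real n * of_bool (squarefree_part n = \<Prod>Q)"
        using expectation_f_mult[of n "\<Prod>Q"] Qpos[OF Qn(1)] Qn(2) by (simp add: I_def)
    qed
    finally show ?thesis by (simp add: sum_distrib_left)
  qed
  define c where "c \<psi> = char_coeff m S \<psi> * L_series (\<lambda>n. \<psi> n * \<psi> n) 2" for \<psi>
  have "(\<lambda>N. \<Sum>Q\<in>Pow F. prod t Q * (\<Sum>n\<in>I N. of_bool (squarefree_part n = \<Prod>Q) / real n)) \<longlonglongrightarrow>
     (\<Sum>Q\<in>Pow F. prod t Q * (?r * Re (\<Sum>\<psi>\<in>characters m. char_coeff m S \<psi> * (\<psi> (\<Prod>Q) / of_nat (\<Prod>Q) * L_series (\<lambda>n. \<psi> n * \<psi> n) 2))))"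
    unfolding I_def using Qsf
    by (intro tendsto_sum tendsto_mult tendsto_const finite_sum_squarefree_class_tendsto[OF m S])
  also have "(\<Sum>Q\<in>Pow F. prod t Q * (?r * Re (\<Sum>\<psi>\<in>characters m. char_coeff m S \<psi> * (\<psi> (\<Prod>Q) / of_nat (\<Prod>Q) * L_series (\<lambda>n. \<psi> n * \<psi> n) 2))))
     = ?r * Re (\<Sum>Q\<in>Pow F. \<Sum>\<psi>\<in>characters m. c \<psi> * (of_real (prod t Q) * (\<psi> (\<Prod>Q) / of_nat (\<Prod>Q))))"
  proof -
    have "prod t Q * (?r * Re (\<Sum>\<psi>\<in>characters m. char_coeff m S \<psi> * (\<psi> (\<Prod>Q) / of_nat (\<Prod>Q) * L_series (\<lambda>n. \<psi> n * \<psi> n) 2)))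
      = ?r * Re (\<Sum>\<psi>\<in>characters m. c \<psi> * (of_real (prod t Q) * (\<psi> (\<Prod>Q) / of_nat (\<Prod>Q))))" for Q
    proof -
      have "(\<Sum>\<psi>\<in>characters m. c \<psi> * (of_real (prod t Q) * (\<psi> (\<Prod>Q) / of_nat (\<Prod>Q)))) =
        of_real (prod t Q) * (\<Sum>\<psi>\<in>characters m. char_coeff m S \<psi> * (\<psi> (\<Prod>Q) / of_nat (\<Prod>Q) * L_series (\<lambda>n. \<psi> n * \<psi> n) 2))"
        unfolding sum_distrib_left by (intro sum.cong refl) (simp add: c_def mult_ac)
      moreover have "Re (of_real x * z) = x * Re z" for x z by simp
      ultimately show ?thesis by (simp only: mult.left_commute)
    qed
    then show ?thesis by (simp only: sum_distrib_left Re_sum)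
  qed
  also have "(\<Sum>Q\<in>Pow F. \<Sum>\<psi>\<in>characters m. c \<psi> * (of_real (prod t Q) * (\<psi> (\<Prod>Q) / of_nat (\<Prod>Q)))) =
     (\<Sum>\<psi>\<in>characters m. c \<psi> * (\<Prod>p\<in>F. 1 + of_real (t p) * \<psi> p / of_nat p))"
  proof (subst sum.swap, rule sum.cong[OF refl])
    fix \<psi> assume "\<psi> \<in> characters m"
    then have \<psi>: "dirichlet_character m \<psi>" by simp
    have mult: "\<psi> (\<Prod>Q) = (\<Prod>p\<in>Q. \<psi> p)" for Q :: "nat set"
      by (induction Q rule: infinite_finite_induct)
         (simp_all add: dirichlet_character_one[OF \<psi>] dirichlet_character_mult[OF \<psi>])
    have "(\<Prod>p\<in>F. 1 + of_real (t p) * \<psi> p / of_nat p) = (\<Sum>Q\<in>Pow F. \<Prod>p\<in>Q. of_real (t p) * \<psi> p / of_nat p)"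
      using prod_add[OF F(1), of "\<lambda>p. of_real (t p) * \<psi> p / of_nat p" "\<lambda>_. 1"] by (simp add: add.commute)
    also have "\<dots> = (\<Sum>Q\<in>Pow F. of_real (prod t Q) * (\<psi> (\<Prod>Q) / of_nat (\<Prod>Q)))"
      by (simp add: mult prod.distrib prod_dividef)
    finally show "(\<Sum>Q\<in>Pow F. c \<psi> * (of_real (prod t Q) * (\<psi> (\<Prod>Q) / of_nat (\<Prod>Q)))) = c \<psi> * (\<Prod>p\<in>F. 1 + of_real (t p) * \<psi> p / of_nat p)"
      by (simp add: sum_distrib_left)
  qed
  finally show ?thesis unfolding e c_def .
qed

text \<open>Pointwise \<open>-T R \<le> K (\<kappa> T^2 + [T < 0] / (4 \<kappa>))\<close> for \<open>0 \<le> R \<le> K\<close>, by AM-GM.\<close>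

lemma prob_neg_lower_bound:
  assumes T: "T \<in> borel_measurable M" "integrable M (\<lambda>\<omega>. T \<omega> ^ 2)" "expectation (\<lambda>\<omega>. T \<omega> ^ 2) \<le> B"
    and R: "R \<in> borel_measurable M" "\<And>\<omega>. \<omega> \<in> space M \<Longrightarrow> 0 \<le> R \<omega>" "\<And>\<omega>. \<omega> \<in> space M \<Longrightarrow> R \<omega> \<le> K"
    and neg: "expectation (\<lambda>\<omega>. T \<omega> * R \<omega>) \<le> - \<eta>" and pos: "\<eta> > 0" "K > 0" "B > 0"
  shows "\<eta> ^ 2 / (K ^ 2 * B) \<le> prob {\<omega> \<in> space M. T \<omega> < 0}"
proof -
  \<comment> \<open>Chosen so that K \<kappa> B = \<eta>/2: the second moment uses up half of
    \<eta>, and the probability has to account for the other half.\<close>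
  define \<kappa> where "\<kappa> = \<eta> / (2 * K * B)"
  have \<kappa>: "\<kappa> > 0" using pos by (simp add: \<kappa>_def)
  define E where "E = {\<omega> \<in> space M. T \<omega> < 0}"
  have E: "E \<in> sets M" unfolding E_def using T(1) by measurable
  have amgm: "\<bar>t\<bar> \<le> \<kappa> * t ^ 2 + 1 / (4 * \<kappa>)" for t
  proof -
    have "0 \<le> (2 * \<kappa> * \<bar>t\<bar> - 1) ^ 2 / (4 * \<kappa>)" using \<kappa> by simp
    also have "\<dots> = \<kappa> * t ^ 2 + 1 / (4 * \<kappa>) - \<bar>t\<bar>"
      using \<kappa> by (simp add: power2_diff power_mult_distrib field_simps) (simp add: power2_eq_square)
    finally show ?thesis by simp
  qed
  have intE: "integrable M (\<lambda>\<omega>. indicator E \<omega> :: real)" using E by (simp add: less_top[symmetric])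
  have "integrable M (\<lambda>\<omega>. T \<omega> * R \<omega>)"
  proof (rule Bochner_Integration.integrable_bound)
    show "integrable M (\<lambda>\<omega>. K * (\<kappa> * T \<omega> ^ 2 + 1 / (4 * \<kappa>)))" using T(2) by simp
    show "AE \<omega> in M. norm (T \<omega> * R \<omega>) \<le> norm (K * (\<kappa> * T \<omega> ^ 2 + 1 / (4 * \<kappa>)))"
    proof (rule AE_I2)
      fix \<omega> assume \<omega>: "\<omega> \<in> space M"
      have "\<bar>T \<omega>\<bar> * \<bar>R \<omega>\<bar> \<le> (\<kappa> * T \<omega> ^ 2 + 1 / (4 * \<kappa>)) * K"
        using amgm[of "T \<omega>"] R(2,3)[OF \<omega>] \<kappa> by (intro mult_mono) auto
      then show "norm (T \<omega> * R \<omega>) \<le> norm (K * (\<kappa> * T \<omega> ^ 2 + 1 / (4 * \<kappa>)))"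
        using \<kappa> pos by (simp add: abs_mult mult.commute)
    qed
  qed (use T(1) R(1) in simp)
  then have "expectation (\<lambda>\<omega>. - (T \<omega> * R \<omega>)) \<le> expectation (\<lambda>\<omega>. K * (\<kappa> * T \<omega> ^ 2 + 1 / (4 * \<kappa>) * indicator E \<omega>))"
  proof (intro integral_mono)
    fix \<omega> assume \<omega>: "\<omega> \<in> space M"
    show "- (T \<omega> * R \<omega>) \<le> K * (\<kappa> * T \<omega> ^ 2 + 1 / (4 * \<kappa>) * indicator E \<omega>)"
    proof (cases "T \<omega> < 0")
      case True
      have "- T \<omega> * R \<omega> \<le> (\<kappa> * T \<omega> ^ 2 + 1 / (4 * \<kappa>)) * K"
        using amgm[of "T \<omega>"] R(2,3)[OF \<omega>] True \<kappa> by (intro mult_mono) auto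
      then show ?thesis using True \<omega> by (simp add: E_def mult.commute)
    next
      case False
      then have "- (T \<omega> * R \<omega>) \<le> 0" using R(2)[OF \<omega>] by simp
      also have "0 \<le> K * (\<kappa> * T \<omega> ^ 2 + 1 / (4 * \<kappa>) * indicator E \<omega>)" using \<kappa> pos by (intro mult_nonneg_nonneg add_nonneg_nonneg) auto
      finally show ?thesis .
    qed
  qed (use T(2) intE in auto)
  also have "\<dots> = K * (\<kappa> * expectation (\<lambda>\<omega>. T \<omega> ^ 2) + 1 / (4 * \<kappa>) * prob E)"
    using T(2) intE E by (simp add: E_def Int_absorb1)
  also have "\<dots> \<le> K * (\<kappa> * B + 1 / (4 * \<kappa>) * prob E)"
    using T(3) pos \<kappa> by (intro mult_left_mono add_mono) auto
  finally have "\<eta> \<le> K * (\<kappa> * B + 1 / (4 * \<kappa>) * prob E)" using neg by simp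
  also have "\<dots> = \<eta> / 2 + K ^ 2 * B / (2 * \<eta>) * prob E"
    using pos by (simp add: \<kappa>_def field_simps power2_eq_square)
  finally have "\<eta> \<le> \<eta> / 2 + K ^ 2 * B / (2 * \<eta>) * prob E" .
  then have "\<eta> / 2 \<le> K ^ 2 * B / (2 * \<eta>) * prob E" by argo
  then show ?thesis using pos unfolding E_def[symmetric]
    by (simp add: field_simps power2_eq_square)
qed

theorem prob_negative_bounded_below:
  assumes m: "m > 0" and S: "S \<subseteq> totatives m"
    and fails: "\<not> (\<forall>\<psi>. dirichlet_character m \<psi> \<longrightarrow>
              (if real_character \<psi> then char_coeff m S \<psi> \<in> \<real>\<^sub>\<ge>\<^sub>0 else char_coeff m S \<psi> = 0))"
  shows "\<exists>\<delta>>0. \<exists>x0::real. \<forall>x\<ge>x0. prob_negative M f (residue_class_set m S) x > \<delta>"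
proof -
  let ?A = "residue_class_set m S"
  from exists_negative_tilt[OF m fails] obtain F t where F: "finite F" "\<And>p. p \<in> F \<Longrightarrow> prime p"
    and t: "\<And>p. \<bar>t p\<bar> \<le> 1" and neg: "Re (\<Sum>\<psi>\<in>characters m. char_coeff m S \<psi> * L_series (\<lambda>n. \<psi> n * \<psi> n) 2 *
          (\<Prod>p\<in>F. 1 + of_real (t p) * \<psi> p / of_nat p)) < 0" by blast
  define X where "X = real (totient m) / real (card (characters m)) *
      Re (\<Sum>\<psi>\<in>characters m. char_coeff m S \<psi> * L_series (\<lambda>n. \<psi> n * \<psi> n) 2 *
          (\<Prod>p\<in>F. 1 + of_real (t p) * \<psi> p / of_nat p))"
  have X: "X < 0" unfolding X_def using neg card_characters_pos[OF m] m by (intro mult_pos_neg) auto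
  define R where "R \<omega> = (\<Prod>p\<in>F. 1 + t p * f p \<omega>)" for \<omega>
  define K where "K = (2::real) ^ card F"
  have Rm: "R \<in> borel_measurable M"
    unfolding R_def using F f_prime_measurable
    by (intro borel_measurable_prod borel_measurable_add borel_measurable_times borel_measurable_const) auto
  have factor: "0 \<le> 1 + t p * f p \<omega>" "1 + t p * f p \<omega> \<le> 2" if "p \<in> F" "\<omega> \<in> space M" for p \<omega>
    using prime_values[OF F(2)[OF that(1)] that(2)] t[of p] by auto
  have R: "0 \<le> R \<omega>" "R \<omega> \<le> K" if "\<omega> \<in> space M" for \<omega>
  proof -
    show "0 \<le> R \<omega>" unfolding R_def using factor(1)[OF _ that] by (rule prod_nonneg)
    have "R \<omega> \<le> (\<Prod>p\<in>F. 2)" unfolding R_def using factor[OF _ that] by (intro prod_mono) auto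
    then show "R \<omega> \<le> K" by (simp add: K_def)
  qed
  have "eventually (\<lambda>N. expectation (\<lambda>\<omega>. partial_sum ?A N \<omega> * R \<omega>) < X / 2) at_top"
  proof (rule order_tendstoD)
    show "(\<lambda>N. expectation (\<lambda>\<omega>. partial_sum ?A N \<omega> * R \<omega>)) \<longlonglongrightarrow> X"
      unfolding X_def R_def by (rule tilted_expectation_tendsto[OF m S F(1)]) (rule F(2))
  qed (use X in simp)
  then obtain N0 where N0: "\<And>N. N \<ge> N0 \<Longrightarrow> expectation (\<lambda>\<omega>. partial_sum ?A N \<omega> * R \<omega>) < X / 2"
    by (auto simp: eventually_sequentially)
  define \<delta> where "\<delta> = (- X / 2) ^ 2 / (K ^ 2 * 8)"
  have \<delta>: "\<delta> > 0" using X by (simp add: \<delta>_def K_def)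
  \<comment> \<open>The bound obtained is not strict; halving makes it so.\<close>
  have "\<delta> / 2 < prob_negative M f ?A x" if x: "x \<ge> real N0" for x
  proof -
    have "nat \<lceil>x\<rceil> \<ge> N0" using x by (simp add: le_nat_iff) (metis ceiling_mono ceiling_of_nat)
    from N0[OF this] have "\<delta> \<le> prob {\<omega> \<in> space M. partial_sum ?A (nat \<lceil>x\<rceil>) \<omega> < 0}"
      unfolding \<delta>_def using X R
      by (intro prob_neg_lower_bound[OF partial_sum_measurable partial_sum_second_moment Rm]) (auto simp: K_def)
    then show ?thesis using \<delta> unfolding prob_negative_eq by linarith
  qed
  then show ?thesis using \<delta> by (intro exI[of _ "\<delta> / 2"]) auto
qed

end

section \<open>Smooth numbers\<close>

text \<open>The sub-Gaussian bound for a fair sign, as the case p = 1/2 of the inequality behind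
  Hoeffding's lemma.\<close>

lemma cosh_le_exp_square: "cosh (z::real) \<le> exp (z ^ 2 / 2)"
proof -
  have *: "cosh z \<le> exp (z ^ 2 / 2)" if z: "z \<ge> 0" for z :: real
  proof -
    have "- (2 * z) * (1 / 2) + ln (1 + (1 / 2) * (exp (2 * z) - 1)) \<le> (2 * z) ^ 2 / 8"
      using Hoeffdings_lemma_aux[of "2 * z" "1 / 2"] z by (simp add: algebra_simps)
    moreover have "1 + (1 / 2) * (exp (2 * z) - 1) = exp z * cosh z"
      by (simp add: cosh_field_def field_simps exp_add[symmetric])
    moreover have "ln (exp z * cosh z) = z + ln (cosh z)"
      by (simp add: ln_mult)
    ultimately have "ln (cosh z) \<le> z ^ 2 / 2" by (simp add: power2_eq_square)
    moreover have "cosh z = exp (ln (cosh z))" by simp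
    ultimately show ?thesis by (metis exp_le_cancel_iff)
  qed
  show ?thesis using *[of z] *[of "- z"] by (cases "z \<ge> 0") auto
qed

lemma sum_inverse_le_ln: "N \<ge> 1 \<Longrightarrow> (\<Sum>a\<in>{1..<N}. 1 / real a) \<le> 1 + ln (real N)"
proof -
  have *: "(\<Sum>a\<in>{1..<Suc N}. 1 / real a) \<le> 1 + ln (real N)" if "N \<ge> 1" for N
    using that
  proof (induction N rule: nat_induct_at_least)
    case (Suc N)
    have N: "real N > 0" using Suc by simp
    have "ln (real N / real (Suc N)) \<le> real N / real (Suc N) - 1"
      using N by (intro ln_le_minus_one) auto
    then have "1 / real (Suc N) \<le> ln (real (Suc N)) - ln (real N)"
      using N by (simp add: ln_div field_simps del: of_nat_Suc)
    then show ?case using Suc.IH by simp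
  qed simp
  assume N: "N \<ge> 1"
  have "(\<Sum>a\<in>{1..<N}. 1 / real a) \<le> (\<Sum>a\<in>{1..<Suc N}. 1 / real a)" by (intro sum_mono2) auto
  then show ?thesis using *[OF N] by linarith
qed

lemma sum_inverse_squares_tail:
  assumes y: "y \<ge> 1"
  shows "(\<Sum>k\<in>{y<..<N}. 1 / real k ^ 2) \<le> 1 / real y"
proof (cases "N > y")
  case True
  have "(\<Sum>k\<in>{y<..<N}. 1 / real k ^ 2) \<le> (\<Sum>k\<in>{y..<N - 1}. 1 / real k - 1 / real (Suc k))"
  proof -
    have "(\<Sum>k\<in>{y<..<N}. 1 / real k ^ 2) = (\<Sum>k\<in>{y..<N - 1}. 1 / real (Suc k) ^ 2)"
      by (rule sum.reindex_bij_witness[of _ Suc "\<lambda>k. k - 1"]) auto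
    also have "\<dots> \<le> (\<Sum>k\<in>{y..<N - 1}. 1 / real k - 1 / real (Suc k))"
    proof (rule sum_mono)
      fix k assume "k \<in> {y..<N - 1}"
      then have k: "real k > 0" using y by simp
      have "1 / real k - 1 / real (Suc k) = 1 / (real k * real (Suc k))" using k by (simp add: field_simps)
      also have "1 / real (Suc k) ^ 2 \<le> \<dots>" unfolding power2_eq_square using k by (intro divide_left_mono mult_right_mono) auto
      finally show "1 / real (Suc k) ^ 2 \<le> 1 / real k - 1 / real (Suc k)" .
    qed
    finally show ?thesis .
  qed
  also have "\<dots> = 1 / real y - 1 / real (N - 1)"
  proof -
    have "(\<Sum>k\<in>{y..<K}. 1 / real k - 1 / real (Suc k)) = 1 / real y - 1 / real K" if "y \<le> K" for K
      using that by (induction K rule: dec_induct) simp_all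
    then show ?thesis using True by simp
  qed
  also have "\<dots> \<le> 1 / real y" by simp
  finally show ?thesis .
qed simp

section \<open>Products over small primes and Rankin's bound\<close>

abbreviation primes_atMost :: "nat \<Rightarrow> nat set" where
  "primes_atMost y \<equiv> {p. prime p \<and> p \<le> y}"

lemma finite_primes_atMost: "finite (primes_atMost y)"
  by (rule finite_subset[of _ "{..y}"]) auto

lemma euler_product_powr:
  assumes s: "s > 0"
  shows "((\<lambda>n. real n powr - s) has_sum (\<Prod>p\<in>primes_atMost y. 1 / (1 - real p powr - s))) (smooth (primes_atMost y))"
  using prime_powr_less_1[OF _ s] finite_primes_atMost
  by (intro euler_product_finite) (auto simp: powr_mult)

lemma euler_product_powr_le:
  assumes e: "e > 0"
  shows "(\<Prod>p\<in>primes_atMost y. 1 / (1 - real p powr - (1 + e))) \<le> 1 + 1 / e"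
proof -
  have "((\<lambda>n. real n powr - (1 + e)) has_sum zeta (1 + e)) UNIV"
    using summable_zeta[of "1 + e"] e by (intro norm_summable_imp_has_sum summable_sums) auto
  note zeta = this
  have "((\<lambda>n. real n powr - (1 + e)) has_sum (\<Prod>p\<in>primes_atMost y. 1 / (1 - real p powr - (1 + e)))) (smooth (primes_atMost y))"
    using e by (intro euler_product_powr) simp
  from has_sum_mono_neutral[OF this zeta]
  have "(\<Prod>p\<in>primes_atMost y. 1 / (1 - real p powr - (1 + e))) \<le> zeta (1 + e)"
    by simp
  then show ?thesis using zeta_bounds(2)[of "1 + e"] e by simp
qed

lemma exp_le_inverse_one_minus: "0 \<le> t \<Longrightarrow> t < 1 \<Longrightarrow> exp t \<le> 1 / (1 - (t::real))"
  using exp_ge_add_one_self[of "- t"] by (simp add: exp_minus field_simps)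

lemma inverse_one_minus_le_exp: "0 \<le> t \<Longrightarrow> t \<le> 3 / 4 \<Longrightarrow> 1 / (1 - t) \<le> exp (4 * (t::real))"
proof -
  assume t: "0 \<le> t" "t \<le> 3 / 4"
  have "t * t \<le> t * (3 / 4)" using t by (intro mult_left_mono) auto
  then have "1 \<le> (1 + 4 * t) * (1 - t)" by (simp add: algebra_simps)
  then have "1 / (1 - t) \<le> 1 + 4 * t" using t by (simp add: divide_le_eq)
  then show ?thesis using exp_ge_add_one_self[of "4 * t"] by linarith
qed

text \<open>A substitute for Mertens' theorem: with e = 1/ln y, the product of 1/(1 - p^(-1-e)) over
  p \<le> y is at most 1 + 1/e = 1 + ln y, and exp t \<le> 1/(1 - t) compares each factor with its
  k-th power.\<close>

lemma prod_le_euler_product_power: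
  assumes y: "y \<ge> 2" and h: "\<And>p. p \<in> primes_atMost y \<Longrightarrow> 0 \<le> h p \<and> h p \<le> exp (real k * real p powr - (1 + 1 / ln (real y)))"
  shows "(\<Prod>p\<in>primes_atMost y. h p) \<le> (1 + ln (real y)) ^ k"
proof -
  define e where "e = 1 / ln (real y)"
  have e: "e > 0" using y by (simp add: e_def)
  have lt: "real p powr - (1 + e) < 1" if "prime p" for p
    using prime_powr_less_1[OF that, of "1 + e"] e by simp
  have "(\<Prod>p\<in>primes_atMost y. h p) \<le> (\<Prod>p\<in>primes_atMost y. (1 / (1 - real p powr - (1 + e))) ^ k)"
  proof (rule prod_mono)
    fix p assume p: "p \<in> primes_atMost y"
    have "h p \<le> exp (real p powr - (1 + e)) ^ k"
      using h[OF p] by (simp add: exp_of_nat_mult[symmetric] e_def)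
    also have "\<dots> \<le> (1 / (1 - real p powr - (1 + e))) ^ k"
      using lt[of p] p by (intro power_mono exp_le_inverse_one_minus) auto
    finally show "0 \<le> h p \<and> h p \<le> (1 / (1 - real p powr - (1 + e))) ^ k" using h[OF p] by simp
  qed
  also have "\<dots> = (\<Prod>p\<in>primes_atMost y. 1 / (1 - real p powr - (1 + e))) ^ k" by (rule prod_power_distrib[symmetric])
  also have "\<dots> \<le> (1 + 1 / e) ^ k"
    using lt by (intro power_mono euler_product_powr_le e prod_nonneg) (auto simp: less_imp_le)
  finally show ?thesis by (simp add: e_def)
qed

text \<open>Moving an exponent by 1/ln y costs at most exp 1 \<le> 3 for p \<le> y. This is the
  source of the exponents 3 and 36 below.\<close>

lemma powr_inverse_ln_le:
  assumes p: "1 \<le> p" "p \<le> y" and y: "y \<ge> (2::nat)"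
  shows "real p powr (1 / ln (real y)) \<le> 3"
proof -
  have "ln (real p) \<le> ln (real y)" using p by (subst ln_le_cancel_iff) auto
  then have "1 / ln (real y) * ln (real p) \<le> 1" using y by (simp add: divide_le_eq)
  then have "real p powr (1 / ln (real y)) \<le> exp 1" using p by (simp add: powr_def)
  then show ?thesis using exp_le by linarith
qed

lemma prod_one_plus_inverse_le:
  assumes y: "y \<ge> 2"
  shows "(\<Prod>p\<in>primes_atMost y. 1 + 1 / real p) \<le> (1 + ln (real y)) ^ 3"
proof (rule prod_le_euler_product_power[OF y], intro conjI)
  fix p assume "p \<in> primes_atMost y"
  then have p: "1 \<le> p" "p \<le> y" using prime_ge_1_nat by auto
  define a where "a = 1 / ln (real y)"
  have "1 / real p = real p powr - (1 + a) * real p powr a"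
    using p by (simp add: powr_add[symmetric] powr_minus_divide)
  also have "\<dots> \<le> real p powr - (1 + a) * 3"
    unfolding a_def by (intro mult_left_mono powr_inverse_ln_le p y) auto
  finally have "1 + 1 / real p \<le> 1 + real 3 * real p powr - (1 + a)" by simp
  also have "\<dots> \<le> exp (real 3 * real p powr - (1 + a))" by (rule exp_ge_add_one_self)
  finally show "1 + 1 / real p \<le> exp (real 3 * real p powr - (1 + 1 / ln (real y)))" by (simp only: a_def)
qed auto

text \<open>The exponent is 36 = 4 * 3 * 3: a factor 4 from 1/(1 - t) \<le> exp (4 t), and 3 for
  each of the two shifts by a = 1/ln y from 1 - a to 1 + a. As 9 \<ge> exp 2, the condition on y
  gives a \<le> 1/2 and hence t \<le> 2^(-1/2) \<le> 3/4.\<close>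

lemma rankin_product_le:
  assumes y: "y \<ge> 9"
  shows "(\<Prod>p\<in>primes_atMost y. 1 / (1 - real p powr - (1 - 1 / ln (real y)))) \<le> (1 + ln (real y)) ^ 36"
proof (rule prod_le_euler_product_power)
  show "y \<ge> 2" using y by simp
  have "exp (2::real) \<le> 9"
  proof -
    have "exp (2::real) = exp 1 * exp 1" by (simp add: exp_add[symmetric])
    also have "\<dots> \<le> 3 * 3" by (intro mult_mono exp_le) auto
    finally show ?thesis by simp
  qed
  then have "2 \<le> ln (real y)" using y by (subst ln_ge_iff) auto
  define a where "a = 1 / ln (real y)"
  have a: "0 < a" "a \<le> 1 / 2" using \<open>2 \<le> ln (real y)\<close> by (auto simp: a_def field_simps)
  fix p assume "p \<in> primes_atMost y"
  then have p: "2 \<le> real p" "1 \<le> p" "p \<le> y" using prime_ge_2_nat prime_ge_1_nat by auto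
  define t where "t = real p powr - (1 - a)"
  have "t \<le> real p powr - (1 / 2)" unfolding t_def using p a by (intro powr_mono) auto
  also have "\<dots> \<le> 2 powr - (1 / 2)" using p by (intro powr_mono2') auto
  also have "\<dots> = 1 / sqrt 2" by (simp add: powr_minus_divide powr_half_sqrt)
  also have "\<dots> \<le> 3 / 4"
  proof -
    have "4 / 3 \<le> sqrt (2::real)" by (rule real_le_rsqrt) (simp add: power2_eq_square)
    then show ?thesis by (simp add: field_simps)
  qed
  finally have t: "0 \<le> t" "t \<le> 3 / 4" by (auto simp: t_def)
  have "t = real p powr - (1 + a) * (real p powr a * real p powr a)"
    unfolding t_def by (simp add: powr_add[symmetric])
  also have "\<dots> \<le> real p powr - (1 + a) * (3 * 3)"
    unfolding a_def using y by (intro mult_left_mono mult_mono powr_inverse_ln_le p) auto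
  finally have "4 * t \<le> real 36 * real p powr - (1 + a)" by simp
  then have "1 / (1 - t) \<le> exp (real 36 * real p powr - (1 + a))"
    using inverse_one_minus_le_exp[OF t] by (meson exp_le_cancel_iff order_trans)
  then show "0 \<le> 1 / (1 - real p powr - (1 - 1 / ln (real y))) \<and>
      1 / (1 - real p powr - (1 - 1 / ln (real y))) \<le> exp (real 36 * real p powr - (1 + 1 / ln (real y)))"
    using t unfolding t_def a_def by auto
qed

text \<open>Rankin's trick: for n \<ge> N and a = 1/ln y one has 1/n \<le> N^(-a) n^(-(1-a)), and
  the sum of n^(-(1-a)) over smooth n is a finite Euler product.\<close>

lemma smooth_tail_le:
  assumes y: "y \<ge> 9" and N: "N \<ge> 1" and F: "finite F" "F \<subseteq> smooth (primes_atMost y)" "\<And>n. n \<in> F \<Longrightarrow> N \<le> n"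
  shows "(\<Sum>n\<in>F. 1 / real n) \<le> (1 + ln (real y)) ^ 36 * real N powr - (1 / ln (real y))"
proof -
  define a where "a = 1 / ln (real y)"
  have "1 < ln (real y)"
  proof -
    have "exp (1::real) < real y" using exp_le y by linarith
    then show ?thesis by (metis exp_gt_zero ln_exp ln_less_cancel_iff order_less_trans)
  qed
  then have a: "0 < a" "a < 1" by (auto simp: a_def)
  have "(\<Sum>n\<in>F. 1 / real n) \<le> (\<Sum>n\<in>F. real N powr - a * real n powr - (1 - a))"
  proof (rule sum_mono)
    fix n assume "n \<in> F"
    then have n: "N \<le> n" "real n > 0" using F(3) N by fastforce+
    have "- 1 = - a + - (1 - a)" by simp
    then have "real n powr - 1 = real n powr - a * real n powr - (1 - a)"
      by (simp only: powr_add)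
    then have "1 / real n = real n powr - a * real n powr - (1 - a)"
      using n by (simp add: powr_minus_divide)
    also have "\<dots> \<le> real N powr - a * real n powr - (1 - a)"
      using n N a by (intro mult_right_mono powr_mono2') auto
    finally show "1 / real n \<le> real N powr - a * real n powr - (1 - a)" .
  qed
  also have "\<dots> = real N powr - a * (\<Sum>n\<in>F. real n powr - (1 - a))" by (simp add: sum_distrib_left)
  also have "\<dots> \<le> real N powr - a * (1 + ln (real y)) ^ 36"
  proof (intro mult_left_mono)
    have "(\<Sum>n\<in>F. real n powr - (1 - a)) \<le> (\<Prod>p\<in>primes_atMost y. 1 / (1 - real p powr - (1 - a)))"
      by (rule finite_sum_le_has_sum[OF euler_product_powr]) (use a F in auto)
    also have "\<dots> \<le> (1 + ln (real y)) ^ 36" unfolding a_def by (rule rankin_product_le[OF y])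
    finally show "(\<Sum>n\<in>F. real n powr - (1 - a)) \<le> (1 + ln (real y)) ^ 36" .
  qed auto
  finally show ?thesis by (simp add: a_def mult.commute)
qed

context random_completely_multiplicative
begin

section \<open>The smooth part of the random sum\<close>

lemma smooth_sum_eq_euler_products:
  assumes m: "m > 0" and S: "S \<subseteq> totatives m" and \<omega>: "\<omega> \<in> space M"
  shows "((\<lambda>n. of_bool (n \<in> residue_class_set m S) * f n \<omega> / real n) has_sum
     real (totient m) / real (card (characters m)) *
       Re (\<Sum>\<psi>\<in>characters m. char_coeff m S \<psi> * (\<Prod>p\<in>primes_atMost y. 1 / (1 - \<psi> p * of_real (f p \<omega>) / of_nat p))))
     (smooth (primes_atMost y))"
proof -
  let ?N = "real (card (characters m))" and ?\<phi> = "real (totient m)"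
  have pos: "?N > 0" "?\<phi> > 0" using card_characters_pos[OF m] m by simp_all
  have "((\<lambda>n. \<Sum>\<psi>\<in>characters m. char_coeff m S \<psi> * (\<psi> n * of_real (f n \<omega>) / of_nat n)) has_sum
     (\<Sum>\<psi>\<in>characters m. char_coeff m S \<psi> * (\<Prod>p\<in>primes_atMost y. 1 / (1 - \<psi> p * of_real (f p \<omega>) / of_nat p))))
     (smooth (primes_atMost y))"
  proof (intro has_sum_finite_sum finite_characters[OF m] has_sum_cmult_right euler_product_finite finite_primes_atMost)
    fix \<psi> assume "\<psi> \<in> characters m"
    then have \<psi>: "dirichlet_character m \<psi>" by simp
    show "\<psi> 1 * of_real (f 1 \<omega>) / of_nat 1 = 1"
      using dirichlet_character_one[OF \<psi>] f_one[OF \<omega>] by simp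
    show "\<psi> (a * b) * of_real (f (a * b) \<omega>) / of_nat (a * b) = \<psi> a * of_real (f a \<omega>) / of_nat a * (\<psi> b * of_real (f b \<omega>) / of_nat b)"
      if "a > 0" "b > 0" for a b
      using that by (simp add: dirichlet_character_mult[OF \<psi>] f_mult[OF that \<omega>])
    show "norm (\<psi> p * of_real (f p \<omega>) / of_nat p) < 1" if "p \<in> primes_atMost y" for p
    proof -
      have "norm (\<psi> p) * \<bar>f p \<omega>\<bar> \<le> 1 * 1"
        using dirichlet_character_norm_le_1[OF m \<psi>] abs_f[of p \<omega>] \<omega> that prime_gt_0_nat by (intro mult_mono) auto
      moreover have "real p > 1" using that prime_gt_1_nat by auto
      ultimately show ?thesis by (simp add: norm_mult norm_divide divide_less_eq)
    qed
  qed auto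
  from has_sum_cmult_right[OF has_sum_Re[OF this], of "?\<phi> / ?N"]
  show ?thesis
  proof (rule has_sum_cong[THEN iffD1, rotated])
    fix n assume "n \<in> smooth (primes_atMost y)"
    then have n: "n > 0" by (simp add: smooth_def)
    have "(\<Sum>\<psi>\<in>characters m. char_coeff m S \<psi> * (\<psi> n * of_real (f n \<omega>) / of_nat n)) =
       (\<Sum>\<psi>\<in>characters m. char_coeff m S \<psi> * \<psi> n) * of_real (f n \<omega> / real n)"
      unfolding sum_distrib_right by (intro sum.cong refl) simp
    also have "\<dots> = of_real (?N / ?\<phi> * (of_bool (n \<in> residue_class_set m S) * f n \<omega> / real n))"
      unfolding residue_class_set_character_expansion[OF m S n] by simp
    finally show "?\<phi> / ?N * Re (\<Sum>\<psi>\<in>characters m. char_coeff m S \<psi> * (\<psi> n * of_real (f n \<omega>) / of_nat n)) =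
       of_bool (n \<in> residue_class_set m S) * f n \<omega> / real n"
      using pos by (simp only: Re_complex_of_real) simp
  qed
qed

text \<open>All characters contribute non-negatively, so it suffices to keep the principal one. Its
  coefficient is at least 1/totient(m) because S is non-empty, and its Euler product is smallest
  when every sign is -1, where it is at least the inverse of \<Prod> (1 + 1/p). Cutting off at N
  costs the Rankin tail.\<close>

lemma smooth_sum_lower_bound:
  assumes m: "m > 0" and S: "S \<subseteq> totatives m" "S \<noteq> {}" and \<omega>: "\<omega> \<in> space M"
    and coeffs: "\<And>\<psi>. dirichlet_character m \<psi> \<Longrightarrow>
              (if real_character \<psi> then char_coeff m S \<psi> \<in> \<real>\<^sub>\<ge>\<^sub>0 else char_coeff m S \<psi> = 0)"
    and y: "y \<ge> 9" and N: "N \<ge> 1"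
  shows "1 / real (card (characters m)) / (1 + ln (real y)) ^ 3 - (1 + ln (real y)) ^ 36 * real N powr - (1 / ln (real y))
      \<le> (\<Sum>n | n \<in> residue_class_set m S \<and> n \<in> smooth (primes_atMost y) \<and> n < N. f n \<omega> / real n)"
proof -
  let ?A = "residue_class_set m S" and ?P = "primes_atMost y"
  let ?N = "real (card (characters m))" and ?\<phi> = "real (totient m)"
  have pos: "?N > 0" "?\<phi> > 0" using card_characters_pos[OF m] m by simp_all
  have finS: "finite S" using S(1) finite_subset by (metis finite_totatives)
  define E where "E \<psi> = (\<Prod>p\<in>?P. 1 / (1 - \<psi> p * of_real (f p \<omega>) / of_nat p))" for \<psi> :: "nat \<Rightarrow> complex"
  define X where "X = ?\<phi> / ?N * Re (\<Sum>\<psi>\<in>characters m. char_coeff m S \<psi> * E \<psi>)"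
  have sumX: "((\<lambda>n. of_bool (n \<in> ?A) * f n \<omega> / real n) has_sum X) (smooth ?P)"
    unfolding X_def E_def by (rule smooth_sum_eq_euler_products[OF m S(1) \<omega>])
  have Ereal: "\<exists>r>0. E \<psi> = of_real r" if \<psi>: "dirichlet_character m \<psi>" "real_character \<psi>" for \<psi>
  proof -
    have "E \<psi> = of_real (\<Prod>p\<in>?P. 1 / (1 - Re (\<psi> p) * f p \<omega> / real p))"
      using \<psi>(2) by (simp add: E_def real_character_def)
    moreover have "(\<Prod>p\<in>?P. 1 / (1 - Re (\<psi> p) * f p \<omega> / real p)) > 0"
    proof (rule prod_pos)
      fix p assume p: "p \<in> ?P"
      have "\<bar>Re (\<psi> p)\<bar> * \<bar>f p \<omega>\<bar> \<le> 1 * 1"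
        using order_trans[OF abs_Re_le_cmod dirichlet_character_norm_le_1[OF m \<psi>(1)]] abs_f[of p \<omega>] \<omega> p prime_gt_0_nat
        by (intro mult_mono) auto
      then have "Re (\<psi> p) * f p \<omega> \<le> 1" by (simp add: abs_mult[symmetric])
      moreover have "real p > 1" using p prime_gt_1_nat by auto
      ultimately show "1 / (1 - Re (\<psi> p) * f p \<omega> / real p) > 0" by (simp add: divide_less_eq)
    qed
    ultimately show ?thesis by blast
  qed
  have nonneg: "0 \<le> Re (char_coeff m S \<psi> * E \<psi>)" if "\<psi> \<in> characters m" for \<psi>
  proof (cases "real_character \<psi>")
    case True
    have \<psi>: "dirichlet_character m \<psi>" using that by simp
    obtain r where r: "r > 0" "E \<psi> = of_real r" using Ereal[OF \<psi> True] by blast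
    have "Re (char_coeff m S \<psi>) \<ge> 0" using coeffs[OF \<psi>] True by (auto simp: complex_nonneg_Reals_iff)
    then show ?thesis using r by simp
  next
    case False
    then show ?thesis using coeffs[of \<psi>] that by simp
  qed
  have lower: "1 / ?\<phi> / (1 + ln (real y)) ^ 3 \<le> Re (char_coeff m S (principal_character m) * E (principal_character m))"
  proof -
    have "cnj (principal_character m a) = 1" if "a \<in> S" for a
      using that S(1) by (auto simp: principal_character_def totatives_def)
    then have c: "char_coeff m S (principal_character m) = of_real (real (card S) / ?\<phi>)"
      by (simp add: char_coeff_def)
    have Epr: "E (principal_character m) = of_real (\<Prod>p\<in>?P. 1 / (1 - of_bool (coprime p m) * f p \<omega> / real p))"
      unfolding E_def of_real_prod
    proof (rule prod.cong[OF refl])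
      fix p show "1 / (1 - principal_character m p * of_real (f p \<omega>) / of_nat p) = complex_of_real (1 / (1 - of_bool (coprime p m) * f p \<omega> / real p))"
        by (cases "coprime p m") (simp_all add: principal_character_def)
    qed
    have "1 / (1 + ln (real y)) ^ 3 \<le> (\<Prod>p\<in>?P. 1 / (1 - of_bool (coprime p m) * f p \<omega> / real p))"
    proof -
      have "1 / (1 + ln (real y)) ^ 3 \<le> 1 / (\<Prod>p\<in>?P. 1 + 1 / real p)"
        using prod_one_plus_inverse_le[of y] y
        by (intro divide_left_mono mult_pos_pos prod_pos) (auto simp: add_pos_nonneg)
      also have "\<dots> = (\<Prod>p\<in>?P. 1 / (1 + 1 / real p))" by (simp add: prod_dividef)
      also have "\<dots> \<le> (\<Prod>p\<in>?P. 1 / (1 - of_bool (coprime p m) * f p \<omega> / real p))"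
      proof (rule prod_mono, intro conjI)
        fix p assume p: "p \<in> ?P"
        have p1: "real p > 1" using p prime_gt_1_nat by auto
        have "f p \<omega> \<in> {1, -1}" using prime_values[of p \<omega>] p \<omega> by auto
        then have "0 < 1 - of_bool (coprime p m) * f p \<omega> / real p" "1 - of_bool (coprime p m) * f p \<omega> / real p \<le> 1 + 1 / real p"
          using p1 by (cases "coprime p m"; auto simp: field_simps)+
        then show "1 / (1 + 1 / real p) \<le> 1 / (1 - of_bool (coprime p m) * f p \<omega> / real p)"
          using p1 by (intro divide_left_mono mult_pos_pos) (auto simp: add_pos_pos)
      qed auto
      finally show ?thesis .
    qed
    moreover have "1 / ?\<phi> \<le> real (card S) / ?\<phi>"
    proof -
      have "card S \<ge> 1" using S(2) finS by (simp add: Suc_le_eq card_gt_0_iff)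
      then show ?thesis by (intro divide_right_mono) auto
    qed
    ultimately have "1 / ?\<phi> * (1 / (1 + ln (real y)) ^ 3) \<le> real (card S) / ?\<phi> * (\<Prod>p\<in>?P. 1 / (1 - of_bool (coprime p m) * f p \<omega> / real p))"
      using y by (intro mult_mono) auto
    then show ?thesis
      unfolding c Epr of_real_mult[symmetric] Re_complex_of_real by simp
  qed
  have "1 / ?\<phi> / (1 + ln (real y)) ^ 3 \<le> (\<Sum>\<psi>\<in>characters m. Re (char_coeff m S \<psi> * E \<psi>))"
    using dirichlet_character_principal nonneg finite_characters[OF m]
    by (intro order_trans[OF lower] member_le_sum) auto
  then have "?\<phi> / ?N * (1 / ?\<phi> / (1 + ln (real y)) ^ 3) \<le> X"
    unfolding X_def Re_sum using pos by (intro mult_left_mono) auto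
  then have XX: "1 / ?N / (1 + ln (real y)) ^ 3 \<le> X" using pos by simp
  define I where "I = {n. n \<in> ?A \<and> n \<in> smooth ?P \<and> n < N}"
  define J where "J = {n \<in> smooth ?P. n < N}"
  have finJ: "finite J" by (rule finite_subset[of _ "{..<N}"]) (auto simp: J_def)
  have sumI: "(\<Sum>n\<in>J. of_bool (n \<in> ?A) * f n \<omega> / real n) = (\<Sum>n\<in>I. f n \<omega> / real n)"
    using finJ by (intro sum.mono_neutral_cong_right) (auto simp: I_def J_def)
  have "X - (\<Sum>n\<in>I. f n \<omega> / real n) \<le> (1 + ln (real y)) ^ 36 * real N powr - (1 / ln (real y))"
  proof (rule has_sum_le_finite_sums)
    show "((\<lambda>n. of_bool (n \<in> ?A) * f n \<omega> / real n) has_sum (X - (\<Sum>n\<in>I. f n \<omega> / real n))) (smooth ?P - J)"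
      unfolding sumI[symmetric] by (rule has_sum_Diff[OF sumX has_sum_finite[OF finJ]]) (auto simp: J_def)
    fix F assume F: "finite F" "F \<subseteq> smooth ?P - J"
    have "(\<Sum>n\<in>F. of_bool (n \<in> ?A) * f n \<omega> / real n) \<le> (\<Sum>n\<in>F. 1 / real n)"
    proof (rule sum_mono)
      fix n assume "n \<in> F"
      then have "n > 0" using F(2) by (auto simp: smooth_def)
      then have "f n \<omega> \<in> {1, -1}" using f_values \<omega> by blast
      then show "of_bool (n \<in> ?A) * f n \<omega> / real n \<le> 1 / real n"
        by (intro divide_right_mono) (auto simp: of_bool_def)
    qed
    also have "\<dots> \<le> (1 + ln (real y)) ^ 36 * real N powr - (1 / ln (real y))"
      using F by (intro smooth_tail_le[OF y N]) (auto simp: J_def)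
    finally show "(\<Sum>n\<in>F. of_bool (n \<in> ?A) * f n \<omega> / real n) \<le> (1 + ln (real y)) ^ 36 * real N powr - (1 / ln (real y))" .
  qed
  then show ?thesis using XX unfolding I_def by linarith
qed

end

section \<open>Rough numbers: a martingale bound\<close>

context random_completely_multiplicative
begin

text \<open>Measurability with respect to the signs on Q, stated pointwise in place of a generated
  sigma-algebra. For a finite set Q of primes it gives an explicit expansion, through which
  independence is used.\<close>

definition depends_on :: "nat set \<Rightarrow> ('w \<Rightarrow> real) \<Rightarrow> bool" where
  "depends_on Q X \<longleftrightarrow> (\<forall>\<omega>\<in>space M. \<forall>\<omega>'\<in>space M. (\<forall>q\<in>Q. f q \<omega> = f q \<omega>') \<longrightarrow> X \<omega> = X \<omega>')"

lemma depends_onD: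
  assumes "depends_on Q X" "\<omega> \<in> space M" "\<omega>' \<in> space M" "\<And>q. q \<in> Q \<Longrightarrow> f q \<omega> = f q \<omega>'"
  shows "X \<omega> = X \<omega>'"
  using assms unfolding depends_on_def by blast

lemma depends_on_f:
  assumes "n > 0" "prime_factors n \<subseteq> Q"
  shows "depends_on Q (f n)"
  using assms
proof (induction n rule: less_induct)
  case (less n)
  show ?case
  proof (cases "n = 1")
    case True
    then show ?thesis using f_one by (simp add: depends_on_def)
  next
    case False
    then obtain p where p: "prime p" "p dvd n" using prime_factor_nat by blast
    then obtain k where k: "n = p * k" by (auto elim: dvdE)
    have k0: "k > 0" "p > 0" using k less.prems by auto
    then have "k < n" using k prime_gt_1_nat[OF p(1)] by simp
    moreover have "prime_factors k \<subseteq> Q" "p \<in> Q"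
      using less.prems p k0 by (auto simp: k prime_factors_product in_prime_factors_iff)
    ultimately have "depends_on Q (f k)" "p \<in> Q" using less.IH k0 by auto
    then show ?thesis
      using f_mult[OF k0(2,1)] unfolding depends_on_def k by metis
  qed
qed

text \<open>A variable depending on finitely many signs is a finite combination of indicators
  \<open>\<Prod> (1 + s(q) f(q)) / 2\<close> of sign patterns \<open>s\<close>.\<close>

lemma depends_on_expansion:
  assumes Q: "finite Q" "\<And>q. q \<in> Q \<Longrightarrow> prime q" and X: "depends_on Q X"
  shows "\<exists>\<Phi>. \<forall>\<omega>\<in>space M. X \<omega> = (\<Sum>s\<in>PiE Q (\<lambda>_. {1, -1}). \<Phi> s * (\<Prod>q\<in>Q. (1 + s q * f q \<omega>) / 2))"
proof -
  \<comment> \<open>For a pattern that no point of the space realises, \<open>SOME\<close> returns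
    an arbitrary value; the indicator of such a pattern vanishes everywhere, so the value is never
    seen.\<close>
  define \<Phi> where "\<Phi> s = X (SOME \<omega>. \<omega> \<in> space M \<and> (\<forall>q\<in>Q. f q \<omega> = s q))" for s
  have "X \<omega> = (\<Sum>s\<in>PiE Q (\<lambda>_. {1, -1}). \<Phi> s * (\<Prod>q\<in>Q. (1 + s q * f q \<omega>) / 2))" if \<omega>: "\<omega> \<in> space M" for \<omega>
  proof -
    define r where "r = restrict (\<lambda>q. f q \<omega>) Q"
    have val: "f q \<omega> \<in> {1, -1}" if "q \<in> Q" for q using prime_values[OF Q(2)[OF that] \<omega>] .
    have r: "r \<in> PiE Q (\<lambda>_. {1, -1})" unfolding r_def using val by auto
    have "(\<Prod>q\<in>Q. (1 + s q * f q \<omega>) / 2) = (if s = r then 1 else 0)" if s: "s \<in> PiE Q (\<lambda>_. {1, -1})" for s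
    proof (cases "s = r")
      case True
      have "(1 + r q * f q \<omega>) / 2 = 1" if "q \<in> Q" for q using val[OF that] that by (auto simp: r_def)
      then show ?thesis using True by simp
    next
      case False
      have "\<exists>q\<in>Q. s q \<noteq> r q"
      proof (rule ccontr)
        assume "\<not> ?thesis"
        then have "s = r" using s r by (intro PiE_ext[of s Q]) auto
        then show False using False by simp
      qed
      then obtain q where q: "q \<in> Q" "s q \<noteq> r q" by blast
      have "s q \<in> {1, -1}" using s q(1) by (metis PiE_mem)
      then have "(1 + s q * f q \<omega>) / 2 = 0" using val[OF q(1)] q by (auto simp: r_def)
      then have "(\<Prod>q\<in>Q. (1 + s q * f q \<omega>) / 2) = 0" using q(1) Q(1) by (intro prod_zero) auto
      then show ?thesis using False by simp
    qed
    then have "(\<Sum>s\<in>PiE Q (\<lambda>_. {1, -1}). \<Phi> s * (\<Prod>q\<in>Q. (1 + s q * f q \<omega>) / 2)) =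
       (\<Sum>s\<in>PiE Q (\<lambda>_. {1, -1}). if s = r then \<Phi> r else 0)"
      by (intro sum.cong) auto
    also have "\<dots> = \<Phi> r" using r Q(1) by (simp add: finite_PiE)
    also have "\<Phi> r = X \<omega>"
    proof -
      have "\<omega> \<in> space M \<and> (\<forall>q\<in>Q. f q \<omega> = r q)" using \<omega> by (simp add: r_def)
      then have *: "(SOME \<omega>. \<omega> \<in> space M \<and> (\<forall>q\<in>Q. f q \<omega> = r q)) \<in> space M \<and>
          (\<forall>q\<in>Q. f q (SOME \<omega>. \<omega> \<in> space M \<and> (\<forall>q\<in>Q. f q \<omega> = r q)) = r q)"
        by (rule someI)
      show ?thesis
        unfolding \<Phi>_def by (rule X[unfolded depends_on_def, rule_format]) (use * \<omega> in \<open>auto simp: r_def\<close>)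
    qed
    finally show ?thesis by simp
  qed
  then show ?thesis by blast
qed

lemma integrable_prod_primes:
  fixes g :: "nat \<Rightarrow> real \<Rightarrow> real"
  assumes "finite Q" "\<And>p. p \<in> Q \<Longrightarrow> prime p" "\<And>p. p \<in> Q \<Longrightarrow> g p \<in> borel_measurable borel"
  shows "integrable M (\<lambda>\<omega>. \<Prod>p\<in>Q. g p (f p \<omega>))"
proof (rule indep_vars_integrable[OF assms(1)])
  have "indep_vars (\<lambda>_. borel) f Q"
    by (rule indep_vars_subset[OF indep_primes]) (use assms(2) in auto)
  then show "indep_vars (\<lambda>_. borel) (\<lambda>p \<omega>. g p (f p \<omega>)) Q"
    by (rule indep_vars_compose2) (use assms(3) in auto)
  show "integrable M (\<lambda>\<omega>. g p (f p \<omega>))" if "p \<in> Q" for p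
    using integrable_of_f_prime assms that by blast
qed

lemma depends_on_integrable:
  assumes Q: "finite Q" "\<And>q. q \<in> Q \<Longrightarrow> prime q" and X: "depends_on Q X"
  shows "integrable M X"
proof -
  obtain \<Phi> where \<Phi>: "\<And>\<omega>. \<omega> \<in> space M \<Longrightarrow> X \<omega> = (\<Sum>s\<in>PiE Q (\<lambda>_. {1, -1}). \<Phi> s * (\<Prod>q\<in>Q. (1 + s q * f q \<omega>) / 2))"
    using depends_on_expansion[OF assms] by blast
  have "integrable M (\<lambda>\<omega>. \<Sum>s\<in>PiE Q (\<lambda>_. {1, -1}). \<Phi> s * (\<Prod>q\<in>Q. (1 + s q * f q \<omega>) / 2))"
    by (intro Bochner_Integration.integrable_sum integrable_mult_right
        integrable_prod_primes[of Q "\<lambda>q x. (1 + _ q * x) / 2"] Q) auto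
  then show ?thesis
    using \<Phi> by (subst Bochner_Integration.integrable_cong[OF refl]) auto
qed

text \<open>The martingale difference property: on each sign pattern of Q the expectation factors
  over primes, and the factor of k has mean zero.\<close>

lemma expectation_f_times_depends_on:
  assumes Q: "finite Q" "\<And>q. q \<in> Q \<Longrightarrow> prime q" and X: "depends_on Q X" and k: "prime k" "k \<notin> Q"
  shows "expectation (\<lambda>\<omega>. f k \<omega> * X \<omega>) = 0"
proof -
  obtain \<Phi> where \<Phi>: "\<And>\<omega>. \<omega> \<in> space M \<Longrightarrow> X \<omega> = (\<Sum>s\<in>PiE Q (\<lambda>_. {1, -1}). \<Phi> s * (\<Prod>q\<in>Q. (1 + s q * f q \<omega>) / 2))"
    using depends_on_expansion[OF Q X] by blast
  define g where "g s p x = (if p = k then x else (1 + s p * x) / 2)" for s :: "nat \<Rightarrow> real" and p :: nat and x :: real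
  have gm: "g s p \<in> borel_measurable borel" for s p unfolding g_def by (cases "p = k") auto
  have kQ: "finite (insert k Q)" "\<And>p. p \<in> insert k Q \<Longrightarrow> prime p" using Q k by auto
  have prod: "f k \<omega> * (\<Prod>q\<in>Q. (1 + s q * f q \<omega>) / 2) = (\<Prod>p\<in>insert k Q. g s p (f p \<omega>))" for s \<omega>
  proof -
    have "(\<Prod>q\<in>Q. (1 + s q * f q \<omega>) / 2) = (\<Prod>p\<in>Q. g s p (f p \<omega>))"
      using k(2) by (intro prod.cong) (auto simp: g_def)
    then show ?thesis using k(2) Q(1) by (simp add: g_def)
  qed
  have "expectation (\<lambda>\<omega>. f k \<omega> * X \<omega>) = expectation (\<lambda>\<omega>. \<Sum>s\<in>PiE Q (\<lambda>_. {1, -1}). \<Phi> s * (\<Prod>p\<in>insert k Q. g s p (f p \<omega>)))"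
    by (intro Bochner_Integration.integral_cong refl)
       (simp only: \<Phi> prod[symmetric] sum_distrib_left mult.left_commute)
  also have "\<dots> = (\<Sum>s\<in>PiE Q (\<lambda>_. {1, -1}). \<Phi> s * expectation (\<lambda>\<omega>. \<Prod>p\<in>insert k Q. g s p (f p \<omega>)))"
    using integrable_prod_primes[OF kQ gm] by (subst Bochner_Integration.integral_sum) auto
  also have "\<dots> = 0"
  proof (intro sum.neutral ballI)
    fix s
    have "expectation (\<lambda>\<omega>. \<Prod>p\<in>insert k Q. g s p (f p \<omega>)) = (\<Prod>p\<in>insert k Q. expectation (\<lambda>\<omega>. g s p (f p \<omega>)))"
      by (rule expectation_prod_primes[OF kQ gm])
    also have "\<dots> = 0"
      using expectation_f_prime[OF k(1)] Q(1) by (intro prod_zero) (auto simp: g_def)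
    finally show "\<Phi> s * expectation (\<lambda>\<omega>. \<Prod>p\<in>insert k Q. g s p (f p \<omega>)) = 0" by simp
  qed
  finally show ?thesis .
qed

text \<open>The Azuma-Hoeffding argument, one prime at a time. Since f(N) is 1 or -1, exp (- l f G)
  = cosh (l G) - f sinh (l G). The past and G depend only on signs at primes below N, so the sinh
  term has mean zero, and cosh (l G) is at most exp ((l c)^2 / 2).\<close>

lemma exp_moment_martingale:
  fixes G :: "nat \<Rightarrow> 'w \<Rightarrow> real"
  assumes G: "\<And>p. prime p \<Longrightarrow> depends_on {q. prime q \<and> q < p} (G p)"
    and bound: "\<And>p \<omega>. prime p \<Longrightarrow> y < p \<Longrightarrow> \<omega> \<in> space M \<Longrightarrow> \<bar>G p \<omega>\<bar> \<le> c p"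
  shows "expectation (\<lambda>\<omega>. exp (- l * (\<Sum>p | prime p \<and> y < p \<and> p < N. f p \<omega> * G p \<omega>)))
      \<le> exp (\<Sum>p | prime p \<and> y < p \<and> p < N. (l * c p) ^ 2 / 2)"
proof (induction N)
  case 0
  then show ?case by (simp add: prob_space)
next
  case (Suc N)
  define A where "A K = {p. prime p \<and> y < p \<and> p < K}" for K
  have finA: "finite (A K)" for K by (rule finite_subset[of _ "{..<K}"]) (auto simp: A_def)
  show ?case
  proof (cases "prime N \<and> y < N")
    case False
    then have "A (Suc N) = A N" by (auto simp: A_def less_Suc_eq)
    then show ?thesis using Suc by (simp add: A_def)
  next
    case True
    then have AS: "A (Suc N) = insert N (A N)" "N \<notin> A N" by (auto simp: A_def less_Suc_eq)
    define Q where "Q = {q. prime q \<and> q < N}"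
    have Q: "finite Q" "\<And>q. q \<in> Q \<Longrightarrow> prime q" "N \<notin> Q"
      by (auto simp: Q_def intro: finite_subset[of _ "{..<N}"])
    define Z where "Z \<omega> = exp (- l * (\<Sum>p\<in>A N. f p \<omega> * G p \<omega>))" for \<omega>
    have Gd: "depends_on Q (G N)" using G True by (simp add: Q_def)
    have Zd: "depends_on Q Z"
      unfolding depends_on_def
    proof (intro ballI impI)
      fix \<omega> \<omega>' assume *: "\<omega> \<in> space M" "\<omega>' \<in> space M" "\<forall>q\<in>Q. f q \<omega> = f q \<omega>'"
      have "f p \<omega> * G p \<omega> = f p \<omega>' * G p \<omega>'" if "p \<in> A N" for p
      proof -
        have p: "prime p" "p \<in> Q" "{q. prime q \<and> q < p} \<subseteq> Q" using that by (auto simp: A_def Q_def)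
        have "G p \<omega> = G p \<omega>'" using G[OF p(1)] * p(3) unfolding depends_on_def by blast
        then show ?thesis using * p(2) by simp
      qed
      then show "Z \<omega> = Z \<omega>'" by (simp add: Z_def)
    qed
    have d1: "depends_on Q (\<lambda>\<omega>. Z \<omega> * cosh (l * G N \<omega>))" and d2: "depends_on Q (\<lambda>\<omega>. Z \<omega> * sinh (l * G N \<omega>))"
      using Gd Zd unfolding depends_on_def by metis+
    have iNQ: "depends_on (insert N Q) (\<lambda>\<omega>. f N \<omega> * (Z \<omega> * sinh (l * G N \<omega>)))"
      using d2 unfolding depends_on_def by (metis insertCI)
    have int2: "integrable M (\<lambda>\<omega>. f N \<omega> * (Z \<omega> * sinh (l * G N \<omega>)))"
      by (rule depends_on_integrable[OF _ _ iNQ]) (use Q True in auto)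
    note int1 = depends_on_integrable[OF Q(1,2) d1]
    have step: "exp (- l * (\<Sum>p\<in>A (Suc N). f p \<omega> * G p \<omega>)) = Z \<omega> * cosh (l * G N \<omega>) - f N \<omega> * (Z \<omega> * sinh (l * G N \<omega>))"
      if \<omega>: "\<omega> \<in> space M" for \<omega>
    proof -
      have "- l * (\<Sum>p\<in>A (Suc N). f p \<omega> * G p \<omega>) = - l * (\<Sum>p\<in>A N. f p \<omega> * G p \<omega>) + - (f N \<omega> * (l * G N \<omega>))"
        unfolding AS(1) using AS(2) finA by (simp add: algebra_simps)
      then have "exp (- l * (\<Sum>p\<in>A (Suc N). f p \<omega> * G p \<omega>)) = Z \<omega> * exp (- (f N \<omega> * (l * G N \<omega>)))"
        by (simp only: exp_add Z_def)
      also have "exp (- (f N \<omega> * (l * G N \<omega>))) = cosh (l * G N \<omega>) - f N \<omega> * sinh (l * G N \<omega>)"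
        using prime_values[of N \<omega>] True \<omega> by (auto simp: cosh_minus_sinh cosh_plus_sinh)
      finally show ?thesis by (simp add: algebra_simps)
    qed
    have "expectation (\<lambda>\<omega>. exp (- l * (\<Sum>p\<in>A (Suc N). f p \<omega> * G p \<omega>))) =
      expectation (\<lambda>\<omega>. Z \<omega> * cosh (l * G N \<omega>) - f N \<omega> * (Z \<omega> * sinh (l * G N \<omega>)))"
      by (intro Bochner_Integration.integral_cong refl step)
    also have "\<dots> = expectation (\<lambda>\<omega>. Z \<omega> * cosh (l * G N \<omega>))"
      using expectation_f_times_depends_on[OF Q(1,2) d2 _ Q(3)] True int1 int2
      by (simp add: Bochner_Integration.integral_diff)
    also have "\<dots> \<le> expectation (\<lambda>\<omega>. Z \<omega> * exp ((l * c N) ^ 2 / 2))"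
    proof (intro integral_mono int1 integrable_mult_left depends_on_integrable[OF Q(1,2) Zd] mult_left_mono)
      fix \<omega> assume \<omega>: "\<omega> \<in> space M"
      have "\<bar>G N \<omega>\<bar> \<le> \<bar>c N\<bar>" using bound[of N \<omega>] True \<omega> by linarith
      then have "(l * G N \<omega>) ^ 2 \<le> (l * c N) ^ 2"
        unfolding power_mult_distrib by (intro mult_left_mono) (auto simp: abs_le_square_iff)
      then show "cosh (l * G N \<omega>) \<le> exp ((l * c N) ^ 2 / 2)"
        by (intro order_trans[OF cosh_le_exp_square]) simp
    qed (auto simp: Z_def)
    also have "\<dots> = expectation Z * exp ((l * c N) ^ 2 / 2)" by simp
    also have "\<dots> \<le> exp (\<Sum>p\<in>A N. (l * c p) ^ 2 / 2) * exp ((l * c N) ^ 2 / 2)"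
      using Suc by (intro mult_right_mono) (auto simp: Z_def[abs_def] A_def)
    also have "\<dots> = exp (\<Sum>p\<in>A (Suc N). (l * c p) ^ 2 / 2)"
      unfolding AS(1) using AS(2) finA by (simp add: exp_add[symmetric] add.commute)
    finally show ?thesis by (simp add: A_def)
  qed
qed

text \<open>A non-smooth n has largest prime factor p > y. If p divides it exactly once, n belongs
  to \<open>B p\<close>, where n/p involves only primes below p, as the martingale requires.
  Otherwise n = p^2 a, and all such n together weigh at most \<Sum> 1/k^2 over k > y times \<Sum>
  1/a over a < N.\<close>

lemma partial_sum_decomposition:
  fixes A :: "nat set"
  assumes \<omega>: "\<omega> \<in> space M" and y: "y \<ge> 1" and N: "N \<ge> 1"
  defines "B \<equiv> \<lambda>p. {n. n \<in> A \<and> 1 \<le> n \<and> n < N \<and> p dvd n \<and> \<not> p ^ 2 dvd n \<and> prime_factors n \<subseteq> {..p}}"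
  shows "(\<Sum>n | n \<in> A \<and> n \<in> smooth (primes_atMost y) \<and> n < N. f n \<omega> / real n)
      + (\<Sum>p | prime p \<and> y < p \<and> p < N. \<Sum>n\<in>B p. f n \<omega> / real n) - (1 + ln (real N)) / real y
      \<le> partial_sum A N \<omega>"
proof -
  define I where "I = {n. n \<in> A \<and> 1 \<le> n \<and> n < N}"
  define I0 where "I0 = {n. n \<in> A \<and> n \<in> smooth (primes_atMost y) \<and> n < N}"
  define P where "P = {p. prime p \<and> y < p \<and> p < N}"
  define R where "R = I - I0 - (\<Union>p\<in>P. B p)"
  have finI: "finite I" unfolding I_def by (rule finite_range_below)
  have finP: "finite P" by (rule finite_subset[of _ "{..<N}"]) (auto simp: P_def)
  have subs: "I0 \<subseteq> I" "B p \<subseteq> I" "R \<subseteq> I" for p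
    by (auto simp: I_def I0_def B_def R_def smooth_def)
  have fins: "finite I0" "finite (B p)" "finite R" for p
    using subs finI finite_subset by blast+
  have disj: "B p \<inter> B q = {}" if "p \<in> P" "q \<in> P" "p \<noteq> q" for p q
  proof (rule ccontr)
    assume "B p \<inter> B q \<noteq> {}"
    then obtain n where n: "n \<in> B p" "n \<in> B q" by blast
    then have "p \<in> prime_factors n" "q \<in> prime_factors n" using that by (auto simp: B_def P_def in_prime_factors_iff)
    then have "p \<le> q" "q \<le> p" using n by (auto simp: B_def)
    then show False using that by simp
  qed
  have disj0: "I0 \<inter> (\<Union>p\<in>P. B p) = {}"
  proof (rule ccontr)
    assume "I0 \<inter> (\<Union>p\<in>P. B p) \<noteq> {}"
    then obtain n p where n: "n \<in> I0" "p \<in> P" "n \<in> B p" by blast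
    then have "p \<in> prime_factors n" by (auto simp: B_def P_def in_prime_factors_iff)
    then have "p \<le> y" using n(1) by (auto simp: I0_def smooth_def)
    then show False using n(2) by (simp add: P_def)
  qed
  have I: "I = I0 \<union> (\<Union>p\<in>P. B p) \<union> R" using subs by (auto simp: R_def)
  have "partial_sum A N \<omega> = (\<Sum>n\<in>I. f n \<omega> / real n)" by (simp add: partial_sum_def I_def)
  also have "\<dots> = (\<Sum>n\<in>I0 \<union> (\<Union>p\<in>P. B p). f n \<omega> / real n) + (\<Sum>n\<in>R. f n \<omega> / real n)"
    by (subst I, rule sum.union_disjoint) (use fins finP in \<open>auto simp: R_def\<close>)
  also have "(\<Sum>n\<in>I0 \<union> (\<Union>p\<in>P. B p). f n \<omega> / real n) = (\<Sum>n\<in>I0. f n \<omega> / real n) + (\<Sum>n\<in>(\<Union>p\<in>P. B p). f n \<omega> / real n)"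
    using fins finP disj0 by (intro sum.union_disjoint) auto
  also have "(\<Sum>n\<in>(\<Union>p\<in>P. B p). f n \<omega> / real n) = (\<Sum>p\<in>P. \<Sum>n\<in>B p. f n \<omega> / real n)"
    using finP fins disj by (intro sum.UNION_disjoint) auto
  finally have eq: "partial_sum A N \<omega> = (\<Sum>n\<in>I0. f n \<omega> / real n) + (\<Sum>p\<in>P. \<Sum>n\<in>B p. f n \<omega> / real n) + (\<Sum>n\<in>R. f n \<omega> / real n)" .
  have "(\<Sum>n\<in>R. - (f n \<omega> / real n)) \<le> (\<Sum>n\<in>R. 1 / real n)"
  proof (rule sum_mono)
    fix n assume "n \<in> R"
    then have "n > 0" using subs by (auto simp: I_def)
    then have "f n \<omega> \<in> {1, -1}" using f_values \<omega> by blast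
    then show "- (f n \<omega> / real n) \<le> 1 / real n" by auto
  qed
  also have "\<dots> \<le> (\<Sum>n\<in>(\<lambda>(k, a). k ^ 2 * a) ` ({y<..<N} \<times> {1..<N}). 1 / real n)"
  proof (rule sum_mono2)
    show "R \<subseteq> (\<lambda>(k, a). k ^ 2 * a) ` ({y<..<N} \<times> {1..<N})"
    proof
      fix n assume n: "n \<in> R"
      then have nI: "n \<in> A" "1 \<le> n" "n < N" using subs by (auto simp: I_def)
      have "n \<notin> I0" using n by (simp add: R_def)
      then obtain q where q: "q \<in> prime_factors n" "\<not> q \<le> y"
        using nI by (auto simp: I0_def smooth_def)
      define p where "p = Max (prime_factors n)"
      have p: "p \<in> prime_factors n" unfolding p_def using q(1) by (intro Max_in) auto
      have max: "prime_factors n \<subseteq> {..p}" unfolding p_def by auto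
      have "q \<le> p" using max q(1) by auto
      then have py: "y < p" using q(2) by simp
      have pd: "prime p" "p dvd n" using p by (auto simp: in_prime_factors_iff)
      have "p \<le> n" using pd nI by (intro dvd_imp_le) auto
      then have "p \<in> P" using pd py nI by (auto simp: P_def)
      then have "n \<notin> B p" using n by (auto simp: R_def)
      then have "p ^ 2 dvd n" using nI pd max by (auto simp: B_def)
      then obtain a where a: "n = p ^ 2 * a" by (auto elim: dvdE)
      have "a \<ge> 1" using a nI by (cases a) auto
      moreover have "a \<le> n" using a prime_gt_0_nat[OF pd(1)] by simp
      then have "a < N" using nI(3) by (rule le_less_trans)
      ultimately show "n \<in> (\<lambda>(k, a). k ^ 2 * a) ` ({y<..<N} \<times> {1..<N})"
        using a py \<open>p \<le> n\<close> nI by (intro image_eqI[of _ _ "(p, a)"]) auto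
    qed
  qed auto
  also have "\<dots> \<le> (\<Sum>z\<in>{y<..<N} \<times> {1..<N}. 1 / real ((\<lambda>(k, a). k ^ 2 * a) z))"
    by (rule order_trans[OF sum_image_le]) (auto simp: o_def)
  also have "\<dots> = (\<Sum>k\<in>{y<..<N}. 1 / real k ^ 2) * (\<Sum>a\<in>{1..<N}. 1 / real a)"
    by (simp add: sum_product sum.cartesian_product case_prod_unfold)
  also have "\<dots> \<le> (1 / real y) * (1 + ln (real N))"
    using sum_inverse_squares_tail[OF y] sum_inverse_le_ln[OF N] by (intro mult_mono) (auto intro!: sum_nonneg)
  finally have "- (\<Sum>n\<in>R. f n \<omega> / real n) \<le> (1 + ln (real N)) / real y" by (simp add: sum_negf)
  then show ?thesis unfolding eq by (simp add: I0_def P_def)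
qed

text \<open>Chernoff's bound: a negative partial sum forces the rough part below -\<epsilon>, where
  \<epsilon> is the bracket multiplied by l. The increments are at most (1 + ln N)/p, and the sum of
  1/p^2 over p > y is at most 1/y.\<close>

lemma prob_partial_sum_neg_le:
  assumes m: "m > 0" and S: "S \<subseteq> totatives m" "S \<noteq> {}"
    and coeffs: "\<And>\<psi>. dirichlet_character m \<psi> \<Longrightarrow>
              (if real_character \<psi> then char_coeff m S \<psi> \<in> \<real>\<^sub>\<ge>\<^sub>0 else char_coeff m S \<psi> = 0)"
    and y: "y \<ge> 9" and N: "N \<ge> 1" and l: "l \<ge> 0"
  shows "prob {\<omega> \<in> space M. partial_sum (residue_class_set m S) N \<omega> < 0} \<le>
    exp (l ^ 2 * (1 + ln (real N)) ^ 2 / (2 * real y)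
      - l * (1 / real (card (characters m)) / (1 + ln (real y)) ^ 3
             - (1 + ln (real y)) ^ 36 * real N powr - (1 / ln (real y)) - (1 + ln (real N)) / real y))"
    (is "?p \<le> exp (_ - l * ?\<epsilon>)")
proof -
  let ?A = "residue_class_set m S"
  define H where "H = 1 + ln (real N)"
  have H: "H \<ge> 0" using N by (simp add: H_def add_nonneg_nonneg)
  define P where "P = {p. prime p \<and> y < p \<and> p < N}"
  have finP: "finite P" by (rule finite_subset[of _ "{..<N}"]) (auto simp: P_def)
  define B where "B p = {n. n \<in> ?A \<and> 1 \<le> n \<and> n < N \<and> p dvd n \<and> \<not> p ^ 2 dvd n \<and> prime_factors n \<subseteq> {..p}}" for p
  have finB: "finite (B p)" for p by (rule finite_subset[of _ "{..<N}"]) (auto simp: B_def)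
  define G where "G p \<omega> = (\<Sum>n\<in>B p. f (n div p) \<omega> / real n)" for p \<omega>
  have quot: "n div p > 0" "n = p * (n div p)" "prime_factors (n div p) \<subseteq> {q. prime q \<and> q < p}"
    if "n \<in> B p" "prime p" for n p
  proof -
    show eq: "n = p * (n div p)" using that by (simp add: B_def)
    show pos: "n div p > 0" using that eq by (intro gr0I) (auto simp: B_def)
    show "prime_factors (n div p) \<subseteq> {q. prime q \<and> q < p}"
    proof
      fix q assume q: "q \<in> prime_factors (n div p)"
      have "n div p dvd n" using eq by (metis dvd_triv_right)
      then have "q \<in> prime_factors n" using q that by (auto simp: in_prime_factors_iff B_def intro: dvd_trans)
      then have "q \<le> p" using that by (auto simp: B_def)
      \<comment> \<open>Here the exclusion of multiples of p^2 is used.\<close>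
      moreover have "q \<noteq> p"
      proof
        assume "q = p"
        then have "p dvd n div p" using q by (simp add: in_prime_factors_iff)
        then have "p * p dvd p * (n div p)" by (rule mult_dvd_mono[OF dvd_refl])
        then show False using that eq by (simp add: B_def power2_eq_square)
      qed
      ultimately show "q \<in> {q. prime q \<and> q < p}" using q by (auto simp: in_prime_factors_iff)
    qed
  qed
  have fG: "(\<Sum>n\<in>B p. f n \<omega> / real n) = f p \<omega> * G p \<omega>" if "prime p" "\<omega> \<in> space M" for p \<omega>
    unfolding G_def sum_distrib_left
  proof (rule sum.cong[OF refl])
    fix n assume n: "n \<in> B p"
    have "f n \<omega> = f p \<omega> * f (n div p) \<omega>"
      using quot[OF n that(1)] f_mult[of p "n div p" \<omega>] that prime_gt_0_nat by metis
    then show "f n \<omega> / real n = f p \<omega> * (f (n div p) \<omega> / real n)" by simp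
  qed
  have Gdep: "depends_on {q. prime q \<and> q < p} (G p)" if "prime p" for p
    unfolding depends_on_def
  proof (intro ballI impI)
    fix \<omega> \<omega>' assume *: "\<omega> \<in> space M" "\<omega>' \<in> space M" "\<forall>q\<in>{q. prime q \<and> q < p}. f q \<omega> = f q \<omega>'"
    have "f (n div p) \<omega> = f (n div p) \<omega>'" if "n \<in> B p" for n
      using depends_on_f[OF quot(1)[OF that \<open>prime p\<close>] quot(3)[OF that \<open>prime p\<close>]] *
      unfolding depends_on_def by blast
    then show "G p \<omega> = G p \<omega>'" unfolding G_def by (intro sum.cong) auto
  qed
  have Gbound: "\<bar>G p \<omega>\<bar> \<le> H / real p" if "prime p" "y < p" "\<omega> \<in> space M" for p \<omega>
  proof -
    have p0: "p > 0" using prime_gt_0_nat[OF that(1)] .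
    have "\<bar>G p \<omega>\<bar> \<le> (\<Sum>n\<in>B p. \<bar>f (n div p) \<omega> / real n\<bar>)" unfolding G_def by (rule sum_abs)
    also have "\<dots> = (\<Sum>n\<in>B p. 1 / real n)"
      using abs_f quot(1) that by (intro sum.cong) auto
    also have "\<dots> \<le> (\<Sum>n\<in>(\<lambda>a. p * a) ` {1..<N}. 1 / real n)"
    proof (rule sum_mono2)
      show "B p \<subseteq> (\<lambda>a. p * a) ` {1..<N}"
      proof
        fix n assume n: "n \<in> B p"
        have "n < N" using n by (auto simp: B_def)
        with div_le_dividend have "n div p < N" by (rule le_less_trans)
        then show "n \<in> (\<lambda>a. p * a) ` {1..<N}"
          using quot(1,2)[OF n that(1)] by (intro image_eqI[of _ _ "n div p"]) auto
      qed
    qed auto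
    also have "\<dots> = (\<Sum>a\<in>{1..<N}. 1 / real a) / real p"
      using p0 by (subst sum.reindex) (auto simp: inj_on_def sum_divide_distrib mult.commute)
    also have "\<dots> \<le> H / real p"
      unfolding H_def by (intro divide_right_mono sum_inverse_le_ln N) auto
    finally show ?thesis .
  qed
  define T where "T \<omega> = (\<Sum>p\<in>P. f p \<omega> * G p \<omega>)" for \<omega>
  have Tdep: "depends_on {q. prime q \<and> q < N} T"
    unfolding depends_on_def
  proof (intro ballI impI)
    fix \<omega> \<omega>' assume *: "\<omega> \<in> space M" "\<omega>' \<in> space M" "\<forall>q\<in>{q. prime q \<and> q < N}. f q \<omega> = f q \<omega>'"
    have "f p \<omega> * G p \<omega> = f p \<omega>' * G p \<omega>'" if "p \<in> P" for p
    proof -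
      have p: "prime p" "p < N" using that by (auto simp: P_def)
      have "G p \<omega> = G p \<omega>'"
        by (rule depends_onD[OF Gdep[OF p(1)] *(1,2)]) (use *(3) p(2) in auto)
      then show ?thesis using * p by simp
    qed
    then show "T \<omega> = T \<omega>'" by (simp add: T_def)
  qed
  have intE: "integrable M (\<lambda>\<omega>. exp (- l * T \<omega>))"
  proof (rule depends_on_integrable)
    show "depends_on {q. prime q \<and> q < N} (\<lambda>\<omega>. exp (- l * T \<omega>))"
      using Tdep unfolding depends_on_def by metis
    show "finite {q. prime q \<and> q < N}" by (rule finite_subset[of _ "{..<N}"]) auto
  qed auto
  have impl: "exp (l * ?\<epsilon>) \<le> exp (- l * T \<omega>)" if \<omega>: "\<omega> \<in> space M" "partial_sum ?A N \<omega> < 0" for \<omega>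
  proof -
    have "(\<Sum>p\<in>P. \<Sum>n\<in>B p. f n \<omega> / real n) = T \<omega>"
      unfolding T_def using fG \<omega> by (intro sum.cong) (auto simp: P_def)
    then have "(\<Sum>n | n \<in> ?A \<and> n \<in> smooth (primes_atMost y) \<and> n < N. f n \<omega> / real n) + T \<omega> - (1 + ln (real N)) / real y < 0"
      using partial_sum_decomposition[OF \<omega>(1), of y N ?A] y N \<omega>(2) by (simp add: P_def B_def)
    then have "?\<epsilon> \<le> - T \<omega>"
      using smooth_sum_lower_bound[OF m S \<omega>(1) coeffs y N] by linarith
    then have "l * ?\<epsilon> \<le> l * - T \<omega>" using l by (rule mult_left_mono)
    then show ?thesis by simp
  qed
  define E where "E = {\<omega> \<in> space M. partial_sum ?A N \<omega> < 0}"
  have E: "E \<in> sets M" unfolding E_def using partial_sum_measurable[of ?A N] by measurable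
  have "?p * exp (l * ?\<epsilon>) = expectation (\<lambda>\<omega>. indicator E \<omega> * exp (l * ?\<epsilon>))"
    using E by (simp add: E_def[symmetric] Int_absorb1 sets.sets_into_space)
  also have "\<dots> \<le> expectation (\<lambda>\<omega>. exp (- l * T \<omega>))"
  proof (rule integral_mono)
    show "integrable M (\<lambda>\<omega>. indicator E \<omega> * exp (l * ?\<epsilon>))" using E by (simp add: less_top[symmetric])
    show "indicator E \<omega> * exp (l * ?\<epsilon>) \<le> exp (- l * T \<omega>)" if "\<omega> \<in> space M" for \<omega>
      using impl[OF that] that by (cases "\<omega> \<in> E") (auto simp: E_def)
  qed (rule intE)
  also have "\<dots> \<le> exp (\<Sum>p\<in>P. (l * (H / real p)) ^ 2 / 2)"
    unfolding T_def P_def by (rule exp_moment_martingale[OF Gdep Gbound])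
  also have "\<dots> \<le> exp (l ^ 2 * H ^ 2 / (2 * real y))"
  proof -
    have "(\<Sum>p\<in>P. (l * (H / real p)) ^ 2 / 2) = l ^ 2 * H ^ 2 / 2 * (\<Sum>p\<in>P. 1 / real p ^ 2)"
      by (simp add: sum_distrib_left power_mult_distrib power_divide mult.commute)
    also have "\<dots> \<le> l ^ 2 * H ^ 2 / 2 * (1 / real y)"
    proof (intro mult_left_mono)
      have "(\<Sum>p\<in>P. 1 / real p ^ 2) \<le> (\<Sum>k\<in>{y<..<N}. 1 / real k ^ 2)"
        by (intro sum_mono2) (auto simp: P_def)
      also have "\<dots> \<le> 1 / real y" using y by (intro sum_inverse_squares_tail) simp
      finally show "(\<Sum>p\<in>P. 1 / real p ^ 2) \<le> 1 / real y" .
    qed auto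
    finally show ?thesis by simp
  qed
  finally have "?p * exp (l * ?\<epsilon>) \<le> exp (l ^ 2 * H ^ 2 / (2 * real y))" .
  then have "?p \<le> exp (l ^ 2 * H ^ 2 / (2 * real y)) / exp (l * ?\<epsilon>)"
    by (simp add: le_divide_eq)
  then show ?thesis by (simp only: exp_diff[symmetric] H_def)
qed

end

text \<open>Here L = ln x and exp (- (50 * ln L)) = L^(-50), so the Rankin term is of order L^(-14)
  against the main term L^(-3). Further, sqrt (exp (L / (50 ln L))) = exp (L / (100 ln L)) outgrows
  exp (L / (400 ln L)) by more than any power of L. The -1 makes room for rounding the smoothness
  bound to an integer.\<close>

lemma eventually_exponent_bound:
  fixes c :: real
  assumes c: "c > 0"
  shows "eventually (\<lambda>L. 
     0 \<le> c / (1 + L) ^ 3 - (1 + L) ^ 36 * exp (- (50 * ln L)) - (2 + L) / (exp (L / (50 * ln L)) - 1) \<and>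
     (2 + L) ^ 2 / 2 - sqrt (exp (L / (50 * ln L)) - 1) * 
       (c / (1 + L) ^ 3 - (1 + L) ^ 36 * exp (- (50 * ln L)) - (2 + L) / (exp (L / (50 * ln L)) - 1))
     \<le> - exp (L / (400 * ln L)) \<and> exp (L / (50 * ln L)) \<ge> 11 \<and> ln L \<ge> 1) at_top"
proof (intro eventually_conj)
  show "eventually (\<lambda>L. 0 \<le> c / (1 + L) ^ 3 - (1 + L) ^ 36 * exp (- (50 * ln L)) - (2 + L) / (exp (L / (50 * ln L)) - 1)) at_top"
    using c by real_asymp
  show "eventually (\<lambda>L::real. exp (L / (50 * ln L)) \<ge> 11) at_top" by real_asymp
  show "eventually (\<lambda>L::real. ln L \<ge> 1) at_top" by real_asymp
  show "eventually (\<lambda>L. (2 + L) ^ 2 / 2 - sqrt (exp (L / (50 * ln L)) - 1) * 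
       (c / (1 + L) ^ 3 - (1 + L) ^ 36 * exp (- (50 * ln L)) - (2 + L) / (exp (L / (50 * ln L)) - 1))
     \<le> - exp (L / (400 * ln L))) at_top"
    using c by real_asymp
qed

context random_completely_multiplicative
begin

theorem prob_negative_bigo:
  assumes m: "m > 0" and S: "S \<subseteq> totatives m" "S \<noteq> {}"
    and coeffs: "\<And>\<psi>. dirichlet_character m \<psi> \<Longrightarrow>
              (if real_character \<psi> then char_coeff m S \<psi> \<in> \<real>\<^sub>\<ge>\<^sub>0 else char_coeff m S \<psi> = 0)"
  shows "\<exists>C>0. prob_negative M f (residue_class_set m S)
                   \<in> O[at_top](\<lambda>x. exp (- exp (ln x / (C * ln (ln x)))))"
proof (intro exI[of _ 400] conjI)
  define c where "c = 1 / real (card (characters m))"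
  have c: "c > 0" using card_characters_pos[OF m] by (simp add: c_def)
  have "eventually (\<lambda>x. norm (prob_negative M f (residue_class_set m S) x) \<le> 1 * norm (exp (- exp (ln x / (400 * ln (ln x)))))) at_top"
    using eventually_compose_filterlim[OF eventually_exponent_bound[OF c] ln_at_top] eventually_ge_at_top[of 1]
  proof eventually_elim
    case (elim x)
    define L where "L = ln x"
    define Y where "Y = exp (L / (50 * ln L))"
    define e0 where "e0 = c / (1 + L) ^ 3 - (1 + L) ^ 36 * exp (- (50 * ln L)) - (2 + L) / (Y - 1)"
    have e0: "0 \<le> e0" and main: "(2 + L) ^ 2 / 2 - sqrt (Y - 1) * e0 \<le> - exp (L / (400 * ln L))"
      and Y: "Y \<ge> 11" and lL: "ln L \<ge> 1"
      using elim by (auto simp: e0_def L_def Y_def)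
    have x: "x \<ge> 1" using elim by simp
    then have L0: "L \<ge> 0" by (simp add: L_def)
    have Lpos: "L > 0" using L0 lL by (cases "L = 0") auto
    define y where "y = nat \<lfloor>Y\<rfloor>"
    define N where "N = nat \<lceil>x\<rceil>"
    have y: "y \<ge> 9" "real y \<le> Y" "Y - 1 \<le> real y"
      using Y unfolding y_def by linarith+
    have N: "N \<ge> 1" "x \<le> real N" "real N \<le> x + 1" using x unfolding N_def by linarith+
    have lny: "0 < ln (real y)" "ln (real y) \<le> L / (50 * ln L)"
    proof -
      show "0 < ln (real y)" using y by simp
      have "ln (real y) \<le> ln Y" using y by (subst ln_le_cancel_iff) auto
      then show "ln (real y) \<le> L / (50 * ln L)" by (simp add: Y_def)
    qed
    have lnyL: "ln (real y) \<le> L"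
    proof -
      have "ln (real y) * 1 \<le> ln (real y) * (50 * ln L)" using lny(1) lL by (intro mult_left_mono) auto
      also have "\<dots> \<le> L" using lny(2) lL by (simp add: le_divide_eq)
      finally show ?thesis by simp
    qed
    have lnN: "0 \<le> ln (real N)" "ln (real N) \<le> 1 + L"
    proof -
      show "0 \<le> ln (real N)" using N by simp
      have "real N \<le> exp 1 * x" using N(3) x exp_ge_add_one_self[of "1::real"] mult_right_mono[of 2 "exp 1" x] by linarith
      then have "ln (real N) \<le> ln (exp 1 * x)" using N x by (subst ln_le_cancel_iff) auto
      then show "ln (real N) \<le> 1 + L" using x by (simp add: L_def ln_mult)
    qed
    define eps where "eps = c / (1 + ln (real y)) ^ 3 - (1 + ln (real y)) ^ 36 * real N powr - (1 / ln (real y)) - (1 + ln (real N)) / real y"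
    have e0eps: "e0 \<le> eps"
      unfolding e0_def eps_def
    proof (intro diff_mono)
      show "c / (1 + L) ^ 3 \<le> c / (1 + ln (real y)) ^ 3"
        using c lny(1) lnyL by (intro divide_left_mono power_mono mult_pos_pos zero_less_power) auto
      \<comment> \<open>The smoothness level was chosen for this estimate: ln x / ln y \<ge> 50 ln
        L.\<close>
      have "real N powr - (1 / ln (real y)) \<le> x powr - (1 / ln (real y))"
        using N x lny(1) by (intro powr_mono2') auto
      also have "\<dots> = exp (- (L / ln (real y)))" using x by (simp add: powr_def L_def)
      also have "\<dots> \<le> exp (- (50 * ln L))"
      proof -
        have "ln (real y) * (50 * ln L) \<le> L" using lny(2) lL by (simp add: le_divide_eq)
        then show ?thesis using lny(1) by (simp add: le_divide_eq mult.commute)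
      qed
      finally show "(1 + ln (real y)) ^ 36 * real N powr - (1 / ln (real y)) \<le> (1 + L) ^ 36 * exp (- (50 * ln L))"
        using lny(1) lnyL by (intro mult_mono power_mono) auto
      show "(1 + ln (real N)) / real y \<le> (2 + L) / (Y - 1)"
        using lnN y Y by (intro frac_le) auto
    qed
    \<comment> \<open>The choice l = sqrt y cancels y in the quadratic term, leaving only (1 + ln
      N)^2 / 2, while the linear gain still grows like sqrt y.\<close>
    have "prob_negative M f (residue_class_set m S) x \<le>
       exp (sqrt (real y) ^ 2 * (1 + ln (real N)) ^ 2 / (2 * real y) - sqrt (real y) * eps)"
      using prob_partial_sum_neg_le[OF m S coeffs y(1) N(1), of "sqrt (real y)"]
      unfolding prob_negative_eq N_def[symmetric] eps_def c_def by simp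
    also have "sqrt (real y) ^ 2 * (1 + ln (real N)) ^ 2 / (2 * real y) - sqrt (real y) * eps \<le> (2 + L) ^ 2 / 2 - sqrt (Y - 1) * e0"
    proof (intro diff_mono)
      have "sqrt (real y) ^ 2 * (1 + ln (real N)) ^ 2 / (2 * real y) = (1 + ln (real N)) ^ 2 / 2" using y by simp
      also have "\<dots> \<le> (2 + L) ^ 2 / 2" using lnN by (intro divide_right_mono power_mono) auto
      finally show "sqrt (real y) ^ 2 * (1 + ln (real N)) ^ 2 / (2 * real y) \<le> (2 + L) ^ 2 / 2" .
      show "sqrt (Y - 1) * e0 \<le> sqrt (real y) * eps"
        using y e0 e0eps Y by (intro mult_mono) auto
    qed
    also note main
    finally show ?case by (simp add: prob_negative_def L_def)
  qed
  then show "prob_negative M f (residue_class_set m S) \<in> O[at_top](\<lambda>x. exp (- exp (ln x / (400 * ln (ln x)))))"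
    by (rule bigoI)
qed simp

end

theorem theorem1p1:
  fixes m :: nat and S :: "nat set" and M :: "'w measure" and f :: "nat \<Rightarrow> 'w \<Rightarrow> real"
  assumes "m > 0"
    and "S \<subseteq> totatives m"
    and "S \<noteq> {}"
    and "random_completely_multiplicative M f"
  shows "(\<not> (\<forall>\<psi>. dirichlet_character m \<psi> \<longrightarrow>
              (if real_character \<psi> then char_coeff m S \<psi> \<in> \<real>\<^sub>\<ge>\<^sub>0 else char_coeff m S \<psi> = 0))
           \<longrightarrow> (\<exists>\<delta>>0. \<exists>x0::real. \<forall>x\<ge>x0. prob_negative M f (residue_class_set m S) x > \<delta>)) \<and>
         ((\<forall>\<psi>. dirichlet_character m \<psi> \<longrightarrow>
              (if real_character \<psi> then char_coeff m S \<psi> \<in> \<real>\<^sub>\<ge>\<^sub>0 else char_coeff m S \<psi> = 0))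
           \<longrightarrow> (\<exists>C>0. prob_negative M f (residue_class_set m S)
                   \<in> O[at_top](\<lambda>x. exp (- exp (ln x / (C * ln (ln x)))))))"
  using random_completely_multiplicative.prob_negative_bounded_below[OF assms(4,1,2)]
    random_completely_multiplicative.prob_negative_bigo[OF assms(4,1,2,3)]
  by blast

end
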